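(* Let $\mu_0\in\mathcal P(\mathbb R^{d_0})$ and $\mu_1\in\mathcal P(\mathbb R^{d_1})$ be compactly supported and let $\varepsilon>0$. The map $\Phi:A\in\mathbb R^{d_0\times d_1}\mapsto 32\|A\|_F^2+\mathrm{OT}_{A,\varepsilon}(\mu_0,\mu_1)$ is smooth, coercive, and has first- and second-order Fréchet derivatives at $A\in\mathbb R^{d_0\times d_1}$ given by \[ D\Phi_{[A]}(B)=64\,\mathrm{tr}(A^{\intercal}B)-32\int x^{\intercal}By\,d\pi_A(x,y), \] \[ D^2\Phi_{[A]}(B,C)=64\,\mathrm{tr}(B^{\intercal}C)+32\varepsilon^{-1}\int x^{\intercal}By\left(h_0^{A,C}(x)+h_1^{A,C}(y)-32x^{\intercal}Cy\right)d\pi_A(x,y), \] where $B,C\in\mathbb R^{d_0\times d_1}$, $\pi_A$ is the unique optimal coupling for $\mathrm{OT}_{A,\varepsilon}(\mu_0,\mu_1)$, and $(h_0^{A,C},h_1^{A,C})$ is the unique (up to additive constants, i.e. up to replacing it by $(h_0^{A,C}+a,h_1^{A,C}-a)$, $a\in\mathbb R$) pair of functions in $\mathcal C(\mathrm{spt}(\mu_0))\times\mathcal C(\mathrm{spt}(\mu_1))$ satisfying \[ \int\left(h_0^{A,C}(x)+h_1^{A,C}(y)-32x^{\intercal}Cy\right)e^{\frac{\varphi_0^{A}(x)+\varphi_1^{A}(y)-c_{A}(x,y)}{\varepsilon}}d\mu_1(y)=0\quad\text{for all }x\in\mathrm{spt}(\mu_0), \] \[ \int\left(h_0^{A,C}(x)+h_1^{A,C}(y)-32x^{\intercal}Cy\right)e^{\frac{\varphi_0^{A}(x)+\varphi_1^{A}(y)-c_{A}(x,y)}{\varepsilon}}d\mu_0(x)=0\quad\text{for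 all }y\in\mathrm{spt}(\mu_1). \] Here $(\varphi_0^A,\varphi_1^A)$ is any pair of EOT potentials for $\mathrm{OT}_{A,\varepsilon}(\mu_0,\mu_1)$.
   Context: $\Pi(\mu_0,\mu_1)$ is the set of couplings of $\mu_0,\mu_1$; $\mathrm{spt}$ denotes support; $\mathcal C(S)$ is the space of continuous functions on $S$; $\|\cdot\|_F$ is the Frobenius norm. $\mathsf D_{\mathsf{KL}}(\mu\|\nu)=\int\log(d\mu/d\nu)\,d\mu$ if $\mu\ll\nu$ and $+\infty$ otherwise. For $A\in\mathbb R^{d_0\times d_1}$, the cost is $c_A(x,y)=-4\|x\|^2\|y\|^2-32x^{\intercal}Ay$ and \[\mathrm{OT}_{A,\varepsilon}(\mu_0,\mu_1)=\inf_{\pi\in\Pi(\mu_0,\mu_1)}\int c_A\,d\pi+\varepsilon\,\mathsf D_{\mathsf{KL}}(\pi\|\mu_0\otimes\mu_1).\] EOT potentials for $\mathrm{OT}_{A,\varepsilon}(\mu_0,\mu_1)$ are continuous functions $(\varphi_0^A,\varphi_1^A)$ such that $\int e^{(\varphi_0^A(x)+\varphi_1^A(y)-c_A(x,y))/\varepsilon}d\mu_1(y)=1$ for all $x\in\mathbb R^{d_0}$ and $\int e^{(\varphi_0^A(x)+\varphi_1^A(y)-c_A(x,y))/\varepsilon}d\mu_0(x)=1$ for all $y\in\mathbb R^{d_1}$; they exist and are unique up to additive constants, and $\frac{d\pi_A}{d\mu_0\otimes\mu_1}(x,y)=e^{(\varphi_0^A(x)+\varphi_1^A(y)-c_A(x,y))/\varepsilon}$.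 $DF_{[u]}(v)$ denotes the Fréchet derivative of $F$ at $u$ evaluated at $v$. *)

theory Defs
  imports "HOL-Probability.Probability"
begin

subsection \<open>Supports and couplings\<close>

definition spt :: "'a::topological_space measure \<Rightarrow> 'a set" where
  "spt M = {x. \<forall>U. open U \<longrightarrow> x \<in> U \<longrightarrow> emeasure M U \<noteq> 0}"

definition compactly_supported_prob :: "'a::topological_space measure \<Rightarrow> bool" where
  "compactly_supported_prob M \<longleftrightarrow> sets M = sets borel \<and> prob_space M \<and> compact (spt M)"

text \<open>On Euclidean spaces the Borel sigma-algebra of the product is the product
  sigma-algebra (\<open>borel_prod\<close>), so couplings and the product measure have the same sets.\<close>

definition couplings ::
  "'a::topological_space measure \<Rightarrow> 'b::topological_space measure \<Rightarrow> ('a \<times> 'b) measure set" where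
  "couplings M N =
     {\<pi>. sets \<pi> = sets borel \<and> distr \<pi> borel fst = M \<and> distr \<pi> borel snd = N}"


subsection \<open>Relative entropy and entropic optimal transport\<close>

text \<open>\<open>KL_divergence (exp 1) N M\<close> is the Bochner integral of \<open>log (dM/dN)\<close> with respect to
  \<open>M\<close>; the order of the arguments is opposite to that of \<open>KL M N\<close>. For probability measures
  \<open>M\<close> absolutely continuous with respect to \<open>N\<close>, the negative part of \<open>log (dM/dN)\<close> is always
  \<open>M\<close>-integrable, as \<open>t log t\<close> is bounded below. If the Bochner integral does not exist, the
  integral is therefore infinite, whereas the library constant would return 0.\<close>

definition KL :: "'a measure \<Rightarrow> 'a measure \<Rightarrow> ereal" where
  "KL M N = (if absolutely_continuous N M \<and> integrable M (entropy_density (exp 1) N M)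
             then ereal (KL_divergence (exp 1) N M) else \<infinity>)"

definition cost :: "real ^ 'n ^ 'm \<Rightarrow> real ^ 'm \<Rightarrow> real ^ 'n \<Rightarrow> real" where
  "cost A x y = - 4 * (norm x)\<^sup>2 * (norm y)\<^sup>2 - 32 * (x \<bullet> (A *v y))"

definition EOT_objective ::
  "real ^ 'n ^ 'm \<Rightarrow> real \<Rightarrow> (real ^ 'm) measure \<Rightarrow> (real ^ 'n) measure
    \<Rightarrow> ((real ^ 'm) \<times> (real ^ 'n)) measure \<Rightarrow> ereal" where
  "EOT_objective A \<epsilon> \<mu>0 \<mu>1 \<pi> =
     ereal (\<integral>z. cost A (fst z) (snd z) \<partial>\<pi>) + ereal \<epsilon> * KL \<pi> (\<mu>0 \<Otimes>\<^sub>M \<mu>1)"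

definition OT ::
  "real ^ 'n ^ 'm \<Rightarrow> real \<Rightarrow> (real ^ 'm) measure \<Rightarrow> (real ^ 'n) measure \<Rightarrow> ereal" where
  "OT A \<epsilon> \<mu>0 \<mu>1 = (INF \<pi>\<in>couplings \<mu>0 \<mu>1. EOT_objective A \<epsilon> \<mu>0 \<mu>1 \<pi>)"

definition optimal_coupling ::
  "real ^ 'n ^ 'm \<Rightarrow> real \<Rightarrow> (real ^ 'm) measure \<Rightarrow> (real ^ 'n) measure
    \<Rightarrow> ((real ^ 'm) \<times> (real ^ 'n)) measure \<Rightarrow> bool" where
  "optimal_coupling A \<epsilon> \<mu>0 \<mu>1 \<pi> \<longleftrightarrow>
     \<pi> \<in> couplings \<mu>0 \<mu>1 \<and> EOT_objective A \<epsilon> \<mu>0 \<mu>1 \<pi> = OT A \<epsilon> \<mu>0 \<mu>1"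

definition EOT_kernel ::
  "real ^ 'n ^ 'm \<Rightarrow> real \<Rightarrow> (real ^ 'm \<Rightarrow> real) \<Rightarrow> (real ^ 'n \<Rightarrow> real)
    \<Rightarrow> real ^ 'm \<Rightarrow> real ^ 'n \<Rightarrow> real" where
  "EOT_kernel A \<epsilon> \<phi>0 \<phi>1 x y = exp ((\<phi>0 x + \<phi>1 y - cost A x y) / \<epsilon>)"

definition EOT_potentials ::
  "real ^ 'n ^ 'm \<Rightarrow> real \<Rightarrow> (real ^ 'm) measure \<Rightarrow> (real ^ 'n) measure
    \<Rightarrow> (real ^ 'm \<Rightarrow> real) \<Rightarrow> (real ^ 'n \<Rightarrow> real) \<Rightarrow> bool" where
  "EOT_potentials A \<epsilon> \<mu>0 \<mu>1 \<phi>0 \<phi>1 \<longleftrightarrow>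
     continuous_on UNIV \<phi>0 \<and> continuous_on UNIV \<phi>1 \<and>
     (\<forall>x. (\<integral>y. EOT_kernel A \<epsilon> \<phi>0 \<phi>1 x y \<partial>\<mu>1) = 1) \<and>
     (\<forall>y. (\<integral>x. EOT_kernel A \<epsilon> \<phi>0 \<phi>1 x y \<partial>\<mu>0) = 1)"

text \<open>Elements of \<open>C(spt \<mu>0) \<times> C(spt \<mu>1)\<close> are represented by total functions whose values off
  the supports are irrelevant. The integrals are hence taken over the supports, which have full
  measure: over the whole space, a non-measurable extension would make the Bochner integrals
  vanish and the equations hold vacuously.\<close>

definition linearized_system ::
  "real ^ 'n ^ 'm \<Rightarrow> real \<Rightarrow> (real ^ 'm) measure \<Rightarrow> (real ^ 'n) measure
    \<Rightarrow> (real ^ 'm \<Rightarrow> real) \<Rightarrow> (real ^ 'n \<Rightarrow> real) \<Rightarrow> real ^ 'n ^ 'm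
    \<Rightarrow> (real ^ 'm \<Rightarrow> real) \<Rightarrow> (real ^ 'n \<Rightarrow> real) \<Rightarrow> bool" where
  "linearized_system A \<epsilon> \<mu>0 \<mu>1 \<phi>0 \<phi>1 C h0 h1 \<longleftrightarrow>
     continuous_on (spt \<mu>0) h0 \<and> continuous_on (spt \<mu>1) h1 \<and>
     (\<forall>x\<in>spt \<mu>0. (LINT y:spt \<mu>1|\<mu>1.
        (h0 x + h1 y - 32 * (x \<bullet> (C *v y))) * EOT_kernel A \<epsilon> \<phi>0 \<phi>1 x y) = 0) \<and>
     (\<forall>y\<in>spt \<mu>1. (LINT x:spt \<mu>0|\<mu>0.
        (h0 x + h1 y - 32 * (x \<bullet> (C *v y))) * EOT_kernel A \<epsilon> \<phi>0 \<phi>1 x y) = 0)"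


subsection \<open>The objective function\<close>

text \<open>The norm of the matrix type \<open>real ^ 'n ^ 'm\<close> is the Frobenius norm.\<close>

lemma norm_matrix_eq_Frobenius:
  fixes A :: "real ^ 'n ^ 'm"
  shows "(norm A)\<^sup>2 = (\<Sum>i\<in>UNIV. \<Sum>j\<in>UNIV. (A $ i $ j)\<^sup>2)"
  by (simp add: norm_vec_def L2_set_def sum_nonneg)

definition Phi ::
  "real \<Rightarrow> (real ^ 'm) measure \<Rightarrow> (real ^ 'n) measure \<Rightarrow> real ^ 'n ^ 'm \<Rightarrow> real" where
  "Phi \<epsilon> \<mu>0 \<mu>1 A = 32 * (norm A)\<^sup>2 + real_of_ereal (OT A \<epsilon> \<mu>0 \<mu>1)"


subsection \<open>Smoothness, second derivatives and coercivity\<close>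

text \<open>\<open>k\<close>-fold continuous (Frechet) differentiability on the whole space, for functions on a
  finite-dimensional space: there, continuity of the derivative as a map into the bounded linear
  maps is the same as continuity of all directional derivatives.\<close>

primrec continuously_differentiable ::
  "nat \<Rightarrow> ('a::euclidean_space \<Rightarrow> 'b::real_normed_vector) \<Rightarrow> bool" where
  "continuously_differentiable 0 f \<longleftrightarrow> continuous_on UNIV f"
| "continuously_differentiable (Suc k) f \<longleftrightarrow>
     (\<forall>x. f differentiable (at x)) \<and>
     (\<forall>v. continuously_differentiable k (\<lambda>x. frechet_derivative f (at x) v))"

definition smooth :: "('a::euclidean_space \<Rightarrow> 'b::real_normed_vector) \<Rightarrow> bool" where
  "smooth f \<longleftrightarrow> (\<forall>k. continuously_differentiable k f)"

text \<open>\<open>f''\<close> is the second Frechet derivative of \<open>f\<close> at \<open>x\<close>, as a function of two directions;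
  the second argument is the direction in which the first derivative is differentiated.\<close>

definition has_second_derivative ::
  "('a::real_normed_vector \<Rightarrow> 'b::real_normed_vector) \<Rightarrow> ('a \<Rightarrow> 'a \<Rightarrow> 'b) \<Rightarrow> 'a \<Rightarrow> bool" where
  "has_second_derivative f f'' x \<longleftrightarrow>
     (\<exists>(D :: 'a \<Rightarrow> 'a \<Rightarrow>\<^sub>L 'b) D2.
        (\<forall>\<^sub>F u in nhds x. (f has_derivative blinfun_apply (D u)) (at u)) \<and>
        (D has_derivative D2) (at x) \<and>
        (\<forall>v w. f'' v w = blinfun_apply (D2 w) v))"

definition coercive :: "('a::real_normed_vector \<Rightarrow> real) \<Rightarrow> bool" where
  "coercive f \<longleftrightarrow> filterlim f at_top at_infinity"

end

theory Submission
  imports Defs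
begin

text \<open>
  Divide costs and potentials by \<open>\<epsilon>\<close> and compose the variables with retractions onto balls containing
  the supports, so that the cost becomes an affine map \<open>A \<mapsto> c\<close> into a Banach space of bounded
  continuous functions. Let \<open>S\<close> be the soft transform \<open>\<phi> \<mapsto> - log \<integral> exp (\<phi> y - c (\<cdot>, y)) d\<mu>1\<close> and
  \<open>S'\<close> its mirror image. The derivative of \<open>S\<close> is minus a Markov operator whose kernel is at least some
  \<open>\<delta> > 0\<close> (Doeblin's condition), hence \<open>\<phi> \<mapsto> S' (S \<phi> + \<delta> \<integral> \<phi> d\<mu>1)\<close> is a sup-norm contraction; conservation
  of mass shows that its fixed point solves the Schroedinger system and has mean zero. The same
  minorization makes \<open>id - QP + mean\<close> invertible by a Neumann argument, where \<open>P\<close> and \<open>Q\<close> are the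
  conditional expectations under the optimal coupling; this yields the derivative of the potentials
  and of the density \<open>k\<close> of \<open>\<pi>\<^sub>A\<close>, and both the existence and the uniqueness for the linearized system.
  The derivative of \<open>k\<close> is an expression in \<open>k\<close> itself, built from bounded bilinear maps and one operator
  inverse, so smoothness follows by bootstrapping. Finally, the objective at a coupling \<open>\<pi>\<close> equals the
  dual value plus \<open>\<epsilon>\<close> times the relative entropy of \<open>\<pi>\<close> with respect to \<open>\<pi>\<^sub>A\<close>, and the derivative of the
  dual value is \<open>d \<mapsto> \<integral> d d\<pi>\<^sub>A\<close>.
\<close>

subsection \<open>Operations on bounded continuous functions\<close>

text \<open>The obstacle is the freedom \<open>(\<phi>0 + a, \<phi>1 - a)\<close>: the round trip
  \<open>\<phi> \<mapsto> S' (S \<phi>)\<close> commutes with adding constants, so in the sup norm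
  it is nonexpansive but not a contraction, and \<open>id - QP\<close> has a kernel. Both defects
  have one cure: a kernel bounded below by \<open>\<delta>\<close> contains \<open>\<delta>\<close>
  times the averaging operator, and without this part a nonnegative kernel of mass
  \<open>1 - \<delta>\<close> remains. The lower bound exists because a soft transform has
  oscillation at most \<open>2 * norm c\<close>, whatever its argument. Differentiability of the
  fixed point rests on a Lipschitz bound and an inverse of the linearization at one point. In the
  formulas the potentials occur only through \<open>k\<close>, so one equation for \<open>k\<close>
  closes the induction over the order of smoothness; the operator inverse enters it by
  \<open>R' = - R L' R\<close>. Functions live on the whole space, in one Banach space type.
  Continuous functions on a support enter by Tietze extension; conversely, a further soft transform
  with the original cost turns the bounded potentials into potentials on the whole space.\<close>

lemma apply_Bcontfun:
  fixes f :: "'a::topological_space \<Rightarrow> real"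
  assumes "continuous_on UNIV f" "\<And>x. \<bar>f x\<bar> \<le> b"
  shows "apply_bcontfun (Bcontfun f) = f"
  using assms by (intro Bcontfun_inverse bcontfun_normI) auto

lemma bcontfun_abs_le: "\<bar>apply_bcontfun f x\<bar> \<le> norm f" for f :: "'a::topological_space \<Rightarrow>\<^sub>C real"
  using norm_bounded[of f x] by simp

lemma bcontfun_le_norm: "apply_bcontfun f x \<le> norm f" "- norm f \<le> apply_bcontfun f x"
  for f :: "'a::topological_space \<Rightarrow>\<^sub>C real"
  using bcontfun_abs_le[of f x] by linarith+

lemma bcontfun_norm_le:
  fixes f :: "'a::topological_space \<Rightarrow>\<^sub>C real"
  assumes "\<And>x. \<bar>f x\<bar> \<le> b"
  shows "norm f \<le> b"
  using assms by (intro norm_bound) simp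

lemma borel_measurable_bcontfun [measurable]: "apply_bcontfun f \<in> borel_measurable borel"
  for f :: "'a::topological_space \<Rightarrow>\<^sub>C real"
  by (intro borel_measurable_continuous_onI) simp

lemma continuous_on_bcontfun_comp [continuous_intros]:
  fixes f :: "'a::topological_space \<Rightarrow>\<^sub>C 'b::metric_space"
  assumes "continuous_on S g"
  shows "continuous_on S (\<lambda>x. f (g x))"
  by (rule continuous_on_compose2[OF continuous_on_apply_bcontfun[of UNIV] assms]) auto

text \<open>\<open>Bcontfun\<close> is specified only for bounded continuous functions. Each
  operation is therefore followed by an \<open>apply\<close> lemma that supplies continuity and an
  explicit bound; later arguments use just the pointwise equation.\<close>

definition bmult :: "('a::topological_space \<Rightarrow>\<^sub>C real) \<Rightarrow> ('a \<Rightarrow>\<^sub>C real) \<Rightarrow> ('a \<Rightarrow>\<^sub>C real)" where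
  "bmult f g = Bcontfun (\<lambda>x. f x * g x)"

lemma apply_bmult [simp]: "bmult f g x = f x * g x"
  unfolding bmult_def
  by (subst apply_Bcontfun[where b = "norm f * norm g"])
    (auto intro!: continuous_intros mult_mono bcontfun_abs_le simp: abs_mult)

lemma norm_bmult_le: "norm (bmult f g) \<le> norm f * norm g"
  by (intro bcontfun_norm_le) (auto simp: abs_mult intro!: mult_mono bcontfun_abs_le)

lemma bounded_bilinear_bmult: "bounded_bilinear bmult"
proof
  show "\<exists>K. \<forall>f g. norm (bmult f g) \<le> norm f * norm g * K"
    using norm_bmult_le by (intro exI[of _ 1]) auto
qed (auto intro!: bcontfun_eqI simp: algebra_simps)

text \<open>With \<open>fst\<close> and \<open>snd\<close> this lifts functions of one variable to
  the product; with \<open>prod.swap\<close> it lets integration over the second variable serve for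
  both marginals.\<close>

definition bcomp :: "('a::topological_space \<Rightarrow> 'b::topological_space) \<Rightarrow> ('b \<Rightarrow>\<^sub>C real) \<Rightarrow> ('a \<Rightarrow>\<^sub>C real)"
  where "bcomp p f = Bcontfun (\<lambda>x. f (p x))"

lemma apply_bcomp [simp]: "continuous_on UNIV p \<Longrightarrow> bcomp p f x = f (p x)"
  unfolding bcomp_def
  by (subst apply_Bcontfun[where b = "norm f"])
    (auto intro!: continuous_intros bcontfun_abs_le)

lemma norm_bcomp_le: "continuous_on UNIV p \<Longrightarrow> norm (bcomp p f) \<le> norm f"
  by (intro bcontfun_norm_le) (auto intro: bcontfun_abs_le)

lemma bounded_linear_bcomp: "continuous_on UNIV p \<Longrightarrow> bounded_linear (bcomp p)"
  by (rule bounded_linear_intro[where K = 1])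
    (auto intro!: bcontfun_eqI simp: norm_bcomp_le)

abbreviation "bfst \<equiv> bcomp fst"
abbreviation "bsnd \<equiv> bcomp snd"
abbreviation "bswap \<equiv> bcomp prod.swap"

lemma apply_bfst [simp]: "bfst f z = f (fst z)"
  and apply_bsnd [simp]: "bsnd g w = g (snd w)"
  and apply_bswap [simp]: "bswap h v = h (prod.swap v)"
  by (simp_all add: continuous_on_fst continuous_on_snd continuous_on_swap)

lemmas bounded_linear_bfst = bounded_linear_bcomp[OF continuous_on_fst[OF continuous_on_id]]
lemmas bounded_linear_bsnd = bounded_linear_bcomp[OF continuous_on_snd[OF continuous_on_id]]
lemmas bounded_linear_bswap = bounded_linear_bcomp[OF continuous_on_swap]

lemma norm_const_bcontfun [simp]: "norm (const_bcontfun a :: 'a::topological_space \<Rightarrow>\<^sub>C real) = \<bar>a\<bar>"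
  using bcontfun_abs_le[of "const_bcontfun a :: 'a \<Rightarrow>\<^sub>C real" undefined]
  by (intro antisym bcontfun_norm_le) auto

lemma bounded_linear_const_bcontfun:
  "bounded_linear (const_bcontfun :: real \<Rightarrow> ('a::topological_space \<Rightarrow>\<^sub>C real))"
  by (rule bounded_linear_intro[where K = 1]) (auto intro!: bcontfun_eqI)

section \<open>The exponential, and differentiability from a quadratic remainder\<close>

definition bexp :: "('a::topological_space \<Rightarrow>\<^sub>C real) \<Rightarrow> ('a \<Rightarrow>\<^sub>C real)" where
  "bexp f = Bcontfun (\<lambda>x. exp (f x))"

lemma apply_bexp [simp]: "bexp f x = exp (f x)"
  unfolding bexp_def
  by (subst apply_Bcontfun[where b = "exp (norm f)"])
    (auto intro!: continuous_intros bcontfun_le_norm)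

text \<open>For negative \<open>x\<close>, the chain
  \<open>exp x * (1 - x) \<le> 1 \<le> 1 - x ^ 3\<close> has the right end
  \<open>(1 + x + x\<^sup>2) * (1 - x)\<close>; divide by \<open>1 - x\<close>.\<close>

lemma exp_remainder_bound:
  fixes x :: real
  assumes "\<bar>x\<bar> \<le> 1"
  shows "exp x \<le> 1 + x + x\<^sup>2"
proof (cases "x \<ge> 0")
  case True then show ?thesis using assms exp_bound by auto
next
  case False
  have "exp x * (1 - x) \<le> exp x * exp (-x)"
    using exp_ge_add_one_self[of "-x"] by (intro mult_left_mono) auto
  then have "exp x * (1 - x) \<le> 1" by (simp add: exp_minus)
  also have "1 \<le> (1 + x + x\<^sup>2) * (1 - x)"
  proof -
    have "(1 + x + x\<^sup>2) * (1 - x) = 1 - x ^ 3" by (simp add: algebra_simps power2_eq_square power3_eq_cube)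
    moreover have "x ^ 3 \<le> 0" using False by (simp add: power_le_zero_eq)
    ultimately show ?thesis by simp
  qed
  finally show ?thesis using False by (simp add: mult_le_cancel_right)
qed

lemma has_derivative_quadratic_remainder:
  fixes f :: "'a::real_normed_vector \<Rightarrow> 'b::real_normed_vector"
  assumes "bounded_linear f'" "r > 0"
    and bound: "\<And>h. norm h \<le> r \<Longrightarrow> norm (f (x + h) - f x - f' h) \<le> C * (norm h)\<^sup>2"
  shows "(f has_derivative f') (at x)"
  unfolding has_derivative_at_alt
proof (intro conjI allI impI assms)
  fix e :: real assume e: "e > 0"
  \<comment> \<open>\<open>C\<close> may be zero or negative; \<open>\<bar>C\<bar> + 1\<close> makes
    the quotient meaningful and still gives \<open>\<bar>C\<bar> * d \<le> e\<close>.\<close>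
  define d where "d = min r (e / (\<bar>C\<bar> + 1))"
  have d: "d > 0" using e assms by (auto simp: d_def)
  show "\<exists>d>0. \<forall>y. norm (y - x) < d \<longrightarrow> norm (f y - f x - f' (y - x)) \<le> e * norm (y - x)"
  proof (intro exI[of _ d] conjI allI impI d)
    fix y assume y: "norm (y - x) < d"
    have "norm (f y - f x - f' (y - x)) \<le> C * (norm (y - x))\<^sup>2"
      using bound[of "y - x"] y by (auto simp: d_def)
    also have "\<dots> \<le> (\<bar>C\<bar> * norm (y - x)) * norm (y - x)"
      by (auto simp: power2_eq_square mult.assoc intro!: mult_right_mono)
    also have "\<bar>C\<bar> * norm (y - x) \<le> (\<bar>C\<bar> + 1) * (e / (\<bar>C\<bar> + 1))"
      using y e by (intro mult_mono) (auto simp: d_def)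
    finally show "norm (f y - f x - f' (y - x)) \<le> e * norm (y - x)"
      by (simp add: mult_right_mono split: if_splits)
  qed
qed

text \<open>The remainder factors as \<open>exp f * (exp h - 1 - h)\<close>, and the second factor
  is at most \<open>(norm h)\<^sup>2\<close> uniformly in the point once
  \<open>norm h \<le> 1\<close>.\<close>

lemma bexp_has_derivative: "(bexp has_derivative bmult (bexp f)) (at f)"
proof (rule has_derivative_quadratic_remainder[where r = 1 and C = "exp (norm f)"])
  show "bounded_linear (bmult (bexp f))"
    by (rule bounded_bilinear.bounded_linear_right[OF bounded_bilinear_bmult])
  fix h :: "'a \<Rightarrow>\<^sub>C real" assume h: "norm h \<le> 1"
  show "norm (bexp (f + h) - bexp f - bmult (bexp f) h) \<le> exp (norm f) * (norm h)\<^sup>2"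
  proof (intro bcontfun_norm_le)
    fix x
    have hx: "\<bar>h x\<bar> \<le> norm h" by (rule bcontfun_abs_le)
    have "\<bar>exp (h x) - 1 - h x\<bar> \<le> (h x)\<^sup>2"
      using exp_remainder_bound[of "h x"] exp_ge_add_one_self[of "h x"] hx h
      unfolding abs_le_iff by linarith
    also have "(h x)\<^sup>2 \<le> (norm h)\<^sup>2"
      using hx by (simp add: abs_le_square_iff[symmetric])
    finally have *: "\<bar>exp (h x) - 1 - h x\<bar> \<le> (norm h)\<^sup>2" .
    have "(bexp (f + h) - bexp f - bmult (bexp f) h) x = exp (f x) * (exp (h x) - 1 - h x)"
      by (simp add: algebra_simps exp_add)
    then have "\<bar>(bexp (f + h) - bexp f - bmult (bexp f) h) x\<bar> = exp (f x) * \<bar>exp (h x) - 1 - h x\<bar>"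
      by (simp add: abs_mult)
    also have "\<dots> \<le> exp (norm f) * (norm h)\<^sup>2"
      using * bcontfun_le_norm by (intro mult_mono) auto
    finally show "\<bar>(bexp (f + h) - bexp f - bmult (bexp f) h) x\<bar> \<le> exp (norm f) * (norm h)\<^sup>2" .
  qed
qed simp

subsection \<open>Integration over one variable\<close>

locale borel_prob_space = prob_space M for M :: "'b::{metric_space, second_countable_topology} measure" +
  assumes sets_eq [measurable_cong, simp]: "sets M = sets borel"
begin

lemma space_eq [simp]: "space M = UNIV"
  using sets_eq_imp_space_eq[OF sets_eq] by simp

lemma prob_UNIV [simp]: "prob UNIV = 1"
  using prob_space by simp

lemma integrable_bcontfun [simp, intro]: "integrable M (apply_bcontfun f)"
  for f :: "'b \<Rightarrow>\<^sub>C real"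
  by (rule integrable_const_bound[where B = "norm f"]) (auto simp: bcontfun_abs_le)

lemma integrable_slice:
  fixes f :: "('a::metric_space \<times> 'b) \<Rightarrow>\<^sub>C real"
  shows "integrable M (\<lambda>y. f (x, y))"
proof (rule integrable_const_bound[where B = "norm f"])
  have "(\<lambda>y. f (x, y)) \<in> borel_measurable borel"
    by (intro borel_measurable_continuous_onI continuous_intros)
  then show "(\<lambda>y. f (x, y)) \<in> borel_measurable M" by simp
qed (auto simp: bcontfun_abs_le)

lemma integral_const: "(\<integral>y. c \<partial>M) = c" for c :: real
  by simp

lemma abs_integral_bcontfun_le: "\<bar>\<integral>y. f y \<partial>M\<bar> \<le> norm f" for f :: "'b \<Rightarrow>\<^sub>C real"
proof -
  have "\<bar>\<integral>y. f y \<partial>M\<bar> \<le> (\<integral>y. \<bar>f y\<bar> \<partial>M)" using integral_norm_bound[of M f] by simp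
  also have "\<dots> \<le> (\<integral>y. norm f \<partial>M)"
    by (intro integral_mono integrable_abs) (auto simp: bcontfun_abs_le)
  finally show ?thesis by (simp add: integral_const)
qed

lemma bounded_linear_integral_bcontfun: "bounded_linear (\<lambda>f :: 'b \<Rightarrow>\<^sub>C real. \<integral>y. f y \<partial>M)"
  by (rule bounded_linear_intro[where K = 1]) (auto simp: abs_integral_bcontfun_le)

lemma abs_integral_slice_le: "\<bar>\<integral>y. f (x, y) \<partial>M\<bar> \<le> norm f"
  for f :: "('a::metric_space \<times> 'b) \<Rightarrow>\<^sub>C real"
proof -
  have "\<bar>\<integral>y. f (x, y) \<partial>M\<bar> \<le> (\<integral>y. \<bar>f (x, y)\<bar> \<partial>M)"
    using integral_norm_bound[of M "\<lambda>y. f (x, y)"] by simp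
  also have "\<dots> \<le> (\<integral>y. norm f \<partial>M)"
    by (intro integral_mono integrable_abs integrable_slice) (auto simp: bcontfun_abs_le)
  finally show ?thesis by (simp add: integral_const)
qed

definition marg :: "(('a::metric_space \<times> 'b) \<Rightarrow>\<^sub>C real) \<Rightarrow> ('a \<Rightarrow>\<^sub>C real)" where
  "marg f = Bcontfun (\<lambda>x. \<integral>y. f (x, y) \<partial>M)"

lemma apply_marg [simp]: "marg f x = (\<integral>y. f (x, y) \<partial>M)"
  for f :: "('a::metric_space \<times> 'b) \<Rightarrow>\<^sub>C real"
  unfolding marg_def
proof (subst apply_Bcontfun[where b = "norm f"])
  show "continuous_on UNIV (\<lambda>x. \<integral>y. f (x, y) \<partial>M)"
    unfolding continuous_on_sequentially
  proof safe
    fix u :: "nat \<Rightarrow> 'a" and x :: 'a assume u: "u \<longlonglongrightarrow> x"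
    show "((\<lambda>x. \<integral>y. f (x, y) \<partial>M) \<circ> u) \<longlonglongrightarrow> (\<integral>y. f (x, y) \<partial>M)"
      unfolding comp_def
    proof (rule integral_dominated_convergence[where w = "\<lambda>_. norm f"])
      show "AE y in M. (\<lambda>i. f (u i, y)) \<longlonglongrightarrow> f (x, y)"
      proof (intro AE_I2)
        fix y :: 'b
        have "(\<lambda>i. (u i, y)) \<longlonglongrightarrow> (x, y)" by (intro tendsto_intros u)
        then show "(\<lambda>i. f (u i, y)) \<longlonglongrightarrow> f (x, y)"
          by (rule continuous_on_tendsto_compose[OF continuous_on_apply_bcontfun[of UNIV]]) auto
      qed
    qed (use integrable_slice in \<open>auto simp: bcontfun_abs_le intro: borel_measurable_integrable\<close>)
  qed
  show "\<bar>\<integral>y. f (x, y) \<partial>M\<bar> \<le> norm f" for x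
    by (rule abs_integral_slice_le)
qed simp

lemma norm_marg_le: "norm (marg f) \<le> norm f" for f :: "('a::metric_space \<times> 'b) \<Rightarrow>\<^sub>C real"
  by (rule bcontfun_norm_le) (simp add: abs_integral_slice_le)

lemma bounded_linear_marg: "bounded_linear (marg :: (('a::metric_space \<times> 'b) \<Rightarrow>\<^sub>C real) \<Rightarrow> _)"
  by (rule bounded_linear_intro[where K = 1])
    (auto intro!: bcontfun_eqI simp: norm_marg_le integrable_slice)

lemma marg_exp_pos: "(\<integral>y. exp (f (x, y)) \<partial>M) \<ge> exp (- norm f)"
  for f :: "('a::metric_space \<times> 'b) \<Rightarrow>\<^sub>C real"
proof -
  have "(\<integral>y. exp (- norm f) \<partial>M) \<le> (\<integral>y. exp (f (x, y)) \<partial>M)"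
    using integrable_slice[of "bexp f" x] by (intro integral_mono) (auto simp: bcontfun_le_norm)
  then show ?thesis by (simp add: integral_const)
qed

lemma marg_exp_pos': "(\<integral>y. exp (f (x, y)) \<partial>M) > 0"
  for f :: "('a::metric_space \<times> 'b) \<Rightarrow>\<^sub>C real"
  by (rule less_le_trans[OF _ marg_exp_pos]) simp

lemma integrable_exp_slice: "integrable M (\<lambda>y. exp (f (x, y)))"
  for f :: "('a::metric_space \<times> 'b) \<Rightarrow>\<^sub>C real"
  using integrable_slice[of "bexp f" x] by simp

text \<open>Monotonicity of the integral, with the shift \<open>K\<close> pulled out as the factor
  \<open>exp K\<close>. Allowing two functions and two base points covers the norm bound of
  \<open>lse\<close>, its nonexpansiveness and the oscillation of soft transforms.\<close>

lemma ln_integral_exp_mono: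
  fixes f :: "('a::metric_space \<times> 'b) \<Rightarrow>\<^sub>C real" and g :: "('c::metric_space \<times> 'b) \<Rightarrow>\<^sub>C real"
  assumes "\<And>y. f (x, y) \<le> g (x', y) + K"
  shows "ln (\<integral>y. exp (f (x, y)) \<partial>M) \<le> ln (\<integral>y. exp (g (x', y)) \<partial>M) + K"
proof -
  have "(\<integral>y. exp (f (x, y)) \<partial>M) \<le> (\<integral>y. exp (g (x', y)) * exp K \<partial>M)"
    using assms
    by (intro integral_mono integrable_exp_slice integrable_mult_left) (simp_all flip: exp_add)
  then have "(\<integral>y. exp (f (x, y)) \<partial>M) \<le> (\<integral>y. exp (g (x', y)) \<partial>M) * exp K"
    by (simp add: integrable_exp_slice)
  then have "ln (\<integral>y. exp (f (x, y)) \<partial>M) \<le> ln ((\<integral>y. exp (g (x', y)) \<partial>M) * exp K)"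
    using marg_exp_pos'[of f x] marg_exp_pos'[of g x'] by (subst ln_le_cancel_iff) auto
  also have "\<dots> = ln (\<integral>y. exp (g (x', y)) \<partial>M) + K"
    using marg_exp_pos'[of g x'] by (subst ln_mult) auto
  finally show ?thesis .
qed

section \<open>The logarithm of integrated exponentials and its derivative\<close>

definition lse :: "(('a::metric_space \<times> 'b) \<Rightarrow>\<^sub>C real) \<Rightarrow> ('a \<Rightarrow>\<^sub>C real)" where
  "lse f = Bcontfun (\<lambda>x. ln (\<integral>y. exp (f (x, y)) \<partial>M))"

lemma apply_lse [simp]: "lse f x = ln (\<integral>y. exp (f (x, y)) \<partial>M)"
  for f :: "('a::metric_space \<times> 'b) \<Rightarrow>\<^sub>C real"
  unfolding lse_def
proof (subst apply_Bcontfun[where b = "norm f"])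
  have "continuous_on UNIV (\<lambda>x. ln (marg (bexp f) x))"
    using marg_exp_pos'[of f] by (intro continuous_intros) (auto, metis less_irrefl)
  then show "continuous_on UNIV (\<lambda>x. ln (\<integral>y. exp (f (x, y)) \<partial>M))" by simp
  show "\<bar>ln (\<integral>y. exp (f (x, y)) \<partial>M)\<bar> \<le> norm f" for x
    using ln_integral_exp_mono[of f x "0 :: ('a \<times> 'b) \<Rightarrow>\<^sub>C real" x "norm f"]
      ln_integral_exp_mono[of "0 :: ('a \<times> 'b) \<Rightarrow>\<^sub>C real" x f x "norm f"] bcontfun_le_norm[of f]
    by (auto simp: integral_const prob_space abs_le_iff) (smt (verit))+
qed simp

lemma lse_nonexpansive: "norm (lse f - lse g) \<le> norm (f - g)"
  for f g :: "('a::metric_space \<times> 'b) \<Rightarrow>\<^sub>C real"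
proof (rule bcontfun_norm_le)
  fix x
  have "f (x, y) \<le> g (x, y) + norm (f - g)" "g (x, y) \<le> f (x, y) + norm (f - g)" for y
    using bcontfun_abs_le[of "f - g" "(x, y)"] by auto
  then show "\<bar>(lse f - lse g) x\<bar> \<le> norm (f - g)"
    using ln_integral_exp_mono[of f x g x "norm (f - g)"] ln_integral_exp_mono[of g x f x "norm (f - g)"]
    by (auto simp: abs_le_iff)
qed

text \<open>The probability density proportional to \<open>exp f\<close> on each slice. Putting the
  normalization inside the exponent makes it visibly bounded, continuous and positive.\<close>

definition gibbs :: "(('a::metric_space \<times> 'b) \<Rightarrow>\<^sub>C real) \<Rightarrow> (('a \<times> 'b) \<Rightarrow>\<^sub>C real)" where
  "gibbs f = bexp (f - bfst (lse f))"

lemma apply_gibbs: "gibbs f (x, y) = exp (f (x, y)) / (\<integral>y. exp (f (x, y)) \<partial>M)"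
  using marg_exp_pos'[of f x] by (simp add: gibbs_def exp_diff)

lemma gibbs_pos: "gibbs f z > 0"
  by (simp add: gibbs_def)

lemma integral_gibbs: "(\<integral>y. gibbs f (x, y) \<partial>M) = 1"
  using marg_exp_pos'[of f x] by (simp add: apply_gibbs)

text \<open>At a point \<open>x\<close> the increment of \<open>lse\<close> is \<open>ln e\<close>,
  where \<open>e\<close> is the mean of \<open>exp h\<close> under the Gibbs density, and
  \<open>m\<close> is the mean of \<open>h\<close>. Jensen's inequality gives
  \<open>m \<le> ln e\<close>; conversely \<open>ln e \<le> e - 1 \<le> m + (norm h)\<^sup>2\<close>
  by the second-order bound of the exponential.\<close>

lemma lse_has_derivative: "(lse has_derivative (\<lambda>h. marg (bmult (gibbs f) h))) (at f)"
  for f :: "('a::metric_space \<times> 'b) \<Rightarrow>\<^sub>C real"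
proof (rule has_derivative_quadratic_remainder[where r = 1 and C = 1])
  show "bounded_linear (\<lambda>h. marg (bmult (gibbs f) h))"
    by (intro bounded_linear_compose[OF bounded_linear_marg]
        bounded_bilinear.bounded_linear_right[OF bounded_bilinear_bmult])
  fix h :: "('a \<times> 'b) \<Rightarrow>\<^sub>C real" assume h: "norm h \<le> 1"
  show "norm (lse (f + h) - lse f - marg (bmult (gibbs f) h)) \<le> 1 * (norm h)\<^sup>2"
  proof (rule bcontfun_norm_le)
    fix x
    define m where "m = (\<integral>y. gibbs f (x, y) * h (x, y) \<partial>M)"
    define e where "e = (\<integral>y. gibbs f (x, y) * exp (h (x, y)) \<partial>M)"
    have ig [simp]: "integrable M (\<lambda>y. gibbs f (x, y))" by (rule integrable_slice)
    have igh [simp]: "integrable M (\<lambda>y. gibbs f (x, y) * h (x, y))"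
      using integrable_slice[of "bmult (gibbs f) h" x] by simp
    have ige [simp]: "integrable M (\<lambda>y. gibbs f (x, y) * exp (h (x, y)))"
      using integrable_slice[of "bmult (gibbs f) (bexp h)" x] by simp
    have Z: "(\<integral>y. exp (f (x, y)) \<partial>M) > 0" by (rule marg_exp_pos')
    have "e = (\<integral>y. exp (f (x, y) + h (x, y)) / (\<integral>y. exp (f (x, y)) \<partial>M) \<partial>M)"
      unfolding e_def by (intro Bochner_Integration.integral_cong) (auto simp: apply_gibbs exp_add)
    then have "e = (\<integral>y. exp ((f + h) (x, y)) \<partial>M) / (\<integral>y. exp (f (x, y)) \<partial>M)" by simp
    then have lne: "ln e = lse (f + h) x - lse f x"
      using Z marg_exp_pos'[of "f + h" x] by (simp add: ln_div)
    have h2: "(h (x, y))\<^sup>2 \<le> (norm h)\<^sup>2" "\<bar>h (x, y)\<bar> \<le> 1" for y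
      using bcontfun_abs_le[of h "(x, y)"] h by (auto simp: abs_le_square_iff[symmetric])
    have "e \<le> (\<integral>y. gibbs f (x, y) * (1 + h (x, y) + (norm h)\<^sup>2) \<partial>M)"
      unfolding e_def
    proof (intro integral_mono mult_left_mono ige)
      show "integrable M (\<lambda>y. gibbs f (x, y) * (1 + h (x, y) + (norm h)\<^sup>2))"
        by (simp add: distrib_left)
      show "exp (h (x, y)) \<le> 1 + h (x, y) + (norm h)\<^sup>2" for y
        using exp_remainder_bound[OF h2(2)[of y]] h2(1)[of y] by linarith
      show "gibbs f (x, y) \<ge> 0" for y using gibbs_pos[of f] by (simp add: less_imp_le)
    qed
    also have "\<dots> = 1 + m + (norm h)\<^sup>2"
      by (simp add: distrib_left integral_gibbs m_def)
    finally have e_upper: "e \<le> 1 + m + (norm h)\<^sup>2" .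
    \<comment> \<open>Jensen's inequality for the exponential, by integrating its tangent line at
      the mean \<open>m\<close>.\<close>
    have "(\<integral>y. gibbs f (x, y) * (exp m * (1 + (h (x, y) - m))) \<partial>M) \<le> e"
      unfolding e_def
    proof (intro integral_mono mult_left_mono ige)
      show "integrable M (\<lambda>y. gibbs f (x, y) * (exp m * (1 + (h (x, y) - m))))"
      proof -
        have "integrable M (\<lambda>y. exp m * (1 - m) * gibbs f (x, y) + exp m * (gibbs f (x, y) * h (x, y)))"
          by simp
        then show ?thesis by (rule Bochner_Integration.integrable_cong[THEN iffD1, rotated -1]) (auto simp: algebra_simps)
      qed
      show "exp m * (1 + (h (x, y) - m)) \<le> exp (h (x, y))" for y
      proof -
        have "exp m * (1 + (h (x, y) - m)) \<le> exp m * exp (h (x, y) - m)"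
          by (intro mult_left_mono exp_ge_add_one_self) auto
        then show ?thesis by (simp add: exp_diff)
      qed
      show "gibbs f (x, y) \<ge> 0" for y using gibbs_pos[of f] by (simp add: less_imp_le)
    qed
    also have "(\<integral>y. gibbs f (x, y) * (exp m * (1 + (h (x, y) - m))) \<partial>M) =
        (\<integral>y. exp m * (1 - m) * gibbs f (x, y) + exp m * (gibbs f (x, y) * h (x, y)) \<partial>M)"
      by (intro Bochner_Integration.integral_cong) (auto simp: algebra_simps)
    also have "\<dots> = exp m * (1 - m) * 1 + exp m * m"
      by (subst Bochner_Integration.integral_add) (simp_all add: integral_gibbs m_def)
    also have "\<dots> = exp m" by (simp add: algebra_simps)
    finally have e_lower: "exp m \<le> e" .
    have "e > 0" using e_lower by (rule less_le_trans[OF exp_gt_zero])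
    then have "m \<le> ln e" using e_lower by (simp add: ln_ge_iff)
    moreover have "ln e \<le> e - 1" using \<open>e > 0\<close> by (rule ln_le_minus_one)
    ultimately have "\<bar>ln e - m\<bar> \<le> (norm h)\<^sup>2" using e_upper by auto
    then show "\<bar>(lse (f + h) - lse f - marg (bmult (gibbs f) h)) x\<bar> \<le> 1 * (norm h)\<^sup>2"
      by (simp add: lne m_def)
  qed
qed simp

end

subsection \<open>The Schroedinger system\<close>

text \<open>The difference on the left is the integral of \<open>v\<close> against
  \<open>k - \<delta>\<close>, a nonnegative kernel of mass \<open>1 - \<delta>\<close>. The case
  \<open>\<delta> = 0\<close> is the bound by one for the norm of a Markov operator.\<close>

lemma (in borel_prob_space) markov_minorized_contraction:
  fixes k :: "('a::metric_space \<times> 'b) \<Rightarrow>\<^sub>C real" and v :: "'b \<Rightarrow>\<^sub>C real"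
  assumes k: "\<And>y. k (x, y) \<ge> \<delta>" and one: "(\<integral>y. k (x, y) \<partial>M) = 1"
  shows "\<bar>(\<integral>y. k (x, y) * v y \<partial>M) - \<delta> * (\<integral>y. v y \<partial>M)\<bar> \<le> (1 - \<delta>) * norm v"
proof -
  have ik: "integrable M (\<lambda>y. k (x, y))" by (rule integrable_slice)
  have ikv: "integrable M (\<lambda>y. k (x, y) * v y)"
    using integrable_slice[of "bmult k (bsnd v)" x] by simp
  have ikd: "integrable M (\<lambda>y. (k (x, y) - \<delta>) * v y)"
    using ikv by (simp add: left_diff_distrib)
  have "(\<integral>y. k (x, y) * v y \<partial>M) - \<delta> * (\<integral>y. v y \<partial>M) = (\<integral>y. (k (x, y) - \<delta>) * v y \<partial>M)"
    using ikv by (simp add: left_diff_distrib)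
  also have "\<bar>\<dots>\<bar> \<le> (\<integral>y. \<bar>(k (x, y) - \<delta>) * v y\<bar> \<partial>M)"
    using integral_norm_bound[of M "\<lambda>y. (k (x, y) - \<delta>) * v y"] by simp
  also have "\<dots> \<le> (\<integral>y. (k (x, y) - \<delta>) * norm v \<partial>M)"
  proof (intro integral_mono integrable_abs ikd)
    show "integrable M (\<lambda>y. (k (x, y) - \<delta>) * norm v)" using ik by simp
    show "\<bar>(k (x, y) - \<delta>) * v y\<bar> \<le> (k (x, y) - \<delta>) * norm v" for y
      using k[of y] by (auto simp: abs_mult intro!: mult_mono bcontfun_abs_le)
  qed
  also have "\<dots> = (1 - \<delta>) * norm v" using ik one by simp
  finally show ?thesis .
qed

locale schroedinger = mu: borel_prob_space \<mu> + nu: borel_prob_space \<nu>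
  for \<mu> :: "'a::{metric_space, second_countable_topology} measure"
    and \<nu> :: "'b::{metric_space, second_countable_topology} measure"
begin

sublocale pair_prob_space \<mu> \<nu> ..

lemma sets_pair: "sets (\<mu> \<Otimes>\<^sub>M \<nu>) = sets borel"
  using sets_pair_measure_cong[OF mu.sets_eq nu.sets_eq] unfolding borel_prod .

lemma integrable_pair: "integrable (\<mu> \<Otimes>\<^sub>M \<nu>) (apply_bcontfun f)"
  for f :: "('a \<times> 'b) \<Rightarrow>\<^sub>C real"
proof (rule P.integrable_const_bound[where B = "norm f"])
  show "apply_bcontfun f \<in> borel_measurable (\<mu> \<Otimes>\<^sub>M \<nu>)"
    using borel_measurable_bcontfun[of f] measurable_cong_sets[OF sets_pair refl] by blast
qed (auto simp: bcontfun_abs_le)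

lemma integral_marg_fst: "(\<integral>x. nu.marg f x \<partial>\<mu>) = (\<integral>z. f z \<partial>(\<mu> \<Otimes>\<^sub>M \<nu>))"
  using integral_fst'[OF integrable_pair[of f]] by simp

lemma integral_marg_snd: "(\<integral>y. mu.marg (bswap f) y \<partial>\<nu>) = (\<integral>z. f z \<partial>(\<mu> \<Otimes>\<^sub>M \<nu>))"
  using integral_snd[of "\<lambda>x y. f (x, y)"] integrable_pair[of f] by simp

definition fwd :: "(('a \<times> 'b) \<Rightarrow>\<^sub>C real) \<Rightarrow> ('b \<Rightarrow>\<^sub>C real) \<Rightarrow> ('a \<Rightarrow>\<^sub>C real)" where
  "fwd c \<phi> = - nu.lse (bsnd \<phi> - c)"

definition bwd :: "(('a \<times> 'b) \<Rightarrow>\<^sub>C real) \<Rightarrow> ('a \<Rightarrow>\<^sub>C real) \<Rightarrow> ('b \<Rightarrow>\<^sub>C real)" where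
  "bwd c \<psi> = - mu.lse (bsnd \<psi> - bswap c)"

lemma bsnd_diff: "bsnd (f - g) = bsnd f - bsnd g"
  and bswap_diff: "bswap (f'' - g'') = bswap f'' - bswap g''"
  by (auto intro!: bcontfun_eqI)

lemma norm_bsnd_le: "norm (bsnd g) \<le> norm g"
  and norm_bswap_le: "norm (bswap h) \<le> norm h"
  by (auto intro!: bcontfun_norm_le bcontfun_abs_le)

lemma fwd_lipschitz: "norm (fwd c \<phi> - fwd c' \<phi>') \<le> norm (\<phi> - \<phi>') + norm (c - c')"
proof -
  have "norm (fwd c \<phi> - fwd c' \<phi>') = norm (nu.lse (bsnd \<phi>' - c') - nu.lse (bsnd \<phi> - c))"
    by (simp add: fwd_def)
  also have "\<dots> \<le> norm ((bsnd \<phi>' - c') - (bsnd \<phi> - c))"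
    by (rule nu.lse_nonexpansive)
  also have "(bsnd \<phi>' - c') - (bsnd \<phi> - c) = (c - c') - bsnd (\<phi> - \<phi>')"
    by (simp add: bsnd_diff)
  also have "norm \<dots> \<le> norm (c - c') + norm (\<phi> - \<phi>')"
    by (rule order_trans[OF norm_triangle_ineq4]) (simp add: norm_bsnd_le)
  finally show ?thesis by simp
qed

lemma bwd_lipschitz: "norm (bwd c \<psi> - bwd c' \<psi>') \<le> norm (\<psi> - \<psi>') + norm (c - c')"
proof -
  have "norm (bwd c \<psi> - bwd c' \<psi>') = norm (mu.lse (bsnd \<psi>' - bswap c') - mu.lse (bsnd \<psi> - bswap c))"
    by (simp add: bwd_def)
  also have "\<dots> \<le> norm ((bsnd \<psi>' - bswap c') - (bsnd \<psi> - bswap c))"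
    by (rule mu.lse_nonexpansive)
  also have "(bsnd \<psi>' - bswap c') - (bsnd \<psi> - bswap c) = bswap (c - c') - bsnd (\<psi> - \<psi>')"
    by (simp add: bsnd_diff bswap_diff)
  also have "norm \<dots> \<le> norm (c - c') + norm (\<psi> - \<psi>')"
    by (rule order_trans[OF norm_triangle_ineq4]) (intro add_mono norm_bsnd_le norm_bswap_le)
  finally show ?thesis by simp
qed

lemma bwd_add_const: "bwd c (\<psi> + const_bcontfun a) = bwd c \<psi> - const_bcontfun a"
proof (rule bcontfun_eqI)
  fix y
  have "(\<integral>x. exp (\<psi> x + a - c (x, y)) \<partial>\<mu>) = (\<integral>x. exp (\<psi> x - c (x, y)) * exp a \<partial>\<mu>)"
    by (intro Bochner_Integration.integral_cong) (auto simp flip: exp_add)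
  also have "\<dots> = (\<integral>x. exp (\<psi> x - c (x, y)) \<partial>\<mu>) * exp a"
    by simp
  finally show "bwd c (\<psi> + const_bcontfun a) y = (bwd c \<psi> - const_bcontfun a) y"
    using mu.marg_exp_pos'[of "bsnd \<psi> - bswap c" y] by (simp add: bwd_def ln_mult)
qed

text \<open>The exponents at \<open>y\<close> and \<open>y'\<close> contain the same
  \<open>\<psi>\<close> and differ only through \<open>c\<close>. Hence every round trip lands in
  one fixed set of functions, on which the Gibbs kernels have a common positive lower bound.\<close>

lemma bwd_osc: "bwd c \<psi> y - bwd c \<psi> y' \<le> 2 * norm c"
  for \<psi> :: "'a \<Rightarrow>\<^sub>C real"
proof -
  have "(bsnd \<psi> - bswap c) (y', x) \<le> (bsnd \<psi> - bswap c) (y, x) + 2 * norm c" for x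
    using bcontfun_le_norm(1)[of c "(x, y)"] bcontfun_le_norm(2)[of c "(x, y')"] by simp
  from mu.ln_integral_exp_mono[of "bsnd \<psi> - bswap c" y' "bsnd \<psi> - bswap c", OF this] show ?thesis
    by (simp add: bwd_def)
qed

lemma integral_fwd: "(\<integral>y. exp (fwd c \<phi> x + \<phi> y - c (x, y)) \<partial>\<nu>) = 1"
  for \<phi> :: "'b \<Rightarrow>\<^sub>C real" and c :: "('a \<times> 'b) \<Rightarrow>\<^sub>C real"
proof -
  have Z: "(\<integral>y. exp (\<phi> y - c (x, y)) \<partial>\<nu>) > 0"
    using nu.marg_exp_pos'[of "bsnd \<phi> - c" x] by simp
  have "(\<integral>y. exp (fwd c \<phi> x + \<phi> y - c (x, y)) \<partial>\<nu>) = (\<integral>y. exp (fwd c \<phi> x) * exp (\<phi> y - c (x, y)) \<partial>\<nu>)"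
    by (intro Bochner_Integration.integral_cong) (auto simp: algebra_simps simp flip: exp_add)
  also have "\<dots> = exp (fwd c \<phi> x) * (\<integral>y. exp (\<phi> y - c (x, y)) \<partial>\<nu>)"
    by simp
  also have "\<dots> = 1"
    using Z by (simp add: fwd_def exp_minus)
  finally show ?thesis .
qed

lemma integral_bwd: "(\<integral>x. exp (\<psi> x + bwd c \<psi> y - c (x, y)) \<partial>\<mu>) = 1"
  for \<psi> :: "'a \<Rightarrow>\<^sub>C real" and c :: "('a \<times> 'b) \<Rightarrow>\<^sub>C real"
proof -
  have Z: "(\<integral>x. exp (\<psi> x - c (x, y)) \<partial>\<mu>) > 0"
    using mu.marg_exp_pos'[of "bsnd \<psi> - bswap c" y] by simp
  have "(\<integral>x. exp (\<psi> x + bwd c \<psi> y - c (x, y)) \<partial>\<mu>) = (\<integral>x. exp (bwd c \<psi> y) * exp (\<psi> x - c (x, y)) \<partial>\<mu>)"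
    by (intro Bochner_Integration.integral_cong) (auto simp: algebra_simps simp flip: exp_add)
  also have "\<dots> = exp (bwd c \<psi> y) * (\<integral>x. exp (\<psi> x - c (x, y)) \<partial>\<mu>)"
    by simp
  also have "\<dots> = 1"
    using Z by (simp add: bwd_def exp_minus)
  finally show ?thesis .
qed

lemma fwd_unique:
  fixes c :: "('a \<times> 'b) \<Rightarrow>\<^sub>C real" and \<psi> :: "'a \<Rightarrow>\<^sub>C real" and \<phi> :: "'b \<Rightarrow>\<^sub>C real"
  assumes "\<And>x. (\<integral>y. exp (\<psi> x + \<phi> y - c (x, y)) \<partial>\<nu>) = 1"
  shows "\<psi> = fwd c \<phi>"
proof (rule bcontfun_eqI)
  fix x
  have "1 = (\<integral>y. exp (\<psi> x - fwd c \<phi> x) * exp (fwd c \<phi> x + \<phi> y - c (x, y)) \<partial>\<nu>)"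
    unfolding assms[of x, symmetric]
    by (intro Bochner_Integration.integral_cong) (auto simp flip: exp_add)
  also have "\<dots> = exp (\<psi> x - fwd c \<phi> x)"
    by (simp add: integral_fwd)
  finally show "\<psi> x = fwd c \<phi> x" by simp
qed

lemma bwd_unique:
  fixes c :: "('a \<times> 'b) \<Rightarrow>\<^sub>C real" and \<psi> :: "'a \<Rightarrow>\<^sub>C real" and \<phi> :: "'b \<Rightarrow>\<^sub>C real"
  assumes "\<And>y. (\<integral>x. exp (\<psi> x + \<phi> y - c (x, y)) \<partial>\<mu>) = 1"
  shows "\<phi> = bwd c \<psi>"
proof (rule bcontfun_eqI)
  fix y
  have "1 = (\<integral>x. exp (\<phi> y - bwd c \<psi> y) * exp (\<psi> x + bwd c \<psi> y - c (x, y)) \<partial>\<mu>)"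
    unfolding assms[of y, symmetric]
    by (intro Bochner_Integration.integral_cong) (auto simp flip: exp_add)
  also have "\<dots> = exp (\<phi> y - bwd c \<psi> y)"
    by (simp add: integral_bwd)
  finally show "\<phi> y = bwd c \<psi> y" by simp
qed

text \<open>Conservation of mass: integrate \<open>exp (fwd c \<phi> + \<phi> - c)\<close> over the
  product in both orders. Starting with \<open>y\<close> gives 1 by the normalization in
  \<open>fwd\<close>; starting with \<open>x\<close> gives \<open>exp (- a)\<close>, because
  \<open>\<phi>\<close> differs from the normalizing \<open>bwd c (fwd c \<phi>)\<close> by
  \<open>a\<close>.\<close>

lemma round_trip_const:
  assumes "bwd c (fwd c \<phi>) = \<phi> + const_bcontfun a"
  shows "a = 0"
proof -
  define F where "F = bexp (bfst (fwd c \<phi>) + bsnd \<phi> - c)"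
  have "(\<integral>z. F z \<partial>(\<mu> \<Otimes>\<^sub>M \<nu>)) = 1"
    using integral_marg_fst[of F] by (simp add: F_def integral_fwd)
  moreover have "(\<integral>x. F (x, y) \<partial>\<mu>) = exp (- a)" for y
  proof -
    have "(\<integral>x. F (x, y) \<partial>\<mu>) = (\<integral>x. exp (- a) * exp (fwd c \<phi> x + bwd c (fwd c \<phi>) y - c (x, y)) \<partial>\<mu>)"
      unfolding assms by (intro Bochner_Integration.integral_cong) (auto simp: F_def simp flip: exp_add)
    also have "\<dots> = exp (- a)"
      by (simp add: integral_bwd)
    finally show ?thesis .
  qed
  then have "(\<integral>z. F z \<partial>(\<mu> \<Otimes>\<^sub>M \<nu>)) = exp (- a)"
    using integral_marg_snd[of F] by simp
  ultimately show ?thesis by simp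
qed

text \<open>The mean value inequality on the set \<open>D\<close> of functions with oscillation at
  most \<open>R\<close>. There the exponent of the Gibbs density varies on a slice by at most
  \<open>R + 2 * norm c \<le> 2 * R\<close>, which explains \<open>\<delta>\<close>; the derivative
  is minus a Markov operator plus \<open>\<delta>\<close> times the mean, of norm at most
  \<open>1 - \<delta>\<close>.\<close>

lemma fwd_contraction:
  fixes R :: real and c :: "('a \<times> 'b) \<Rightarrow>\<^sub>C real" and \<phi> \<phi>' :: "'b \<Rightarrow>\<^sub>C real"
  defines "\<delta> \<equiv> exp (- (2 * R))"
  assumes c: "2 * norm c \<le> R"
    and \<phi>: "\<And>y y'. \<phi> y - \<phi> y' \<le> R" and \<phi>': "\<And>y y'. \<phi>' y - \<phi>' y' \<le> R"
  shows "norm ((fwd c \<phi> + const_bcontfun (\<delta> * (\<integral>y. \<phi> y \<partial>\<nu>))) - (fwd c \<phi>' + const_bcontfun (\<delta> * (\<integral>y. \<phi>' y \<partial>\<nu>))))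
    \<le> (1 - \<delta>) * norm (\<phi> - \<phi>')"
proof -
  define D where "D = {\<phi> :: 'b \<Rightarrow>\<^sub>C real. \<forall>y y'. \<phi> y - \<phi> y' \<le> R}"
  define f where "f = (\<lambda>\<phi>. fwd c \<phi> + const_bcontfun (\<delta> * (\<integral>y. apply_bcontfun \<phi> y \<partial>\<nu>)))"
  define f' where "f' = (\<lambda>\<phi> v. - nu.marg (bmult (nu.gibbs (bsnd \<phi> - c)) (bsnd v))
      + const_bcontfun (\<delta> * (\<integral>y. apply_bcontfun v y \<partial>\<nu>)))"
  have bl: "bounded_linear (\<lambda>v::'b \<Rightarrow>\<^sub>C real. const_bcontfun (\<delta> * (\<integral>y. v y \<partial>\<nu>)) :: 'a \<Rightarrow>\<^sub>C real)"
    by (intro bounded_linear_compose[OF bounded_linear_const_bcontfun]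
        bounded_linear_const_mult nu.bounded_linear_integral_bcontfun)
  have der: "(f has_derivative f' \<phi>) (at \<phi> within D)" for \<phi>
  proof -
    have 1: "((\<lambda>\<phi>. bsnd \<phi> - c) has_derivative bsnd) (at \<phi>)"
      by (auto intro!: derivative_eq_intros bounded_linear_imp_has_derivative bounded_linear_bsnd)
    have "((\<lambda>\<phi>. nu.lse (bsnd \<phi> - c)) has_derivative
        (\<lambda>v. nu.marg (bmult (nu.gibbs (bsnd \<phi> - c)) (bsnd v)))) (at \<phi>)"
      using has_derivative_compose[OF 1 nu.lse_has_derivative] .
    then have "(f has_derivative f' \<phi>) (at \<phi>)"
      unfolding f_def f'_def fwd_def
      by (intro has_derivative_add has_derivative_minus bounded_linear_imp_has_derivative bl)
    then show ?thesis by (rule has_derivative_at_withinI)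
  qed
  have bound: "onorm (f' \<phi>) \<le> 1 - \<delta>" if "\<phi> \<in> D" for \<phi>
  proof (rule onorm_bound)
    have R: "R \<ge> 0" using c norm_ge_zero[of c] by linarith
    then show "0 \<le> 1 - \<delta>" by (simp add: \<delta>_def)
    fix v
    show "norm (f' \<phi> v) \<le> (1 - \<delta>) * norm v"
    proof (rule bcontfun_norm_le)
      fix x
      have "nu.gibbs (bsnd \<phi> - c) (x, y) \<ge> \<delta>" for y
      proof -
        have "(\<integral>y'. exp ((bsnd \<phi> - c) (x, y')) \<partial>\<nu>) \<le> (\<integral>y'. exp ((bsnd \<phi> - c) (x, y)) / \<delta> \<partial>\<nu>)"
        proof (intro integral_mono nu.integrable_exp_slice)
          fix y'
          have "\<phi> y' - \<phi> y \<le> R" using that by (auto simp: D_def)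
          then have "(bsnd \<phi> - c) (x, y') \<le> (bsnd \<phi> - c) (x, y) + 2 * R"
            using c bcontfun_le_norm(2)[of c "(x, y')"] bcontfun_le_norm(1)[of c "(x, y)"] by simp
          then show "exp ((bsnd \<phi> - c) (x, y')) \<le> exp ((bsnd \<phi> - c) (x, y)) / \<delta>"
            by (simp add: \<delta>_def exp_minus divide_inverse flip: exp_add)
        qed simp
        then have "(\<integral>y'. exp ((bsnd \<phi> - c) (x, y')) \<partial>\<nu>) \<le> exp ((bsnd \<phi> - c) (x, y)) / \<delta>"
          by (simp only: nu.integral_const)
        then show ?thesis
          unfolding nu.apply_gibbs using nu.marg_exp_pos'[of "bsnd \<phi> - c" x]
          by (simp add: \<delta>_def field_simps)
      qed
      then have "\<bar>(\<integral>y. nu.gibbs (bsnd \<phi> - c) (x, y) * v y \<partial>\<nu>) - \<delta> * (\<integral>y. v y \<partial>\<nu>)\<bar> \<le> (1 - \<delta>) * norm v"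
        by (rule nu.markov_minorized_contraction) (rule nu.integral_gibbs)
      then show "\<bar>f' \<phi> v x\<bar> \<le> (1 - \<delta>) * norm v"
        by (simp add: f'_def abs_minus_commute)
    qed
  qed
  \<comment> \<open>The mean value inequality needs the segment between \<open>\<phi>\<close> and
    \<open>\<phi>'\<close> to stay where the derivative is controlled.\<close>
  have "convex D"
  proof (rule convexI)
    fix f g :: "'b \<Rightarrow>\<^sub>C real" and u v :: real
    assume *: "f \<in> D" "g \<in> D" "0 \<le> u" "0 \<le> v" "u + v = 1"
    show "u *\<^sub>R f + v *\<^sub>R g \<in> D"
      unfolding D_def
    proof safe
      fix y y'
      have "u * (f y - f y') + v * (g y - g y') \<le> u * R + v * R"
        using * by (intro add_mono mult_left_mono) (auto simp: D_def)
      also have "u * R + v * R = R"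
        using * by (simp flip: distrib_right)
      finally show "(u *\<^sub>R f + v *\<^sub>R g) y - (u *\<^sub>R f + v *\<^sub>R g) y' \<le> R"
        by (simp add: algebra_simps)
    qed
  qed
  from differentiable_bound[OF this der bound, of \<phi> \<phi>'] show ?thesis
    using \<phi> \<phi>' by (simp add: f_def D_def)
qed

section \<open>Existence of the normalized potential and its Lipschitz dependence on the
  cost\<close>

definition normalized_potential :: "(('a \<times> 'b) \<Rightarrow>\<^sub>C real) \<Rightarrow> ('b \<Rightarrow>\<^sub>C real) \<Rightarrow> bool" where
  "normalized_potential c \<phi> \<longleftrightarrow> bwd c (fwd c \<phi>) = \<phi> \<and> (\<integral>y. \<phi> y \<partial>\<nu>) = 0"

text \<open>By \<open>bwd_add_const\<close> this is \<open>bwd c (fwd c \<phi>)\<close> minus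
  \<open>\<delta>\<close> times the mean of \<open>\<phi>\<close>. With the correction placed before
  the backward step, the inner map contracts, while the outer one is nonexpansive and returns to the
  functions of small oscillation.\<close>

definition sink :: "real \<Rightarrow> (('a \<times> 'b) \<Rightarrow>\<^sub>C real) \<Rightarrow> ('b \<Rightarrow>\<^sub>C real) \<Rightarrow> ('b \<Rightarrow>\<^sub>C real)" where
  "sink \<delta> c \<phi> = bwd c (fwd c \<phi> + const_bcontfun (\<delta> * (\<integral>y. \<phi> y \<partial>\<nu>)))"

lemma sink_contraction:
  fixes \<phi> \<phi>' :: "'b \<Rightarrow>\<^sub>C real"
  assumes c: "2 * norm c \<le> R"
    and \<phi>: "\<And>y y'. \<phi> y - \<phi> y' \<le> R" and \<phi>': "\<And>y y'. \<phi>' y - \<phi>' y' \<le> R"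
  shows "norm (sink (exp (- (2 * R))) c \<phi> - sink (exp (- (2 * R))) c \<phi>') \<le> (1 - exp (- (2 * R))) * norm (\<phi> - \<phi>')"
  unfolding sink_def
  by (rule order_trans[OF bwd_lipschitz]) (use fwd_contraction[OF assms] in simp)

text \<open>At a fixed point a round trip adds the constant \<open>\<delta>\<close> times the mean,
  which \<open>round_trip_const\<close> forces to be zero. So the fixed points do not depend on
  \<open>\<delta>\<close>: a small value serves for the contraction, the value 1 for the
  derivative.\<close>

lemma sink_fixed_point:
  assumes "\<delta> \<noteq> 0"
  shows "sink \<delta> c \<phi> = \<phi> \<longleftrightarrow> normalized_potential c \<phi>"
proof
  assume *: "sink \<delta> c \<phi> = \<phi>"
  then have eq: "bwd c (fwd c \<phi>) = \<phi> + const_bcontfun (\<delta> * (\<integral>y. \<phi> y \<partial>\<nu>))"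
    by (simp add: sink_def bwd_add_const algebra_simps)
  from round_trip_const[OF this] assms have "(\<integral>y. \<phi> y \<partial>\<nu>) = 0" by simp
  with eq show "normalized_potential c \<phi>" by (simp add: normalized_potential_def)
qed (simp add: normalized_potential_def sink_def)

lemma normalized_potential_osc: "normalized_potential c \<phi> \<Longrightarrow> \<phi> y - \<phi> y' \<le> 2 * norm c"
  for \<phi> :: "'b \<Rightarrow>\<^sub>C real"
  unfolding normalized_potential_def using bwd_osc[of c "fwd c \<phi>" y y'] by simp

text \<open>Banach's fixed point theorem on the closed set \<open>D\<close>, into which
  \<open>sink\<close> maps by \<open>bwd_osc\<close>. Uniqueness extends beyond \<open>D\<close>, as
  every normalized potential is itself a soft transform and so lies in \<open>D\<close>.\<close>

lemma ex1_normalized_potential: "\<exists>!\<phi>. normalized_potential c \<phi>"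
proof -
  define R where "R = 2 * norm c"
  define D where "D = {\<phi> :: 'b \<Rightarrow>\<^sub>C real. \<forall>y y'. \<phi> y - \<phi> y' \<le> R}"
  define \<delta> where "\<delta> = exp (- (2 * R))"
  have \<delta>: "0 < \<delta>" "\<delta> \<le> 1" by (auto simp: \<delta>_def R_def)
  have "closed D"
    unfolding closed_sequential_limits
  proof safe
    fix f l assume f: "\<forall>n. f n \<in> D" "f \<longlonglongrightarrow> l"
    have lim: "(\<lambda>n. f n y) \<longlonglongrightarrow> l y" for y
      using tendsto_bcontfun_uniform_limit[OF f(2)] by (rule tendsto_uniform_limitI) simp
    show "l \<in> D"
      unfolding D_def
    proof safe
      fix y y'
      show "l y - l y' \<le> R"
        by (rule LIMSEQ_le_const2[OF tendsto_diff[OF lim lim]]) (use f in \<open>auto simp: D_def\<close>)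
    qed
  qed
  note complete_eq_closed[THEN iffD2, OF this]
  moreover have "0 \<in> D" by (simp add: D_def R_def)
  moreover have "sink \<delta> c ` D \<subseteq> D"
    unfolding D_def sink_def R_def using bwd_osc by auto
  moreover have "dist (sink \<delta> c \<phi>) (sink \<delta> c \<phi>') \<le> (1 - \<delta>) * dist \<phi> \<phi>'" if "\<phi> \<in> D" "\<phi>' \<in> D" for \<phi> \<phi>'
    using sink_contraction[of c R \<phi> \<phi>'] that by (simp add: D_def R_def \<delta>_def dist_norm)
  ultimately have "\<exists>!\<phi>\<in>D. sink \<delta> c \<phi> = \<phi>"
    using \<delta> by (intro Banach_fix[where c = "1 - \<delta>"]) auto
  then show ?thesis
    using sink_fixed_point[of \<delta> c] \<delta> normalized_potential_osc[of c]
    by (auto simp: D_def R_def Ex1_def)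
qed

definition pot :: "(('a \<times> 'b) \<Rightarrow>\<^sub>C real) \<Rightarrow> ('b \<Rightarrow>\<^sub>C real)" where
  "pot c = (THE \<phi>. normalized_potential c \<phi>)"

lemma normalized_potential_pot: "normalized_potential c (pot c)"
  unfolding pot_def by (rule theI'[OF ex1_normalized_potential])

lemma pot_unique: "normalized_potential c \<phi> \<Longrightarrow> \<phi> = pot c"
  using ex1_normalized_potential[of c] normalized_potential_pot[of c] by blast

lemma bwd_fwd_pot [simp]: "bwd c (fwd c (pot c)) = pot c"
  and integral_pot [simp]: "(\<integral>y. pot c y \<partial>\<nu>) = 0"
  using normalized_potential_pot[of c] by (simp_all add: normalized_potential_def)

text \<open>Comparison of fixed points: \<open>R\<close> bounds both costs, so both potentials lie
  in the domain where \<open>sink\<close> for the cost \<open>c\<close> contracts by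
  \<open>1 - \<delta>\<close>. The cost enters once in each half step, whence the factor 2;
  \<open>exp (2 * R)\<close> is \<open>1 / \<delta>\<close>.\<close>

lemma pot_lipschitz:
  assumes "2 * norm c \<le> R" "2 * norm c' \<le> R"
  shows "norm (pot c - pot c') \<le> 2 * exp (2 * R) * norm (c - c')"
proof -
  define \<delta> where "\<delta> = exp (- (2 * R))"
  have \<delta>: "\<delta> > 0" by (simp add: \<delta>_def)
  have fix_pt: "sink \<delta> c (pot c) = pot c" for c
    using sink_fixed_point[of \<delta> c "pot c"] normalized_potential_pot \<delta> by simp
  have osc: "pot c y - pot c y' \<le> R" "pot c' y - pot c' y' \<le> R" for y y'
    using assms normalized_potential_osc[OF normalized_potential_pot, of c y y']
      normalized_potential_osc[OF normalized_potential_pot, of c' y y'] by linarith+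
  have "norm (pot c - pot c') \<le> norm (sink \<delta> c (pot c) - sink \<delta> c (pot c')) + norm (sink \<delta> c (pot c') - sink \<delta> c' (pot c'))"
    unfolding fix_pt using norm_triangle_ineq[of "pot c - sink \<delta> c (pot c')" "sink \<delta> c (pot c') - pot c'"] by simp
  also have "norm (sink \<delta> c (pot c) - sink \<delta> c (pot c')) \<le> (1 - \<delta>) * norm (pot c - pot c')"
    unfolding \<delta>_def by (rule sink_contraction[OF assms(1) osc])
  also have "norm (sink \<delta> c (pot c') - sink \<delta> c' (pot c')) \<le> 2 * norm (c - c')"
  proof -
    have "norm (sink \<delta> c (pot c') - sink \<delta> c' (pot c')) \<le> norm (fwd c (pot c') - fwd c' (pot c')) + norm (c - c')"
      unfolding sink_def by (rule order_trans[OF bwd_lipschitz]) simp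
    then show ?thesis using fwd_lipschitz[of c "pot c'" c' "pot c'"] by simp
  qed
  finally have "\<delta> * norm (pot c - pot c') \<le> 2 * norm (c - c')"
    by (simp add: algebra_simps)
  then have "norm (pot c - pot c') \<le> 2 * norm (c - c') / \<delta>"
    using \<delta> by (simp add: field_simps)
  then show ?thesis by (simp add: \<delta>_def exp_minus field_simps)
qed

end

subsection \<open>Inverse operators and differentiability of fixed points\<close>

lemma bounded_linear_bounded_bilinear_compose:
  assumes "bounded_linear f" "bounded_bilinear h"
  shows "bounded_bilinear (\<lambda>x y. f (h x y))"
proof -
  interpret f: bounded_linear f by fact
  interpret h: bounded_bilinear h by fact
  obtain K where K: "\<And>x. norm (f x) \<le> norm x * K" "K \<ge> 0" using f.nonneg_bounded by metis
  obtain L where L: "\<And>x y. norm (h x y) \<le> norm x * norm y * L" using h.nonneg_bounded by metis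
  show ?thesis
  proof
    show "\<exists>K. \<forall>a b. norm (f (h a b)) \<le> norm a * norm b * K"
    proof (intro exI[of _ "L * K"] allI)
      fix a b
      have "norm (f (h a b)) \<le> norm (h a b) * K" by (rule K)
      also have "\<dots> \<le> (norm a * norm b * L) * K" using L K by (intro mult_right_mono) auto
      finally show "norm (f (h a b)) \<le> norm a * norm b * (L * K)" by (simp add: mult.assoc)
    qed
  qed (simp_all add: h.add_left h.add_right h.scaleR_left h.scaleR_right f.add f.scaleR)
qed

lemma blinfun_apply_Blinfun_bilinear:
  "bounded_bilinear h \<Longrightarrow> blinfun_apply (Blinfun (h x)) = h x"
  by (intro bounded_linear_Blinfun_apply bounded_bilinear.bounded_linear_right)

text \<open>Currying into the operator space: boundedness in the first argument now refers to the
  operator norm, as needed to differentiate operator-valued maps.\<close>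

lemma bounded_linear_Blinfun_bilinear:
  assumes "bounded_bilinear h"
  shows "bounded_linear (\<lambda>x. Blinfun (h x))"
proof -
  have "h = (\<lambda>i. blinfun_apply (Blinfun (h i)))"
    by (rule ext) (rule blinfun_apply_Blinfun_bilinear[OF assms, symmetric])
  from transfer_bounded_bilinear_bounded_linearI[OF this] show ?thesis
    using assms by (rule iffD1)
qed

text \<open>The inverse at \<open>w\<close> is the fixed point of the contraction
  \<open>v \<mapsto> M v + w\<close>; linearity follows from uniqueness of the fixed point,
  boundedness from the triangle inequality.\<close>

lemma blinfun_inverse_id_minus:
  fixes M :: "'a::{real_normed_vector, complete_space} \<Rightarrow>\<^sub>L 'a"
  assumes M: "norm M < 1"
  obtains R :: "'a \<Rightarrow>\<^sub>L 'a" where "\<And>v. R (v - M v) = v" "\<And>w. R w - M (R w) = w"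
proof -
  have ex1: "\<exists>!v. M v + w = v" for w
  proof -
    have "\<exists>!v\<in>UNIV. M v + w = v"
    proof (intro Banach_fix[where c = "norm M"])
      show "dist (M x + w) (M y + w) \<le> norm M * dist x y" for x y
        using norm_blinfun[of M "x - y"] by (simp add: dist_norm blinfun.diff_right)
    qed (use M complete_UNIV in simp_all)
    then show ?thesis by simp
  qed
  define r where "r w = (THE v. M v + w = v)" for w
  have r: "M (r w) + w = r w" for w
    unfolding r_def by (rule theI'[OF ex1])
  have uniq: "r w = v" if "M v + w = v" for v w
    using ex1[of w] that r[of w] by blast
  have bound: "norm (r w) \<le> norm w * (1 / (1 - norm M))" for w
  proof -
    have "norm (r w) \<le> norm (M (r w)) + norm w"
      using norm_triangle_ineq[of "M (r w)" w] by (simp add: r)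
    also have "norm (M (r w)) \<le> norm M * norm (r w)" by (rule norm_blinfun)
    finally have "norm (r w) * (1 - norm M) \<le> norm w" by (simp add: algebra_simps)
    then show ?thesis using M by (simp add: field_simps)
  qed
  have bl: "bounded_linear r"
  proof (rule bounded_linear_intro[OF _ _ bound])
    fix x y :: 'a and a :: real
    have "M (r x + r y) + (x + y) = (M (r x) + x) + (M (r y) + y)"
      by (simp add: blinfun.add_right)
    then show "r (x + y) = r x + r y" by (intro uniq) (simp add: r)
    have "M (a *\<^sub>R r x) + a *\<^sub>R x = a *\<^sub>R (M (r x) + x)"
      by (simp add: blinfun.scaleR_right scaleR_right_distrib)
    then show "r (a *\<^sub>R x) = a *\<^sub>R r x" by (intro uniq) (simp add: r)
  qed
  show thesis
  proof (rule that[of "Blinfun r"])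
    show "Blinfun r (v - M v) = v" for v
      using uniq[of v "v - M v"] by (simp add: bounded_linear_Blinfun_apply[OF bl])
    show "Blinfun r w - M (Blinfun r w) = w" for w
      unfolding bounded_linear_Blinfun_apply[OF bl] by (metis r add_diff_cancel_left')
  qed
qed

text \<open>Implicit differentiation. With \<open>D = \<phi> c - \<phi> c0\<close>, the fixed-point
  equation reads \<open>D - G' (0, D) = G' (c - c0, 0)\<close> up to an error small against
  \<open>norm (c - c0, D)\<close>. The Lipschitz hypothesis bounds this by a multiple of
  \<open>norm (c - c0)\<close>, and a left inverse at the single point \<open>c0\<close> isolates
  \<open>D\<close>.\<close>

lemma fixed_point_has_derivative:
  fixes G :: "'a::real_normed_vector \<times> 'b::real_normed_vector \<Rightarrow> 'b" and R :: "'b \<Rightarrow>\<^sub>L 'b"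
  assumes G: "(G has_derivative G') (at (c0, \<phi> c0))"
    and fix_pt: "\<And>c. G (c, \<phi> c) = \<phi> c"
    and lip: "\<And>c. norm (c - c0) \<le> r \<Longrightarrow> norm (\<phi> c - \<phi> c0) \<le> K * norm (c - c0)" and r: "r > 0"
    and R: "\<And>v. R (v - G' (0, v)) = v"
  shows "(\<phi> has_derivative (\<lambda>d. R (G' (d, 0)))) (at c0)"
  unfolding has_derivative_at_alt
proof (intro conjI allI impI)
  interpret G': bounded_linear G' using G by (rule has_derivative_bounded_linear)
  show "bounded_linear (\<lambda>d. R (G' (d, 0)))"
    by (intro bounded_linear_compose[OF blinfun.bounded_linear_right]
        bounded_linear_compose[OF G'.bounded_linear_axioms] bounded_linear_Pair
        bounded_linear_ident bounded_linear_zero)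
  fix e :: real assume e: "e > 0"
  \<comment> \<open>The error is later multiplied by \<open>norm R\<close> and by the factor
    \<open>\<bar>K\<bar> + 1\<close> that bounds \<open>norm (c - c0, D)\<close>; both are divided
    out here.\<close>
  define e' where "e' = e / ((norm R + 1) * (\<bar>K\<bar> + 1))"
  have e': "e' > 0" using e by (auto simp: e'_def intro!: divide_pos_pos mult_pos_pos add_nonneg_pos)
  from G e' obtain d where d: "d > 0"
    "\<And>z. norm (z - (c0, \<phi> c0)) < d \<Longrightarrow>
      norm (G z - G (c0, \<phi> c0) - G' (z - (c0, \<phi> c0))) \<le> e' * norm (z - (c0, \<phi> c0))"
    unfolding has_derivative_at_alt by blast
  show "\<exists>d>0. \<forall>c. norm (c - c0) < d \<longrightarrow> norm (\<phi> c - \<phi> c0 - R (G' (c - c0, 0))) \<le> e * norm (c - c0)"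
  proof (intro exI[of _ "min r (d / (\<bar>K\<bar> + 1))"] conjI allI impI)
    show "min r (d / (\<bar>K\<bar> + 1)) > 0" using r d by auto
    fix c assume c: "norm (c - c0) < min r (d / (\<bar>K\<bar> + 1))"
    define D where "D = \<phi> c - \<phi> c0"
    have "norm D \<le> K * norm (c - c0)" using lip[of c] c by (simp add: D_def)
    also have "\<dots> \<le> \<bar>K\<bar> * norm (c - c0)" by (intro mult_right_mono) auto
    finally have nD: "norm ((c - c0, D)) \<le> (\<bar>K\<bar> + 1) * norm (c - c0)"
      using norm_Pair_le[of "c - c0" D] by (simp add: algebra_simps)
    also have "\<dots> < d"
      using c by (simp add: field_simps)
    finally have "norm (G (c, \<phi> c) - G (c0, \<phi> c0) - G' (c - c0, D)) \<le> e' * norm (c - c0, D)"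
      using d(2)[of "(c, \<phi> c)"] by (simp add: D_def)
    also have "\<dots> \<le> e' * ((\<bar>K\<bar> + 1) * norm (c - c0))"
      using nD e' by (intro mult_left_mono) auto
    finally have rem: "norm (D - G' (c - c0, D)) \<le> e' * ((\<bar>K\<bar> + 1) * norm (c - c0))"
      by (simp add: fix_pt D_def)
    have "G' (c - c0, D) = G' (c - c0, 0) + G' (0, D)"
      by (simp flip: G'.add)
    then have "\<phi> c - \<phi> c0 - R (G' (c - c0, 0)) = R (D - G' (0, D)) - R (G' (c - c0, 0))"
      by (simp add: R D_def)
    also have "\<dots> = R (D - G' (c - c0, D))"
      by (simp add: \<open>G' (c - c0, D) = _\<close> blinfun.diff_right blinfun.add_right)
    also have "norm \<dots> \<le> norm R * norm (D - G' (c - c0, D))" by (rule norm_blinfun)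
    also have "\<dots> \<le> (norm R + 1) * (e' * ((\<bar>K\<bar> + 1) * norm (c - c0)))"
      using rem by (intro mult_mono) auto
    also have "\<dots> = e * norm (c - c0)"
    proof -
      have "norm R + 1 \<noteq> 0" "\<bar>K\<bar> + 1 \<noteq> 0" using norm_ge_zero[of R] by linarith+
      then show ?thesis by (simp add: e'_def)
    qed
    finally show "norm (\<phi> c - \<phi> c0 - R (G' (c - c0, 0))) \<le> e * norm (c - c0)" .
  qed
qed

lemma bfst_const: "bfst (const_bcontfun a) = const_bcontfun a"
  and bsnd_const: "bsnd (const_bcontfun b) = const_bcontfun b"
  by (auto intro!: bcontfun_eqI)

subsection \<open>The linearized Schroedinger system\<close>

context schroedinger
begin

text \<open>For \<open>k\<close> the density of a coupling, this is the conditional expectation of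
  \<open>f\<close> given the first variable. It is bilinear in \<open>k\<close> and \<open>f\<close>
  and defined for every \<open>k\<close>, since the smoothness argument differentiates in
  \<open>k\<close>.\<close>

definition cond_fst :: "(('a \<times> 'b) \<Rightarrow>\<^sub>C real) \<Rightarrow> (('a \<times> 'b) \<Rightarrow>\<^sub>C real) \<Rightarrow> ('a \<Rightarrow>\<^sub>C real)" where
  "cond_fst k f = nu.marg (bmult k f)"

definition cond_snd :: "(('a \<times> 'b) \<Rightarrow>\<^sub>C real) \<Rightarrow> (('a \<times> 'b) \<Rightarrow>\<^sub>C real) \<Rightarrow> ('b \<Rightarrow>\<^sub>C real)" where
  "cond_snd k f = mu.marg (bswap (bmult k f))"

lemma apply_cond_fst: "cond_fst k f x = (\<integral>y. k (x, y) * f (x, y) \<partial>\<nu>)"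
  and apply_cond_snd: "cond_snd k f y = (\<integral>x. k (x, y) * f (x, y) \<partial>\<mu>)"
  by (simp_all add: cond_fst_def cond_snd_def)

lemma bounded_bilinear_cond_fst: "bounded_bilinear cond_fst"
  unfolding cond_fst_def[abs_def]
  by (rule bounded_linear_bounded_bilinear_compose[OF nu.bounded_linear_marg bounded_bilinear_bmult])

lemma bounded_bilinear_cond_snd: "bounded_bilinear cond_snd"
  unfolding cond_snd_def[abs_def]
  by (rule bounded_linear_bounded_bilinear_compose[OF mu.bounded_linear_marg
      bounded_linear_bounded_bilinear_compose[OF bounded_linear_bswap bounded_bilinear_bmult]])

definition Pop :: "(('a \<times> 'b) \<Rightarrow>\<^sub>C real) \<Rightarrow> ('b \<Rightarrow>\<^sub>C real) \<Rightarrow>\<^sub>L ('a \<Rightarrow>\<^sub>C real)" where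
  "Pop k = Blinfun (\<lambda>v. cond_fst k (bsnd v))"

definition Qop :: "(('a \<times> 'b) \<Rightarrow>\<^sub>C real) \<Rightarrow> ('a \<Rightarrow>\<^sub>C real) \<Rightarrow>\<^sub>L ('b \<Rightarrow>\<^sub>C real)" where
  "Qop k = Blinfun (\<lambda>u. cond_snd k (bfst u))"

definition mean :: "('b \<Rightarrow>\<^sub>C real) \<Rightarrow>\<^sub>L ('b \<Rightarrow>\<^sub>C real)" where
  "mean = Blinfun (\<lambda>v. const_bcontfun (\<integral>y. apply_bcontfun v y \<partial>\<nu>))"

lemmas bounded_bilinear_cond_fst_bsnd =
  bounded_bilinear.comp[OF bounded_bilinear_cond_fst bounded_linear_ident bounded_linear_bsnd]
lemmas bounded_bilinear_cond_snd_bfst =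
  bounded_bilinear.comp[OF bounded_bilinear_cond_snd bounded_linear_ident bounded_linear_bfst]

lemma Pop_apply [simp]: "Pop k v = cond_fst k (bsnd v)"
  unfolding Pop_def
  by (subst blinfun_apply_Blinfun_bilinear[OF bounded_bilinear_cond_fst_bsnd]) simp

lemma Qop_apply [simp]: "Qop k u = cond_snd k (bfst u)"
  unfolding Qop_def
  by (subst blinfun_apply_Blinfun_bilinear[OF bounded_bilinear_cond_snd_bfst]) simp

lemma bounded_linear_Pop: "bounded_linear Pop"
  unfolding Pop_def[abs_def] by (rule bounded_linear_Blinfun_bilinear[OF bounded_bilinear_cond_fst_bsnd])

lemma bounded_linear_Qop: "bounded_linear Qop"
  unfolding Qop_def[abs_def] by (rule bounded_linear_Blinfun_bilinear[OF bounded_bilinear_cond_snd_bfst])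

lemma mean_apply [simp]: "mean v = const_bcontfun (\<integral>y. v y \<partial>\<nu>)"
  unfolding mean_def
  by (subst bounded_linear_Blinfun_apply)
    (intro bounded_linear_compose[OF bounded_linear_const_bcontfun] nu.bounded_linear_integral_bcontfun refl)+

text \<open>The rank-one term \<open>mean\<close> removes the kernel of \<open>id - QP\<close>, which consists of the constants.\<close>

definition Lop :: "(('a \<times> 'b) \<Rightarrow>\<^sub>C real) \<Rightarrow> ('b \<Rightarrow>\<^sub>C real) \<Rightarrow>\<^sub>L ('b \<Rightarrow>\<^sub>C real)" where
  "Lop k = id_blinfun - (Qop k o\<^sub>L Pop k) + mean"

lemma Lop_apply: "Lop k v = v - Qop k (Pop k v) + mean v"
  by (simp add: Lop_def plus_blinfun.rep_eq minus_blinfun.rep_eq)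

text \<open>The densities to which Doeblin's argument applies: the lower bound is the minorization,
  and the two integrals make \<open>QP\<close> preserve constants and means.\<close>

definition markov :: "(('a \<times> 'b) \<Rightarrow>\<^sub>C real) \<Rightarrow> bool" where
  "markov k \<longleftrightarrow> (\<forall>x. (\<integral>y. k (x, y) \<partial>\<nu>) = 1) \<and> (\<forall>y. (\<integral>x. k (x, y) \<partial>\<mu>) = 1) \<and> (\<exists>\<delta>>0. \<forall>z. \<delta> \<le> k z)"

lemma integral_cond_fst: "(\<integral>x. cond_fst k f x \<partial>\<mu>) = (\<integral>z. k z * f z \<partial>(\<mu> \<Otimes>\<^sub>M \<nu>))"
  using integral_marg_fst[of "bmult k f"] by (simp add: cond_fst_def)

lemma integral_cond_snd: "(\<integral>y. cond_snd k f y \<partial>\<nu>) = (\<integral>z. k z * f z \<partial>(\<mu> \<Otimes>\<^sub>M \<nu>))"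
  using integral_marg_snd[of "bmult k f"] by (simp add: cond_snd_def)

context
  fixes k assumes k: "markov k"
begin

lemma cond_fst_bfst: "cond_fst k (bfst u) = u"
  using k by (intro bcontfun_eqI) (simp add: apply_cond_fst markov_def)

lemma cond_snd_bsnd: "cond_snd k (bsnd v) = v"
  using k by (intro bcontfun_eqI) (simp add: apply_cond_snd markov_def)

lemma integral_cond_fst_bsnd: "(\<integral>x. cond_fst k (bsnd v) x \<partial>\<mu>) = (\<integral>y. v y \<partial>\<nu>)"
  using integral_cond_snd[of k "bsnd v"] by (simp only: integral_cond_fst cond_snd_bsnd)

lemma integral_cond_snd_bfst: "(\<integral>y. cond_snd k (bfst u) y \<partial>\<nu>) = (\<integral>x. u x \<partial>\<mu>)"
  using integral_cond_fst[of k "bfst u"] by (simp only: integral_cond_snd cond_fst_bfst)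

lemma cond_fst_const [simp]: "cond_fst k (const_bcontfun a) = const_bcontfun a"
  using cond_fst_bfst[of "const_bcontfun a"] by (simp only: bfst_const)

lemma cond_snd_const [simp]: "cond_snd k (const_bcontfun a) = const_bcontfun a"
  using cond_snd_bsnd[of "const_bcontfun a"] by (simp only: bsnd_const)

text \<open>\<open>P\<close> and \<open>Q\<close> preserve integrals, so \<open>id - QP\<close> has
  image of mean zero and only the rank-one term contributes.\<close>

lemma mean_Lop: "mean (Lop k v) = mean v"
  using integral_cond_snd_bfst[of "cond_fst k (bsnd v)"]
  by (simp add: Lop_apply integral_cond_fst_bsnd)

text \<open>Write \<open>L = (id - M) + (1 - \<delta>) mean\<close> with
  \<open>M = QP - \<delta> mean\<close>, whose norm is at most \<open>1 - \<delta>\<close> by the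
  minorization. As \<open>L\<close> preserves means, the other rank-one term can be subtracted
  explicitly before the inverse \<open>S\<close> of \<open>id - M\<close> is applied.\<close>

lemma Lop_inverse: obtains R where "\<And>v. blinfun_apply R (Lop k v) = v" "\<And>w. Lop k (blinfun_apply R w) = w"
proof -
  from k obtain \<delta> where \<delta>: "\<delta> > 0" "\<And>z. \<delta> \<le> k z"
    and one: "\<And>x. (\<integral>y. k (x, y) \<partial>\<nu>) = 1" "\<And>y. (\<integral>x. k (x, y) \<partial>\<mu>) = 1"
    by (auto simp: markov_def)
  have "\<delta> \<le> 1"
    using integral_mono[of \<nu> "\<lambda>_. \<delta>" "\<lambda>y. k (x, y)" for x] \<delta> one nu.integrable_slice[of k]
    by (simp add: nu.integral_const)
  define M where "M = (Qop k o\<^sub>L Pop k) - \<delta> *\<^sub>R mean"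
  have M: "M v = Qop k (Pop k v) - \<delta> *\<^sub>R mean v" for v
    by (simp add: M_def minus_blinfun.rep_eq scaleR_blinfun.rep_eq)
  have norm_Q: "norm (cond_snd k (bfst u)) \<le> norm u" for u
  proof (rule bcontfun_norm_le)
    fix y
    show "\<bar>cond_snd k (bfst u) y\<bar> \<le> norm u"
      using mu.markov_minorized_contraction[of 0 "bswap k" y u] one \<delta> less_imp_le[OF less_le_trans[OF \<delta>]]
      by (simp add: apply_cond_snd)
  qed
  have "norm M \<le> 1 - \<delta>"
  proof (rule norm_blinfun_bound)
    show "0 \<le> 1 - \<delta>" using \<open>\<delta> \<le> 1\<close> by simp
    fix v
    \<comment> \<open>\<open>Q\<close> fixes constants, so the subtracted mean moves inside
      \<open>Q\<close>; then only \<open>P\<close> has to contract.\<close>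
    have "M v = Qop k (Pop k v - const_bcontfun (\<delta> * (\<integral>y. v y \<partial>\<nu>)))"
      unfolding M blinfun.diff_right
      by (auto intro!: bcontfun_eqI simp: bfst_const)
    also have "norm \<dots> \<le> norm (Pop k v - const_bcontfun (\<delta> * (\<integral>y. v y \<partial>\<nu>)))"
      using norm_Q by simp
    also have "\<dots> \<le> (1 - \<delta>) * norm v"
      using nu.markov_minorized_contraction[of \<delta> k _ v] one \<delta>
      by (intro bcontfun_norm_le) (simp add: apply_cond_fst)
    finally show "norm (M v) \<le> (1 - \<delta>) * norm v" .
  qed
  with \<open>\<delta> > 0\<close> have "norm M < 1" by simp
  from blinfun_inverse_id_minus[OF this] obtain S where
    S: "\<And>v. blinfun_apply S (v - M v) = v" "\<And>w. blinfun_apply S w - M (blinfun_apply S w) = w" by blast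
  define R where "R = S o\<^sub>L (id_blinfun - (1 - \<delta>) *\<^sub>R mean)"
  have R: "R w = S (w - (1 - \<delta>) *\<^sub>R mean w)" for w
    by (simp add: R_def minus_blinfun.rep_eq scaleR_blinfun.rep_eq)
  have LM: "Lop k v = (v - M v) + (1 - \<delta>) *\<^sub>R mean v" for v
    unfolding Lop_apply M by (simp add: algebra_simps)
  have mm: "mean (mean v) = mean v" for v
    by (simp add: nu.integral_const)
  show thesis
  proof (rule that[of R])
    show "R (Lop k v) = v" for v
      unfolding R mean_Lop unfolding LM by (simp add: S)
    show "Lop k (R w) = w" for w
    proof -
      define s where "s = w - (1 - \<delta>) *\<^sub>R mean w"
      \<comment> \<open>Computing the mean of \<open>L (S s)\<close> in two ways determines the mean
        of \<open>S s\<close>, which is all that the rank-one term of \<open>L\<close> sees.\<close>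
      have "mean (Lop k (S s)) = mean (S s)" by (rule mean_Lop)
      then have "mean s + (1 - \<delta>) *\<^sub>R mean (S s) = mean (S s)"
        unfolding LM S(2) blinfun.add_right blinfun.scaleR_right mm .
      moreover have "mean s = \<delta> *\<^sub>R mean w"
        unfolding s_def blinfun.diff_right blinfun.scaleR_right mm by (simp add: algebra_simps)
      ultimately have "\<delta> *\<^sub>R mean (S s) = \<delta> *\<^sub>R mean w"
        by (simp add: algebra_simps)
      then have "mean (S s) = mean w" using \<open>\<delta> > 0\<close> by simp
      then have "Lop k (S s) = s + (1 - \<delta>) *\<^sub>R mean w"
        unfolding LM S(2) by (rule arg_cong)
      then show ?thesis by (simp only: R s_def) (simp add: algebra_simps)
    qed
  qed
qed

end

definition Rop :: "(('a \<times> 'b) \<Rightarrow>\<^sub>C real) \<Rightarrow> ('b \<Rightarrow>\<^sub>C real) \<Rightarrow>\<^sub>L ('b \<Rightarrow>\<^sub>C real)" where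
  "Rop k = (SOME R. (\<forall>v. blinfun_apply R (Lop k v) = v) \<and> (\<forall>w. Lop k (blinfun_apply R w) = w))"

lemma Rop_Lop: "markov k \<Longrightarrow> Rop k (Lop k v) = v"
  and Lop_Rop: "markov k \<Longrightarrow> Lop k (Rop k w) = w"
proof -
  assume "markov k"
  then have "\<exists>R. (\<forall>v. blinfun_apply R (Lop k v) = v) \<and> (\<forall>w. Lop k (blinfun_apply R w) = w)"
    using Lop_inverse by metis
  from someI_ex[OF this] show "Rop k (Lop k v) = v" "Lop k (Rop k w) = w"
    unfolding Rop_def by blast+
qed

text \<open>The system is \<open>u + P v = E(d | x)\<close>, \<open>v + Q u = E(d | y)\<close>.
  Eliminating \<open>u\<close> leaves \<open>(id - QP) v = E(d | y) - Q E(d | x)\<close>; inverting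
  \<open>L\<close> in place of the singular \<open>id - QP\<close> selects the solution whose second
  component has mean zero.\<close>

definition lin_snd :: "(('a \<times> 'b) \<Rightarrow>\<^sub>C real) \<Rightarrow> (('a \<times> 'b) \<Rightarrow>\<^sub>C real) \<Rightarrow> ('b \<Rightarrow>\<^sub>C real)" where
  "lin_snd k d = Rop k (cond_snd k d - Qop k (cond_fst k d))"

definition lin_fst :: "(('a \<times> 'b) \<Rightarrow>\<^sub>C real) \<Rightarrow> (('a \<times> 'b) \<Rightarrow>\<^sub>C real) \<Rightarrow> ('a \<Rightarrow>\<^sub>C real)" where
  "lin_fst k d = cond_fst k d - Pop k (lin_snd k d)"

text \<open>Both parts of the right-hand side average to the integral of \<open>d\<close> against
  the coupling, and \<open>L\<close> preserves means.\<close>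

lemma integral_lin_snd:
  assumes k: "markov k"
  shows "(\<integral>y. lin_snd k d y \<partial>\<nu>) = 0"
proof -
  have "mean (lin_snd k d) = mean (Lop k (lin_snd k d))"
    by (simp only: mean_Lop[OF k])
  also have "\<dots> = mean (cond_snd k d - Qop k (cond_fst k d))"
    by (simp only: lin_snd_def Lop_Rop[OF k])
  also have "\<dots> = 0"
    unfolding blinfun.diff_right mean_apply Qop_apply integral_cond_snd_bfst[OF k]
    unfolding integral_cond_snd integral_cond_fst by simp
  finally have "mean (lin_snd k d) undefined = 0" by simp
  then show ?thesis by simp
qed

lemma linearized_solution:
  assumes k: "markov k"
  shows "lin_fst k d + cond_fst k (bsnd (lin_snd k d)) = cond_fst k d"
    and "lin_snd k d + cond_snd k (bfst (lin_fst k d)) = cond_snd k d"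
proof -
  show "lin_fst k d + cond_fst k (bsnd (lin_snd k d)) = cond_fst k d"
    by (simp add: lin_fst_def)
  have "Lop k (lin_snd k d) = cond_snd k d - Qop k (cond_fst k d)"
    by (simp only: lin_snd_def Lop_Rop[OF k])
  then have "lin_snd k d - Qop k (Pop k (lin_snd k d)) = cond_snd k d - Qop k (cond_fst k d)"
    by (simp add: Lop_apply integral_lin_snd[OF k])
  moreover
  have "Qop k (lin_fst k d) = Qop k (cond_fst k d) - Qop k (Pop k (lin_snd k d))"
    unfolding lin_fst_def by (rule blinfun.diff_right)
  then have "lin_snd k d + Qop k (lin_fst k d) =
      (lin_snd k d - Qop k (Pop k (lin_snd k d))) + Qop k (cond_fst k d)"
    by simp
  ultimately show "lin_snd k d + cond_snd k (bfst (lin_fst k d)) = cond_snd k d"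
    by simp
qed

text \<open>Subtracting its mean from \<open>v\<close> removes the rank-one term of
  \<open>L\<close>, so the left inverse of \<open>L\<close> identifies the difference with
  \<open>lin_snd k d\<close>; the first equation then determines \<open>u\<close>.\<close>

lemma linearized_solution_unique:
  assumes k: "markov k"
    and u: "u + cond_fst k (bsnd v) = cond_fst k d" and v: "v + cond_snd k (bfst u) = cond_snd k d"
  obtains a where "u = lin_fst k d + const_bcontfun a" "v = lin_snd k d - const_bcontfun a"
proof -
  define m where "m = (\<integral>y. v y \<partial>\<nu>)"
  have u': "u = cond_fst k d - Pop k v" using u by (simp add: algebra_simps)
  have "v - Qop k (Pop k v) = cond_snd k d - Qop k (cond_fst k d)"
  proof -
    have "Qop k u = Qop k (cond_fst k d) - Qop k (Pop k v)"
      unfolding u' by (rule blinfun.diff_right)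
    then have "v - Qop k (Pop k v) = (v + Qop k u) - Qop k (cond_fst k d)"
      by simp
    then show ?thesis using v by simp
  qed
  moreover have "Lop k (v - const_bcontfun m) = v - Qop k (Pop k v)"
  proof -
    have "Lop k (v - const_bcontfun m) = Lop k v - Lop k (const_bcontfun m)"
      by (rule blinfun.diff_right)
    also have "Lop k (const_bcontfun m) = const_bcontfun m"
      by (simp add: Lop_apply bsnd_const bfst_const cond_fst_const[OF k] cond_snd_const[OF k])
    finally show ?thesis by (simp add: Lop_apply m_def)
  qed
  ultimately have "lin_snd k d = v - const_bcontfun m"
    unfolding lin_snd_def by (metis Rop_Lop[OF k])
  then have v': "v = lin_snd k d - const_bcontfun (- m)"
    by (auto intro!: bcontfun_eqI)
  have "Pop k v = Pop k (lin_snd k d) - Pop k (const_bcontfun (- m))"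
    unfolding v' by (rule blinfun.diff_right)
  then have "u = lin_fst k d + const_bcontfun (- m)"
    unfolding u' lin_fst_def by (simp add: bsnd_const cond_fst_const[OF k])
  then show thesis using v' by (rule that)
qed

subsection \<open>Derivatives of the potentials\<close>

definition dens :: "(('a \<times> 'b) \<Rightarrow>\<^sub>C real) \<Rightarrow> (('a \<times> 'b) \<Rightarrow>\<^sub>C real)" where
  "dens c = bexp (bfst (fwd c (pot c)) + bsnd (pot c) - c)"

text \<open>At the fixed point the Gibbs densities of both half steps are the coupling density, up
  to the swap; thus the derivatives of the soft transforms become conditional expectations.\<close>

lemma gibbs_fwd: "nu.gibbs (bsnd (pot c) - c) = dens c"
  unfolding nu.gibbs_def dens_def by (rule arg_cong[where f = bexp]) (auto intro!: bcontfun_eqI simp: fwd_def)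

lemma gibbs_bwd: "mu.gibbs (bsnd (fwd c (pot c)) - bswap c) = bswap (dens c)"
proof -
  have "mu.gibbs (bsnd (fwd c (pot c)) - bswap c) = bexp (bsnd (fwd c (pot c)) - bswap c + bfst (bwd c (fwd c (pot c))))"
    unfolding mu.gibbs_def by (rule arg_cong[where f = bexp]) (auto intro!: bcontfun_eqI simp: bwd_def)
  then show ?thesis by (auto intro!: bcontfun_eqI simp: dens_def)
qed

lemma markov_dens: "markov (dens c)"
  unfolding markov_def
proof (intro conjI allI)
  show "(\<integral>y. dens c (x, y) \<partial>\<nu>) = 1" for x
    by (simp add: dens_def integral_fwd)
  show "(\<integral>x. dens c (x, y) \<partial>\<mu>) = 1" for y
    using integral_bwd[of "fwd c (pot c)" c y] by (simp add: dens_def)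
  show "\<exists>\<delta>>0. \<forall>z. \<delta> \<le> dens c z"
    by (intro exI[of _ "exp (- norm (bfst (fwd c (pot c)) + bsnd (pot c) - c))"])
      (auto simp: dens_def simp del: plus_bcontfun.rep_eq minus_bcontfun.rep_eq intro: bcontfun_le_norm)
qed

text \<open>The fixed-point equation is taken with \<open>\<delta> = 1\<close>, for which
  \<open>id\<close> minus the partial derivative in the potential is exactly \<open>Lop\<close>. The
  contraction enters only through \<open>pot_lipschitz\<close>.\<close>

lemma pot_has_derivative: "(pot has_derivative lin_snd (dens c)) (at c)"
proof -
  define k where "k = dens c"
  have k: "markov k" by (simp add: k_def markov_dens)
  define G where "G = (\<lambda>z. sink 1 (fst z) (snd z))"
  define H where "H = (\<lambda>z. fwd (fst z) (snd z) + const_bcontfun (\<integral>y. apply_bcontfun (snd z) y \<partial>\<nu>))"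
  define H' where "H' = (\<lambda>z. - cond_fst k (bsnd (snd z) - fst z) + const_bcontfun (\<integral>y. apply_bcontfun (snd z) y \<partial>\<nu>))"
  define G' where "G' = (\<lambda>z. - cond_snd k (bfst (H' z) - fst z))"
  have H: "(H has_derivative H') (at (c, pot c))"
  proof -
    have 1: "((\<lambda>z. bsnd (snd z) - fst z) has_derivative (\<lambda>z. bsnd (snd z) - fst z)) (at (c, pot c))"
      by (intro bounded_linear_imp_has_derivative bounded_linear_sub
          bounded_linear_compose[OF bounded_linear_bsnd] bounded_linear_fst bounded_linear_snd)
    have 2: "(nu.lse has_derivative (\<lambda>h. nu.marg (bmult (dens c) h))) (at (bsnd (snd (c, pot c)) - fst (c, pot c)))"
      using nu.lse_has_derivative[of "bsnd (pot c) - c"] by (simp add: gibbs_fwd)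
    have 3: "((\<lambda>z. const_bcontfun (\<integral>y. apply_bcontfun (snd z) y \<partial>\<nu>)) has_derivative
        (\<lambda>z. const_bcontfun (\<integral>y. apply_bcontfun (snd z) y \<partial>\<nu>))) (at (c, pot c))"
      by (intro bounded_linear_imp_has_derivative
          bounded_linear_compose[OF bounded_linear_const_bcontfun]
          bounded_linear_compose[OF nu.bounded_linear_integral_bcontfun] bounded_linear_snd)
    show ?thesis
      unfolding H_def H'_def fwd_def cond_fst_def k_def
      by (intro has_derivative_add has_derivative_minus 3 has_derivative_compose[OF 1 2])
  qed
  have G: "(G has_derivative G') (at (c, pot c))"
  proof -
    have H0: "H (c, pot c) = fwd c (pot c)" by (simp add: H_def)
    have 1: "((\<lambda>z. bsnd (H z) - bswap (fst z)) has_derivative (\<lambda>z. bsnd (H' z) - bswap (fst z))) (at (c, pot c))"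
      by (intro has_derivative_diff bounded_linear.has_derivative[OF bounded_linear_bsnd] H
          bounded_linear_imp_has_derivative bounded_linear_compose[OF bounded_linear_bswap] bounded_linear_fst)
    have 2: "(mu.lse has_derivative (\<lambda>h. mu.marg (bmult (bswap k) h)))
        (at (bsnd (H (c, pot c)) - bswap (fst (c, pot c))))"
      using mu.lse_has_derivative[of "bsnd (fwd c (pot c)) - bswap c"] by (simp add: gibbs_bwd H0 k_def)
    have sw: "bmult (bswap k) (bsnd u - bswap d) = bswap (bmult k (bfst u - d))" for u d
      by (auto intro!: bcontfun_eqI)
    have "G = (\<lambda>z. - mu.lse (bsnd (H z) - bswap (fst z)))"
      by (simp add: G_def sink_def H_def bwd_def)
    moreover have "G' = (\<lambda>z. - mu.marg (bmult (bswap k) (bsnd (H' z) - bswap (fst z))))"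
      by (simp add: G'_def cond_snd_def sw)
    ultimately show ?thesis
      using has_derivative_minus[OF has_derivative_compose[OF 1 2]] by simp
  qed
  have *: "v - G' (0, v) = Lop k v" for v
  proof -
    have "G' (0, v) = - cond_snd k (bfst (- cond_fst k (bsnd v) + const_bcontfun (\<integral>y. v y \<partial>\<nu>)))"
      by (simp add: G'_def H'_def)
    also have "bfst (- cond_fst k (bsnd v) + const_bcontfun (\<integral>y. v y \<partial>\<nu>)) =
        const_bcontfun (\<integral>y. v y \<partial>\<nu>) - bfst (cond_fst k (bsnd v))"
      by (auto intro!: bcontfun_eqI)
    also have "cond_snd k \<dots> = const_bcontfun (\<integral>y. v y \<partial>\<nu>) - cond_snd k (bfst (cond_fst k (bsnd v)))"
      by (simp add: bounded_bilinear.diff_right[OF bounded_bilinear_cond_snd] cond_snd_const[OF k])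
    finally show ?thesis by (simp add: Lop_apply)
  qed
  have **: "G' (d, 0) = cond_snd k d - Qop k (cond_fst k d)" for d
  proof -
    have "H' (d, 0) = - cond_fst k (- d)"
      by (simp add: H'_def linear_0[OF bounded_linear.linear[OF bounded_linear_bsnd]])
    then have "H' (d, 0) = cond_fst k d"
      by (simp add: bounded_bilinear.minus_right[OF bounded_bilinear_cond_fst])
    then show ?thesis
      by (simp add: G'_def bounded_bilinear.diff_right[OF bounded_bilinear_cond_snd])
  qed
  \<comment> \<open>Large enough to bound \<open>2 * norm c'\<close> for every cost
    \<open>c'\<close> within distance 1 of \<open>c\<close>.\<close>
  define R where "R = 2 * norm c + 2"
  have "(pot has_derivative (\<lambda>d. Rop k (G' (d, 0)))) (at c)"
  proof (rule fixed_point_has_derivative[where \<phi> = pot and ?c0.0 = c, OF G])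
    show "G (c', pot c') = pot c'" for c'
      using sink_fixed_point[of 1 c' "pot c'"] normalized_potential_pot by (simp add: G_def)
    show "Rop k (v - G' (0, v)) = v" for v
      by (simp only: * Rop_Lop[OF k])
    show "norm (pot c' - pot c) \<le> 2 * exp (2 * R) * norm (c' - c)" if "norm (c' - c) \<le> 1" for c'
    proof (rule pot_lipschitz)
      show "2 * norm c' \<le> R" "2 * norm c \<le> R"
        using norm_triangle_sub[of c' c] that by (auto simp: R_def)
    qed
  qed simp
  moreover have "(\<lambda>d. Rop k (G' (d, 0))) = lin_snd (dens c)"
    by (simp add: fun_eq_iff ** lin_snd_def k_def)
  ultimately show ?thesis by simp
qed

lemma fwd_pot_has_derivative: "((\<lambda>c. fwd c (pot c)) has_derivative lin_fst (dens c)) (at c)"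
proof -
  have 1: "((\<lambda>c. bsnd (pot c) - c) has_derivative (\<lambda>d. bsnd (lin_snd (dens c) d) - d)) (at c)"
    by (intro has_derivative_diff bounded_linear.has_derivative[OF bounded_linear_bsnd]
        pot_has_derivative has_derivative_ident)
  have 2: "(nu.lse has_derivative cond_fst (dens c)) (at (bsnd (pot c) - c))"
    using nu.lse_has_derivative[of "bsnd (pot c) - c"] by (simp add: gibbs_fwd cond_fst_def[abs_def])
  have "((\<lambda>c. fwd c (pot c)) has_derivative (\<lambda>d. - cond_fst (dens c) (bsnd (lin_snd (dens c) d) - d))) (at c)"
    unfolding fwd_def by (intro has_derivative_minus has_derivative_compose[OF 1 2])
  moreover have "(\<lambda>d. - cond_fst (dens c) (bsnd (lin_snd (dens c) d) - d)) = lin_fst (dens c)"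
    by (simp add: fun_eq_iff lin_fst_def bounded_bilinear.diff_right[OF bounded_bilinear_cond_fst])
  ultimately show ?thesis by simp
qed

lemma dens_has_derivative:
  "(dens has_derivative (\<lambda>d. bmult (dens c) (bfst (lin_fst (dens c) d) + bsnd (lin_snd (dens c) d) - d))) (at c)"
proof -
  have 1: "((\<lambda>c. bfst (fwd c (pot c)) + bsnd (pot c) - c) has_derivative
      (\<lambda>d. bfst (lin_fst (dens c) d) + bsnd (lin_snd (dens c) d) - d)) (at c)"
    by (intro has_derivative_diff has_derivative_add bounded_linear.has_derivative[OF bounded_linear_bsnd]
        bounded_linear.has_derivative[OF bounded_linear_bfst]
        pot_has_derivative fwd_pot_has_derivative has_derivative_ident)
  show ?thesis
    using has_derivative_compose[OF 1 bexp_has_derivative] unfolding dens_def[symmetric] .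
qed

section \<open>The dual value: envelope formula and lower bound\<close>

definition dual_value :: "(('a \<times> 'b) \<Rightarrow>\<^sub>C real) \<Rightarrow> real" where
  "dual_value c = (\<integral>x. fwd c (pot c) x \<partial>\<mu>) + (\<integral>y. pot c y \<partial>\<nu>)"

text \<open>Envelope principle: \<open>P\<close> preserves integrals and \<open>lin_snd\<close> has
  mean zero, so the variation of the potentials cancels and only the conditional expectation of
  \<open>d\<close> remains.\<close>

lemma dual_value_has_derivative:
  "(dual_value has_derivative (\<lambda>d. \<integral>z. dens c z * d z \<partial>(\<mu> \<Otimes>\<^sub>M \<nu>))) (at c)"
proof -
  have "(\<integral>x. lin_fst (dens c) d x \<partial>\<mu>) = (\<integral>z. dens c z * d z \<partial>(\<mu> \<Otimes>\<^sub>M \<nu>))" for d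
    by (simp add: lin_fst_def integral_cond_fst integral_cond_fst_bsnd[OF markov_dens] integral_lin_snd[OF markov_dens]
        flip: integral_cond_fst)
  moreover have "dual_value = (\<lambda>c. \<integral>x. fwd c (pot c) x \<partial>\<mu>)"
    by (simp add: dual_value_def fun_eq_iff)
  ultimately show ?thesis
    using bounded_linear.has_derivative[OF mu.bounded_linear_integral_bcontfun fwd_pot_has_derivative[of c]]
    by simp
qed

text \<open>From \<open>t log t \<ge> t - 1\<close> for the density \<open>t\<close>.\<close>

lemma dual_value_ge: "dual_value c \<ge> - norm c"
proof -
  define f where "f = bfst (fwd c (pot c)) + bsnd (pot c) - c"
  have k: "dens c = bexp f" by (simp add: dens_def f_def)
  have one: "(\<integral>z. dens c z \<partial>(\<mu> \<Otimes>\<^sub>M \<nu>)) = 1"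
    using integral_marg_fst[of "dens c"] markov_dens[of c] by (simp add: markov_def)
  have "0 \<le> (\<integral>z. bmult (dens c) f z - dens c z + 1 \<partial>(\<mu> \<Otimes>\<^sub>M \<nu>))"
  proof (rule integral_nonneg_AE, rule AE_I2)
    fix z
    have "exp (f z) * (1 - f z) \<le> exp (f z) * exp (- f z)"
      using exp_ge_add_one_self[of "- f z"] by (intro mult_left_mono) auto
    then show "0 \<le> bmult (dens c) f z - dens c z + 1"
      by (simp add: k exp_minus algebra_simps)
  qed
  also have "\<dots> = (\<integral>z. bmult (dens c) f z \<partial>(\<mu> \<Otimes>\<^sub>M \<nu>))"
    using integrable_pair[of "bmult (dens c) f"] integrable_pair[of "dens c"] one P.prob_space
    unfolding ext[OF apply_bmult] by simp
  also have "\<dots> = (\<integral>z. dens c z * f z \<partial>(\<mu> \<Otimes>\<^sub>M \<nu>))"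
    by simp
  also have "\<dots> = (\<integral>x. cond_fst (dens c) f x \<partial>\<mu>)"
    by (rule integral_cond_fst[symmetric])
  also have "cond_fst (dens c) f = fwd c (pot c) + cond_fst (dens c) (bsnd (pot c)) - cond_fst (dens c) c"
    by (simp add: f_def bounded_bilinear.diff_right[OF bounded_bilinear_cond_fst]
        bounded_bilinear.add_right[OF bounded_bilinear_cond_fst] cond_fst_bfst[OF markov_dens])
  also have "(\<integral>x. \<dots> x \<partial>\<mu>) = dual_value c - (\<integral>x. cond_fst (dens c) c x \<partial>\<mu>)"
    by (simp add: dual_value_def integral_cond_fst_bsnd[OF markov_dens])
  finally have "dual_value c \<ge> (\<integral>x. cond_fst (dens c) c x \<partial>\<mu>)" by simp
  moreover have "\<bar>\<integral>x. cond_fst (dens c) c x \<partial>\<mu>\<bar> \<le> norm c"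
  proof (rule order_trans[OF mu.abs_integral_bcontfun_le], rule bcontfun_norm_le)
    fix x
    have ik: "integrable \<nu> (\<lambda>y. dens c (x, y))" by (rule nu.integrable_slice)
    have ikc: "integrable \<nu> (\<lambda>y. dens c (x, y) * c (x, y))"
      using nu.integrable_slice[of "bmult (dens c) c" x] by simp
    have "\<bar>\<integral>y. dens c (x, y) * c (x, y) \<partial>\<nu>\<bar> \<le> (\<integral>y. \<bar>dens c (x, y) * c (x, y)\<bar> \<partial>\<nu>)"
      using integral_norm_bound[of \<nu> "\<lambda>y. dens c (x, y) * c (x, y)"] by simp
    also have "\<dots> \<le> (\<integral>y. dens c (x, y) * norm c \<partial>\<nu>)"
      using ik by (intro integral_mono integrable_abs ikc)
        (auto simp: abs_mult dens_def intro!: mult_left_mono bcontfun_abs_le)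
    also have "\<dots> = norm c" using ik markov_dens[of c] by (simp add: markov_def)
    finally show "\<bar>cond_fst (dens c) c x\<bar> \<le> norm c" by (simp add: apply_cond_fst)
  qed
  ultimately show ?thesis by linarith
qed

end

subsection \<open>Calculus of continuously differentiable functions\<close>

lemma continuously_differentiable_imp_continuous_on:
  "continuously_differentiable k f \<Longrightarrow> continuous_on UNIV f"
  by (cases k) (auto simp: differentiable_imp_continuous_on differentiable_on_def
      intro: differentiable_at_withinI)

lemma continuously_differentiable_SucD:
  "continuously_differentiable (Suc k) f \<Longrightarrow> continuously_differentiable k f"
proof (induction k arbitrary: f)
  case 0
  then show ?case using continuously_differentiable_imp_continuous_on[OF 0] by simp
next
  case (Suc k)
  show ?case
    unfolding continuously_differentiable.simps(2)[of k]
  proof (intro conjI allI)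
    fix x v
    show "f differentiable at x" using Suc.prems by simp
    have "continuously_differentiable (Suc k) (\<lambda>x. frechet_derivative f (at x) v)"
      using Suc.prems unfolding continuously_differentiable.simps(2)[of "Suc k"] by blast
    then show "continuously_differentiable k (\<lambda>x. frechet_derivative f (at x) v)"
      by (rule Suc.IH)
  qed
qed

lemma continuously_differentiable_SucI:
  assumes "\<And>x. (f has_derivative f' x) (at x)" "\<And>v. continuously_differentiable k (\<lambda>x. f' x v)"
  shows "continuously_differentiable (Suc k) f"
proof -
  have "frechet_derivative f (at x) = f' x" for x
    using assms(1) by (rule frechet_derivative_at[symmetric])
  then show ?thesis using assms by (auto simp: differentiable_def)
qed

lemma continuously_differentiable_has_derivative:
  assumes "continuously_differentiable (Suc k) f"
  shows "(f has_derivative frechet_derivative f (at x)) (at x)"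
  using assms frechet_derivative_works by auto

lemma continuously_differentiable_frechet:
  "continuously_differentiable (Suc k) f \<Longrightarrow> continuously_differentiable k (\<lambda>x. frechet_derivative f (at x) v)"
  by simp

lemma continuously_differentiable_const: "continuously_differentiable k (\<lambda>_. c)"
  by (induction k arbitrary: c) (auto intro!: continuously_differentiable_SucI derivative_eq_intros
      simp del: continuously_differentiable.simps(2))

lemma continuously_differentiable_bounded_linear:
  assumes "bounded_linear g"
  shows "continuously_differentiable k f \<Longrightarrow> continuously_differentiable k (\<lambda>x. g (f x))"
proof (induction k arbitrary: f)
  case 0
  then show ?case
    using assms by (auto intro: bounded_linear.continuous_on)
next
  case (Suc k)
  show ?case
    by (rule continuously_differentiable_SucI[OF bounded_linear.has_derivative[OF assms
            continuously_differentiable_has_derivative[OF Suc.prems]]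
          Suc.IH[OF continuously_differentiable_frechet[OF Suc.prems]]])
qed

lemma continuously_differentiable_add:
  "continuously_differentiable k f \<Longrightarrow> continuously_differentiable k g \<Longrightarrow>
    continuously_differentiable k (\<lambda>x. f x + g x)"
proof (induction k arbitrary: f g)
  case 0
  then show ?case by (auto intro: continuous_intros)
next
  case (Suc k)
  show ?case
    by (rule continuously_differentiable_SucI[OF has_derivative_add[OF
            continuously_differentiable_has_derivative[OF Suc.prems(1)]
            continuously_differentiable_has_derivative[OF Suc.prems(2)]]
          Suc.IH[OF Suc.prems[THEN continuously_differentiable_frechet]]])
qed

lemma continuously_differentiable_minus:
  "continuously_differentiable k f \<Longrightarrow> continuously_differentiable k (\<lambda>x. - f x)"
  by (rule continuously_differentiable_bounded_linear[OF bounded_linear_minus[OF bounded_linear_ident]])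

lemma continuously_differentiable_diff:
  "continuously_differentiable k f \<Longrightarrow> continuously_differentiable k g \<Longrightarrow>
    continuously_differentiable k (\<lambda>x. f x - g x)"
  using continuously_differentiable_add[of k f "\<lambda>x. - g x"] continuously_differentiable_minus[of k g] by simp

lemma continuously_differentiable_bilinear:
  assumes "bounded_bilinear h"
  shows "continuously_differentiable k f \<Longrightarrow> continuously_differentiable k g \<Longrightarrow>
    continuously_differentiable k (\<lambda>x. h (f x) (g x))"
proof (induction k arbitrary: f g)
  case 0
  then show ?case
    using assms by (auto intro: bounded_bilinear.continuous_on)
next
  case (Suc k)
  note D = bounded_bilinear.FDERIV[OF assms continuously_differentiable_has_derivative[OF Suc.prems(1)]
      continuously_differentiable_has_derivative[OF Suc.prems(2)]]
  show ?case
    by (rule continuously_differentiable_SucI[OF D])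
      (intro continuously_differentiable_add Suc.IH continuously_differentiable_SucD[OF Suc.prems(1)]
        continuously_differentiable_SucD[OF Suc.prems(2)]
        continuously_differentiable_frechet[OF Suc.prems(1)]
        continuously_differentiable_frechet[OF Suc.prems(2)])
qed

text \<open>The resolvent identity \<open>R1\<close>, inserted into itself, gives \<open>R2\<close>:
  the expected first-order term plus a remainder \<open>T\<close> that contains
  \<open>N = L y - L x\<close> twice. \<open>R1\<close> also bounds \<open>R\<close> near
  \<open>x\<close>, which makes \<open>T\<close> quadratic.\<close>

lemma blinfun_inverse_has_derivative:
  fixes L R :: "'a::real_normed_vector \<Rightarrow> 'b::real_normed_vector \<Rightarrow>\<^sub>L 'b"
  assumes RL: "\<And>y v. R y (L y v) = v" and LR: "\<And>y v. L y (R y v) = v"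
    and L: "(L has_derivative L') (at x)"
  shows "(R has_derivative (\<lambda>v. - (R x o\<^sub>L (L' v o\<^sub>L R x)))) (at x)"
proof -
  define N where "N y = L y - L x" for y
  define T where "T y = R y o\<^sub>L (N y o\<^sub>L (R x o\<^sub>L (N y o\<^sub>L R x)))" for y
  have N: "N y v = L y v - L x v" for y v by (simp add: N_def minus_blinfun.rep_eq)
  have R1: "R y = R x - (R y o\<^sub>L (N y o\<^sub>L R x))" for y
    by (rule blinfun_eqI) (simp add: minus_blinfun.rep_eq N LR RL blinfun.diff_right)
  have R2: "R y = R x - (R x o\<^sub>L (N y o\<^sub>L R x)) + T y" for y
    by (rule blinfun_eqI)
      (simp add: minus_blinfun.rep_eq plus_blinfun.rep_eq T_def N LR RL blinfun.diff_right)
  interpret L': bounded_linear L' using L by (rule has_derivative_bounded_linear)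
  obtain d where d: "d > 0" "\<And>y. norm (y - x) < d \<Longrightarrow> norm (N y - L' (y - x)) \<le> norm (y - x)"
    using L unfolding has_derivative_at_alt N_def by (metis mult_1 zero_less_one)
  obtain K where K: "K > 0" "\<And>v. norm (L' v) \<le> norm v * K" using L'.pos_bounded by blast
  have N_le: "norm (N y) \<le> (K + 1) * norm (y - x)" if "norm (y - x) < d" for y
    using d(2)[OF that] K(2)[of "y - x"] norm_triangle_sub[of "N y" "L' (y - x)"]
    by (simp add: algebra_simps)
  define a where "a = norm (R x)"
  \<comment> \<open>Small enough for \<open>norm (N y) * a \<le> 1 / 2\<close>, so that the term
    with \<open>norm (R y)\<close> on the right can be absorbed.\<close>
  define r where "r = min (d / 2) (1 / (2 * ((K + 1) * (a + 1))))"
  have r: "r > 0" using d K by (auto simp: r_def a_def intro!: divide_pos_pos mult_pos_pos add_nonneg_pos)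
  have R_le: "norm (R y) \<le> 2 * a" if y: "norm (y - x) \<le> r" for y
  proof -
    have pos: "(K + 1) * (a + 1) > 0" using K by (auto simp: a_def intro!: mult_pos_pos add_nonneg_pos)
    have "norm (N y) * a \<le> ((K + 1) * norm (y - x)) * (a + 1)"
      using y d K by (intro mult_mono N_le) (auto simp: r_def a_def)
    also have "\<dots> \<le> ((K + 1) * (1 / (2 * ((K + 1) * (a + 1))))) * (a + 1)"
      using y K by (intro mult_right_mono mult_left_mono) (auto simp: r_def a_def)
    also have "\<dots> = 1 / 2" using pos by (simp add: field_simps)
    finally have half: "norm (N y) * a \<le> 1 / 2" .
    have "norm (R y) \<le> norm (R x) + norm (R y o\<^sub>L (N y o\<^sub>L R x))"
      by (subst R1) (rule norm_triangle_ineq4)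
    also have "norm (R y o\<^sub>L (N y o\<^sub>L R x)) \<le> norm (R y) * (norm (N y) * a)"
      unfolding a_def by (intro order_trans[OF norm_blinfun_compose] mult_left_mono norm_blinfun_compose) auto
    also have "\<dots> \<le> norm (R y) * (1 / 2)" using half by (intro mult_left_mono) auto
    finally show ?thesis by (simp add: a_def)
  qed
  have "(T has_derivative (\<lambda>_. 0)) (at x)"
  proof (rule has_derivative_quadratic_remainder[OF bounded_linear_zero r])
    fix h :: 'a assume h: "norm h \<le> r"
    have "norm (T (x + h)) \<le> norm (R (x + h)) * (norm (N (x + h)) * (norm (R x) * (norm (N (x + h)) * norm (R x))))"
      unfolding T_def
      by (intro order_trans[OF norm_blinfun_compose] mult_left_mono norm_blinfun_compose norm_ge_zero)
    also have "\<dots> \<le> (2 * a) * (((K + 1) * norm h) * (a * (((K + 1) * norm h) * a)))"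
    proof -
      have "norm (N (x + h)) \<le> (K + 1) * norm h"
        using N_le[of "x + h"] h d by (auto simp: r_def)
      then show ?thesis
        using R_le[of "x + h"] h K by (intro mult_mono) (auto simp: a_def)
    qed
    also have "\<dots> = (2 * a * a * a * (K + 1) * (K + 1)) * (norm h)\<^sup>2"
      by (simp add: power2_eq_square algebra_simps)
    finally show "norm (T (x + h) - T x - 0) \<le> (2 * a * a * a * (K + 1) * (K + 1)) * (norm h)\<^sup>2"
      by (simp add: T_def N_def)
  qed
  moreover have "(N has_derivative L') (at x)"
    unfolding N_def[abs_def] using L by (auto intro!: derivative_eq_intros)
  then have "((\<lambda>y. R x o\<^sub>L (N y o\<^sub>L R x)) has_derivative (\<lambda>v. R x o\<^sub>L (L' v o\<^sub>L R x))) (at x)"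
    by (intro bounded_linear.has_derivative[OF bounded_bilinear.bounded_linear_right[OF bounded_bilinear_blinfun_compose]]
        bounded_linear.has_derivative[OF bounded_bilinear.bounded_linear_left[OF bounded_bilinear_blinfun_compose]])
  ultimately have "((\<lambda>y. R x - (R x o\<^sub>L (N y o\<^sub>L R x)) + T y) has_derivative
      (\<lambda>v. 0 - (R x o\<^sub>L (L' v o\<^sub>L R x)) + 0)) (at x)"
    by (intro has_derivative_add has_derivative_diff has_derivative_const)
  then show ?thesis unfolding R2[symmetric] by simp
qed

text \<open>The derivative \<open>- R L' R\<close> contains \<open>R\<close> itself, which is one
  order smoother at each stage of the induction. Differentiability of \<open>L\<close> starts it:
  continuity of \<open>R\<close> comes from its differentiability.\<close>

lemma continuously_differentiable_inverse:
  fixes L R :: "'a::euclidean_space \<Rightarrow> 'b::real_normed_vector \<Rightarrow>\<^sub>L 'b"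
  assumes RL: "\<And>y v. R y (L y v) = v" and LR: "\<And>y v. L y (R y v) = v"
    and L: "\<And>x. L differentiable (at x)"
  shows "continuously_differentiable k L \<Longrightarrow> continuously_differentiable k R"
proof (induction k)
  case 0
  have "\<forall>x. R differentiable (at x)"
    using blinfun_inverse_has_derivative[of R L, OF RL LR] L unfolding differentiable_def by blast
  then show ?case
    by (auto simp: differentiable_imp_continuous_on differentiable_on_def
      intro: differentiable_at_withinI)
next
  case (Suc k)
  note D = blinfun_inverse_has_derivative[of R L, OF RL LR continuously_differentiable_has_derivative[OF Suc.prems]]
  have R: "continuously_differentiable k R"
    by (rule Suc.IH[OF continuously_differentiable_SucD[OF Suc.prems]])
  show ?case
    by (rule continuously_differentiable_SucI[OF D])
      (intro continuously_differentiable_minus R continuously_differentiable_frechet[OF Suc.prems]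
        continuously_differentiable_bilinear[OF bounded_bilinear_blinfun_compose])
qed

subsection \<open>Smooth dependence on parameters\<close>

context schroedinger
begin

text \<open>The integral of \<open>d\<close> against the coupling with density \<open>k\<close>; its
  bilinearity carries smoothness of the density over to the dual value.\<close>

definition pairing :: "(('a \<times> 'b) \<Rightarrow>\<^sub>C real) \<Rightarrow> (('a \<times> 'b) \<Rightarrow>\<^sub>C real) \<Rightarrow> real" where
  "pairing k d = (\<integral>z. k z * d z \<partial>(\<mu> \<Otimes>\<^sub>M \<nu>))"

lemma bounded_bilinear_pairing: "bounded_bilinear pairing"
proof -
  have "pairing = (\<lambda>k d. \<integral>x. cond_fst k d x \<partial>\<mu>)"
    by (simp add: pairing_def fun_eq_iff integral_cond_fst)
  then show ?thesis
    using bounded_linear_bounded_bilinear_compose[OF mu.bounded_linear_integral_bcontfun bounded_bilinear_cond_fst]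
    by simp
qed

context
  fixes c :: "'e::euclidean_space \<Rightarrow> ('a \<times> 'b) \<Rightarrow>\<^sub>C real" and c'
  assumes c: "\<And>A. (c has_derivative c') (at A)"
begin

lemma bounded_linear_cost_derivative: "bounded_linear c'"
  using c by (rule has_derivative_bounded_linear)

abbreviation "dens_deriv k d \<equiv> bmult k (bfst (lin_fst k d) + bsnd (lin_snd k d) - d)"

lemma dens_cost_has_derivative:
  "((\<lambda>A. dens (c A)) has_derivative (\<lambda>B. dens_deriv (dens (c A)) (c' B))) (at A)"
  using has_derivative_compose[OF c dens_has_derivative] .

text \<open>If the density is \<open>k\<close> times differentiable, so are the operators
  \<open>P\<close>, \<open>Q\<close>, \<open>L\<close> and the inverse \<open>Rop\<close>, hence
  also the derivative of the density. The direction \<open>c' B\<close> is constant in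
  \<open>A\<close>, since the cost has the same derivative everywhere.\<close>

lemma continuously_differentiable_dens: "continuously_differentiable k (\<lambda>A. dens (c A))"
proof (induction k)
  case 0
  have "\<forall>A. (\<lambda>A. dens (c A)) differentiable (at A)"
    using dens_cost_has_derivative unfolding differentiable_def by blast
  then show ?case
    by (auto simp: differentiable_imp_continuous_on differentiable_on_def intro: differentiable_at_withinI)
next
  case (Suc k)
  note k = this
  have Rop: "continuously_differentiable k (\<lambda>A. Rop (dens (c A)))"
  proof (rule continuously_differentiable_inverse[where L = "\<lambda>A. Lop (dens (c A))"])
    show "(\<lambda>A. Lop (dens (c A))) differentiable (at A)" for A
      unfolding differentiable_def Lop_def
      by (rule exI, rule has_derivative_add[OF has_derivative_diff[OF has_derivative_const
            bounded_bilinear.FDERIV[OF bounded_bilinear_blinfun_compose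
              bounded_linear.has_derivative[OF bounded_linear_Qop dens_cost_has_derivative]
              bounded_linear.has_derivative[OF bounded_linear_Pop dens_cost_has_derivative]]]
            has_derivative_const])
    show "continuously_differentiable k (\<lambda>A. Lop (dens (c A)))"
      unfolding Lop_def
      by (intro k continuously_differentiable_add continuously_differentiable_diff continuously_differentiable_const
          continuously_differentiable_bilinear[OF bounded_bilinear_blinfun_compose]
          continuously_differentiable_bounded_linear[OF bounded_linear_Pop]
          continuously_differentiable_bounded_linear[OF bounded_linear_Qop])
  qed (simp_all only: Rop_Lop[OF markov_dens] Lop_Rop[OF markov_dens])
  show ?case
  proof (rule continuously_differentiable_SucI[OF dens_cost_has_derivative])
    fix B
    have snd: "continuously_differentiable k (\<lambda>A. lin_snd (dens (c A)) (c' B))"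
      unfolding lin_snd_def Qop_apply
      by (intro continuously_differentiable_bilinear[OF bounded_bilinear_blinfun_apply] Rop k
          continuously_differentiable_diff continuously_differentiable_const
          continuously_differentiable_bilinear[OF bounded_bilinear_cond_fst]
          continuously_differentiable_bilinear[OF bounded_bilinear_cond_snd]
          continuously_differentiable_bounded_linear[OF bounded_linear_bfst])
    have fst: "continuously_differentiable k (\<lambda>A. lin_fst (dens (c A)) (c' B))"
      unfolding lin_fst_def Pop_apply
      by (intro snd k continuously_differentiable_diff continuously_differentiable_const
          continuously_differentiable_bilinear[OF bounded_bilinear_cond_fst]
          continuously_differentiable_bounded_linear[OF bounded_linear_bsnd])
    show "continuously_differentiable k (\<lambda>A. dens_deriv (dens (c A)) (c' B))"
      by (intro fst snd k continuously_differentiable_diff continuously_differentiable_add continuously_differentiable_const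
          continuously_differentiable_bilinear[OF bounded_bilinear_bmult]
          continuously_differentiable_bounded_linear[OF bounded_linear_bfst]
          continuously_differentiable_bounded_linear[OF bounded_linear_bsnd])
  qed
qed

lemma dual_value_cost_has_derivative:
  "((\<lambda>A. dual_value (c A)) has_derivative (\<lambda>B. \<integral>z. dens (c A) z * c' B z \<partial>(\<mu> \<Otimes>\<^sub>M \<nu>))) (at A)"
  using has_derivative_compose[OF c dual_value_has_derivative] .

lemma continuously_differentiable_dual_value:
  "continuously_differentiable k (\<lambda>A. dual_value (c A))"
proof -
  have "continuously_differentiable (Suc k) (\<lambda>A. dual_value (c A))"
    by (rule continuously_differentiable_SucI[OF dual_value_cost_has_derivative])
      (unfold pairing_def[symmetric], intro continuously_differentiable_bilinear[OF bounded_bilinear_pairing]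
        continuously_differentiable_dens continuously_differentiable_const)
  then show ?thesis by (rule continuously_differentiable_SucD)
qed

text \<open>A second Frechet derivative requires differentiating the gradient in the operator norm.
  The gradient is a bounded linear map applied to the density, so the derivative of the density is
  simply passed through it.\<close>

lemma dual_value_gradient_has_derivative:
  "((\<lambda>A. Blinfun (\<lambda>B. pairing (dens (c A)) (c' B))) has_derivative
    (\<lambda>C. Blinfun (\<lambda>B. pairing (dens_deriv (dens (c A)) (c' C)) (c' B)))) (at A)"
  and blinfun_apply_pairing: "blinfun_apply (Blinfun (\<lambda>B. pairing k (c' B))) B = pairing k (c' B)"
proof -
  note bb = bounded_bilinear.comp[OF bounded_bilinear_pairing bounded_linear_ident bounded_linear_cost_derivative]
  show "((\<lambda>A. Blinfun (\<lambda>B. pairing (dens (c A)) (c' B))) has_derivative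
    (\<lambda>C. Blinfun (\<lambda>B. pairing (dens_deriv (dens (c A)) (c' C)) (c' B)))) (at A)"
    by (rule bounded_linear.has_derivative[OF bounded_linear_Blinfun_bilinear[OF bb] dens_cost_has_derivative])
  show "blinfun_apply (Blinfun (\<lambda>B. pairing k (c' B))) B = pairing k (c' B)"
    by (simp add: blinfun_apply_Blinfun_bilinear[OF bb])
qed

end

end

subsection \<open>Supports\<close>

lemma closed_spt: "closed (spt M)"
proof -
  have "- spt M = \<Union>{U. open U \<and> emeasure M U = 0}"
    by (auto simp: spt_def)
  then have "open (- spt M)" by (simp only:) (intro open_Union, auto)
  then show ?thesis by (simp add: closed_def)
qed

text \<open>Each point outside the support has a null basic neighbourhood, and a countable basis
  leaves only countably many of these to unite.\<close>

lemma AE_spt: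
  fixes M :: "'a::second_countable_topology measure"
  assumes M: "sets M = sets borel"
  shows "AE x in M. x \<in> spt M"
proof -
  obtain B :: "'a set set" where B: "countable B" "topological_basis B"
    using ex_countable_basis by blast
  define Z where "Z = {U\<in>B. emeasure M U = 0}"
  have "\<Union>Z \<in> null_sets M"
  proof (rule null_sets_UN'[where I = Z and N = "\<lambda>U. U", simplified])
    show "countable Z" using B by (auto simp: Z_def)
    show "U \<in> null_sets M" if "U \<in> Z" for U
      using that topological_basis_open[OF B(2)] M by (auto simp: Z_def null_sets_def)
  qed
  moreover have "x \<in> \<Union>Z" if "x \<notin> spt M" for x
  proof -
    from that obtain U where U: "open U" "x \<in> U" "emeasure M U = 0" by (auto simp: spt_def)
    from topological_basisE[OF B(2) U(1,2)] obtain V where V: "V \<in> B" "x \<in> V" "V \<subseteq> U" by metis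
    have "emeasure M V \<le> emeasure M U" using V U M by (intro emeasure_mono) auto
    then show ?thesis using V U by (auto simp: Z_def)
  qed
  ultimately show ?thesis
    by (intro AE_I'[of "\<Union>Z"]) auto
qed

lemma continuous_on_compact_abs_bound:
  fixes f :: "'a::topological_space \<Rightarrow> real"
  assumes "compact C" "continuous_on C f"
  shows "\<exists>B. \<forall>x\<in>C. \<bar>f x\<bar> \<le> B"
  using compact_imp_bounded[OF compact_continuous_image[OF assms(2,1)]]
  by (simp add: bounded_iff)

text \<open>Costs and potentials may be unbounded on the whole space; their integrability rests on
  the concentration of the measures on compact sets.\<close>

lemma integrable_continuous_AE_compact:
  fixes f :: "'a::topological_space \<Rightarrow> real"
  assumes "finite_measure M" and M: "sets M = sets borel" and C: "AE x in M. x \<in> C" "compact C"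
    and f: "continuous_on UNIV f"
  shows "integrable M f"
proof -
  interpret finite_measure M by fact
  obtain B where B: "\<And>x. x \<in> C \<Longrightarrow> \<bar>f x\<bar> \<le> B"
    using continuous_on_compact_abs_bound[OF C(2) continuous_on_subset[OF f subset_UNIV]] by blast
  show ?thesis
  proof (rule integrable_const_bound[where B = B])
    show "AE x in M. norm (f x) \<le> B" using C(1) by eventually_elim (use B in auto)
    show "f \<in> borel_measurable M"
      using borel_measurable_continuous_onI[OF f] measurable_cong_sets[OF M refl] by blast
  qed
qed

subsection \<open>Optimality of the coupling given by the potentials\<close>

locale eot =
  fixes \<mu>0 :: "(real ^ 'm) measure" and \<mu>1 :: "(real ^ 'n) measure" and \<epsilon> :: real
    and A :: "real ^ 'n ^ 'm" and \<phi>0 \<phi>1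
  assumes supp0: "compactly_supported_prob \<mu>0" and supp1: "compactly_supported_prob \<mu>1"
    and eps: "\<epsilon> > 0"
    and potentials: "EOT_potentials A \<epsilon> \<mu>0 \<mu>1 \<phi>0 \<phi>1"
begin

sublocale m0: borel_prob_space \<mu>0
  using supp0 by (auto simp: compactly_supported_prob_def borel_prob_space_def borel_prob_space_axioms_def)
sublocale m1: borel_prob_space \<mu>1
  using supp1 by (auto simp: compactly_supported_prob_def borel_prob_space_def borel_prob_space_axioms_def)
sublocale schroedinger \<mu>0 \<mu>1 ..

abbreviation "NN \<equiv> \<mu>0 \<Otimes>\<^sub>M \<mu>1"

text \<open>The logarithm of the density of the optimal coupling with respect to the product
  measure.\<close>

definition g where "g z = (\<phi>0 (fst z) + \<phi>1 (snd z) - cost A (fst z) (snd z)) / \<epsilon>"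

abbreviation k where "k z \<equiv> exp (g z)"

lemma kernel_eq: "EOT_kernel A \<epsilon> \<phi>0 \<phi>1 x y = k (x, y)"
  by (simp add: EOT_kernel_def g_def)

lemma continuous_cost: "continuous_on UNIV (\<lambda>z. cost A (fst z) (snd z))"
  unfolding cost_def
  by (intro continuous_intros bounded_linear.continuous_on[OF matrix_vector_mul_bounded_linear])

lemma continuous_potentials: "continuous_on UNIV \<phi>0" "continuous_on UNIV \<phi>1"
  using potentials by (auto simp: EOT_potentials_def)

lemma continuous_g: "continuous_on UNIV g"
  unfolding g_def
  by (intro continuous_intros continuous_cost continuous_on_compose2[OF continuous_potentials(1)]
      continuous_on_compose2[OF continuous_potentials(2)]) (use eps in auto)

lemma compact_spt: "compact (spt \<mu>0)" "compact (spt \<mu>1)"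
  using supp0 supp1 by (auto simp: compactly_supported_prob_def)

lemma coupling_prob: "\<pi> \<in> couplings \<mu>0 \<mu>1 \<Longrightarrow> prob_space \<pi>"
proof -
  assume "\<pi> \<in> couplings \<mu>0 \<mu>1"
  then have \<pi>: "sets \<pi> = sets borel" "distr \<pi> borel fst = \<mu>0" by (auto simp: couplings_def)
  have "fst \<in> measurable \<pi> borel"
    using measurable_cong_sets[OF \<pi>(1) refl] borel_measurable_continuous_onI[OF continuous_on_fst[OF continuous_on_id]] by blast
  then show ?thesis
    using prob_space_distrD[of fst \<pi> borel] m0.prob_space_axioms by (simp add: \<pi>)
qed

context
  fixes \<pi> assumes \<pi>: "\<pi> \<in> couplings \<mu>0 \<mu>1"
begin

lemma coupling_sets: "sets \<pi> = sets borel"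
  using \<pi> by (auto simp: couplings_def)

lemma coupling_measurable [measurable]: "fst \<in> measurable \<pi> borel" "snd \<in> measurable \<pi> borel"
  using measurable_cong_sets[OF coupling_sets refl] borel_measurable_continuous_onI[OF continuous_on_fst[OF continuous_on_id]]
    borel_measurable_continuous_onI[OF continuous_on_snd[OF continuous_on_id]] by blast+

lemma coupling_AE: "AE z in \<pi>. z \<in> spt \<mu>0 \<times> spt \<mu>1"
proof -
  have "AE x in distr \<pi> borel fst. x \<in> spt \<mu>0" "AE x in distr \<pi> borel snd. x \<in> spt \<mu>1"
    using \<pi> AE_spt[OF m0.sets_eq] AE_spt[OF m1.sets_eq] by (auto simp: couplings_def)
  then have "AE z in \<pi>. fst z \<in> spt \<mu>0" "AE z in \<pi>. snd z \<in> spt \<mu>1"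
    by (auto dest!: AE_distrD[rotated])
  then show ?thesis by eventually_elim auto
qed

lemma coupling_integrable: "continuous_on UNIV f \<Longrightarrow> integrable \<pi> f" for f :: "_ \<Rightarrow> real"
  using integrable_continuous_AE_compact[OF _ coupling_sets coupling_AE compact_Times[OF compact_spt]]
    prob_space.finite_measure[OF coupling_prob[OF \<pi>]] by blast

lemma coupling_integral_fst: "continuous_on UNIV f \<Longrightarrow> (\<integral>z. f (fst z) \<partial>\<pi>) = (\<integral>x. f x \<partial>\<mu>0)" for f :: "_ \<Rightarrow> real"
  using \<pi> integral_distr[of fst \<pi> borel f] borel_measurable_continuous_onI[of f] by (auto simp: couplings_def)

lemma coupling_integral_snd: "continuous_on UNIV f \<Longrightarrow> (\<integral>z. f (snd z) \<partial>\<pi>) = (\<integral>x. f x \<partial>\<mu>1)" for f :: "_ \<Rightarrow> real"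
  using \<pi> integral_distr[of snd \<pi> borel f] borel_measurable_continuous_onI[of f] by (auto simp: couplings_def)

text \<open>A coupling integrates each potential against its own marginal, so the two potential
  terms do not depend on \<open>\<pi>\<close>. This ties the transport cost to an integral of the
  log-density \<open>g\<close>.\<close>

lemma coupling_integral_g:
  "\<epsilon> * (\<integral>z. g z \<partial>\<pi>) = (\<integral>x. \<phi>0 x \<partial>\<mu>0) + (\<integral>y. \<phi>1 y \<partial>\<mu>1) - (\<integral>z. cost A (fst z) (snd z) \<partial>\<pi>)"
proof -
  have "(\<integral>z. g z \<partial>\<pi>) = (\<integral>z. \<phi>0 (fst z) + \<phi>1 (snd z) - cost A (fst z) (snd z) \<partial>\<pi>) / \<epsilon>"
    unfolding g_def by simp
  also have "(\<integral>z. \<phi>0 (fst z) + \<phi>1 (snd z) - cost A (fst z) (snd z) \<partial>\<pi>) =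
      (\<integral>z. \<phi>0 (fst z) \<partial>\<pi>) + (\<integral>z. \<phi>1 (snd z) \<partial>\<pi>) - (\<integral>z. cost A (fst z) (snd z) \<partial>\<pi>)"
  proof -
    have "integrable \<pi> (\<lambda>z. \<phi>0 (fst z))" "integrable \<pi> (\<lambda>z. \<phi>1 (snd z))" "integrable \<pi> (\<lambda>z. cost A (fst z) (snd z))"
      by (intro coupling_integrable continuous_cost continuous_on_compose2[OF continuous_potentials(1)]
          continuous_on_compose2[OF continuous_potentials(2)] continuous_intros; simp)+
    then show ?thesis by simp
  qed
  finally show ?thesis
    using eps by (simp add: coupling_integral_fst coupling_integral_snd continuous_potentials)
qed

end

lemma g_measurable [measurable]: "g \<in> borel_measurable NN"
  using borel_measurable_continuous_onI[OF continuous_g] measurable_cong_sets[OF sets_pair refl] by blast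

definition opt where "opt = density NN (\<lambda>z. ennreal (k z))"

lemma sets_opt [measurable_cong]: "sets opt = sets NN"
  by (simp add: opt_def)

lemma nn_integral_k_snd: "(\<integral>\<^sup>+y. ennreal (k (x, y)) \<partial>\<mu>1) = 1"
proof -
  have "integrable \<mu>1 (\<lambda>y. k (x, y))"
    by (rule integrable_continuous_AE_compact[OF m1.finite_measure_axioms m1.sets_eq AE_spt[OF m1.sets_eq] compact_spt(2)])
      (intro continuous_intros continuous_on_compose2[OF continuous_g], auto)
  then have "(\<integral>\<^sup>+y. ennreal (k (x, y)) \<partial>\<mu>1) = ennreal (\<integral>y. k (x, y) \<partial>\<mu>1)"
    by (intro nn_integral_eq_integral) auto
  then show ?thesis
    using potentials by (simp add: EOT_potentials_def kernel_eq)
qed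

lemma nn_integral_k_fst: "(\<integral>\<^sup>+x. ennreal (k (x, y)) \<partial>\<mu>0) = 1"
proof -
  have "integrable \<mu>0 (\<lambda>x. k (x, y))"
    by (rule integrable_continuous_AE_compact[OF m0.finite_measure_axioms m0.sets_eq AE_spt[OF m0.sets_eq] compact_spt(1)])
      (intro continuous_intros continuous_on_compose2[OF continuous_g], auto)
  then have "(\<integral>\<^sup>+x. ennreal (k (x, y)) \<partial>\<mu>0) = ennreal (\<integral>x. k (x, y) \<partial>\<mu>0)"
    by (intro nn_integral_eq_integral) auto
  then show ?thesis
    using potentials by (simp add: EOT_potentials_def kernel_eq)
qed

text \<open>By Tonelli, the two equations for the potentials are the marginal conditions for the
  density \<open>k\<close>.\<close>

lemma opt_coupling: "opt \<in> couplings \<mu>0 \<mu>1"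
  unfolding couplings_def
proof (intro CollectI conjI)
  show so: "sets opt = sets borel" by (simp only: opt_def sets_density sets_pair)
  have meas [measurable]: "fst \<in> measurable NN borel" "snd \<in> measurable NN borel"
    using measurable_cong_sets[OF sets_pair refl] borel_measurable_continuous_onI[OF continuous_on_fst[OF continuous_on_id]]
      borel_measurable_continuous_onI[OF continuous_on_snd[OF continuous_on_id]] by blast+
  have meas': "fst \<in> measurable opt borel" "snd \<in> measurable opt borel"
    using meas by (simp_all add: opt_def)
  show "distr opt borel fst = \<mu>0"
  proof (rule measure_eqI)
    fix S assume "S \<in> sets (distr opt borel fst)"
    then have S [measurable]: "S \<in> sets borel" by simp
    have "emeasure (distr opt borel fst) S = emeasure opt (fst -` S \<inter> space opt)"
      using meas' by (intro emeasure_distr) auto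
    also have "\<dots> = (\<integral>\<^sup>+z. ennreal (k z) * indicator S (fst z) \<partial>NN)"
    proof -
      have "fst -` S \<inter> space opt \<in> sets NN"
        using measurable_sets[OF meas(1) S] by (simp add: opt_def)
      then show ?thesis
        unfolding opt_def
        by (subst emeasure_density) (auto intro!: nn_integral_cong simp: indicator_def)
    qed
    also have "\<dots> = (\<integral>\<^sup>+x. \<integral>\<^sup>+y. ennreal (k (x, y)) * indicator S x \<partial>\<mu>1 \<partial>\<mu>0)"
      by (subst m1.nn_integral_fst[symmetric]) auto
    also have "\<dots> = (\<integral>\<^sup>+x. indicator S x \<partial>\<mu>0)"
    proof (intro nn_integral_cong)
      fix x
      have "(\<lambda>y. k (x, y)) \<in> borel_measurable \<mu>1" by measurable
      then show "(\<integral>\<^sup>+y. ennreal (k (x, y)) * indicator S x \<partial>\<mu>1) = indicator S x"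
        by (subst nn_integral_multc) (auto simp: nn_integral_k_snd)
    qed
    also have "\<dots> = emeasure \<mu>0 S" by simp
    finally show "emeasure (distr opt borel fst) S = emeasure \<mu>0 S" .
  qed simp
  show "distr opt borel snd = \<mu>1"
  proof (rule measure_eqI)
    fix S assume "S \<in> sets (distr opt borel snd)"
    then have S [measurable]: "S \<in> sets borel" by simp
    have "emeasure (distr opt borel snd) S = emeasure opt (snd -` S \<inter> space opt)"
      using meas' by (intro emeasure_distr) auto
    also have "\<dots> = (\<integral>\<^sup>+z. ennreal (k z) * indicator S (snd z) \<partial>NN)"
    proof -
      have "snd -` S \<inter> space opt \<in> sets NN"
        using measurable_sets[OF meas(2) S] by (simp add: opt_def)
      then show ?thesis
        unfolding opt_def
        by (subst emeasure_density) (auto intro!: nn_integral_cong simp: indicator_def)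
    qed
    also have "\<dots> = (\<integral>\<^sup>+y. \<integral>\<^sup>+x. ennreal (k (x, y)) * indicator S y \<partial>\<mu>0 \<partial>\<mu>1)"
      by (subst nn_integral_snd[symmetric]) auto
    also have "\<dots> = (\<integral>\<^sup>+x. indicator S x \<partial>\<mu>1)"
    proof (intro nn_integral_cong)
      fix y
      have "(\<lambda>x. k (x, y)) \<in> borel_measurable \<mu>0" by measurable
      then show "(\<integral>\<^sup>+x. ennreal (k (x, y)) * indicator S y \<partial>\<mu>0) = indicator S y"
        by (subst nn_integral_multc) (auto simp: nn_integral_k_fst)
    qed
    also have "\<dots> = emeasure \<mu>1 S" by simp
    finally show "emeasure (distr opt borel snd) S = emeasure \<mu>1 S" .
  qed simp
qed

sublocale opt: prob_space opt
  by (rule coupling_prob[OF opt_coupling])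

sublocale optinfo: information_space opt "exp 1"
  by standard simp

lemma ac_opt: "absolutely_continuous NN opt"
  unfolding opt_def by (rule absolutely_continuousI_density) measurable

definition dual where "dual = (\<integral>x. \<phi>0 x \<partial>\<mu>0) + (\<integral>y. \<phi>1 y \<partial>\<mu>1)"

lemma KL_opt: "KL opt NN = ereal (\<integral>z. g z \<partial>opt)"
proof -
  have "AE z in NN. ennreal (k z) = RN_deriv NN opt z"
    by (rule P.RN_deriv_unique) (auto simp: opt_def)
  then have ae: "AE z in opt. ennreal (k z) = RN_deriv NN opt z"
    using absolutely_continuous_AE[OF sets_opt ac_opt] by simp
  have eq: "AE z in opt. entropy_density (exp 1) NN opt z = g z"
    using ae
  proof eventually_elim
    case (elim z)
    show ?case by (simp add: entropy_density_def log_def flip: elim)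
  qed
  have m: "entropy_density (exp 1) NN opt \<in> borel_measurable opt" "g \<in> borel_measurable opt"
    by (simp_all add: opt_def)
  have "integrable opt g"
    by (rule coupling_integrable[OF opt_coupling continuous_g])
  then have "integrable opt (entropy_density (exp 1) NN opt)"
    using integrable_cong_AE[OF m eq] by simp
  moreover have "KL_divergence (exp 1) NN opt = (\<integral>z. g z \<partial>opt)"
    unfolding KL_divergence_def by (rule integral_cong_AE[OF m eq])
  ultimately show ?thesis using ac_opt by (simp add: KL_def)
qed

lemma objective_opt: "EOT_objective A \<epsilon> \<mu>0 \<mu>1 opt = ereal dual"
  unfolding EOT_objective_def KL_opt using coupling_integral_g[OF opt_coupling]
  by (simp add: dual_def)

text \<open>For finite entropy the excess over \<open>dual\<close> is \<open>\<epsilon>\<close>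
  times the relative entropy of \<open>\<pi>\<close> with respect to \<open>opt\<close>, which is
  positive unless the two agree. The strict form yields optimality and uniqueness together.\<close>

lemma objective_gt:
  assumes \<pi>: "\<pi> \<in> couplings \<mu>0 \<mu>1" and ne: "\<pi> \<noteq> opt"
  shows "EOT_objective A \<epsilon> \<mu>0 \<mu>1 \<pi> > ereal dual"
proof (cases "absolutely_continuous NN \<pi> \<and> integrable \<pi> (entropy_density (exp 1) NN \<pi>)")
  case False
  then show ?thesis using eps by (auto simp: EOT_objective_def KL_def)
next
  case True
  then have ac: "absolutely_continuous NN \<pi>" and int: "integrable \<pi> (entropy_density (exp 1) NN \<pi>)" by auto
  interpret \<pi>: prob_space \<pi> by (rule coupling_prob[OF \<pi>])
  have sets_\<pi>: "sets \<pi> = sets NN" using coupling_sets[OF \<pi>] sets_pair by simp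
  from P.real_RN_deriv[OF \<pi>.finite_measure_axioms ac sets_\<pi>] obtain D where
    D: "D \<in> borel_measurable NN" "AE x in NN. RN_deriv NN \<pi> x = ennreal (D x)"
      "AE x in \<pi>. 0 < D x" "\<And>x. 0 \<le> D x" by auto
  note [measurable] = D(1)
  \<comment> \<open>The density of \<open>\<pi>\<close> with respect to \<open>opt\<close>, as
    \<open>exp (- g)\<close> is the density of the product measure with respect to
    \<open>opt\<close>.\<close>
  define E where "E z = D z * exp (- g z)" for z
  have E: "E \<in> borel_measurable NN" "\<And>z. E z \<ge> 0"
    unfolding E_def[abs_def] using D(4) by auto
  note [measurable] = E(1)
  have "\<pi> = density NN (RN_deriv NN \<pi>)"
    using P.density_RN_deriv[OF ac sets_\<pi>] by simp
  also have "\<dots> = density NN D"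
    using D by (intro density_cong) auto
  finally have \<pi>D: "\<pi> = density NN D" .
  also have "\<dots> = density opt E"
    unfolding opt_def
    by (subst density_density_eq) (auto simp: E_def D(4) exp_minus simp flip: ennreal_mult intro!: density_cong)
  finally have \<pi>E: "\<pi> = density opt E" .
  \<comment> \<open>True only \<open>\<pi>\<close>-almost everywhere, where \<open>D\<close> is
    positive and the logarithm of the product splits.\<close>
  have lnE: "AE z in \<pi>. ln (E z) = entropy_density (exp 1) NN \<pi> z - g z"
    using D(3) absolutely_continuous_AE[OF sets_\<pi> ac D(2)]
    by eventually_elim (auto simp: E_def ln_mult D(4) entropy_density_def log_def)
  have m: "entropy_density (exp 1) NN \<pi> \<in> borel_measurable \<pi>" "g \<in> borel_measurable \<pi>"
    "(\<lambda>z. ln (E z)) \<in> borel_measurable \<pi>"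
    by (simp_all add: \<pi>D)
  have ig: "integrable \<pi> g" by (rule coupling_integrable[OF \<pi> continuous_g])
  have ilnE: "integrable \<pi> (\<lambda>z. ln (E z))"
    using integrable_cong_AE[OF m(3) _ lnE] int ig m by simp
  have Eopt: "E \<in> borel_measurable opt" by (simp add: opt_def)
  have iE: "integrable opt (\<lambda>z. E z * log (exp 1) (E z))"
    using ilnE unfolding \<pi>E
    by (subst (asm) integrable_real_density) (auto simp: log_def Eopt E(2))
  have pE: "prob_space (density opt E)"
    using \<pi>.prob_space_axioms \<pi>E by simp
  have "0 < KL_divergence (exp 1) opt (density opt E)"
    using ne \<pi>E by (intro optinfo.KL_gt_0[OF pE Eopt _ iE]) (auto simp: E(2))
  also have "\<dots> = (\<integral>z. E z * ln (E z) \<partial>opt)"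
    by (subst opt.KL_density) (auto simp: Eopt E(2) log_def)
  also have "\<dots> = (\<integral>z. ln (E z) \<partial>\<pi>)"
    unfolding \<pi>E by (subst integral_real_density) (auto simp: Eopt E(2))
  also have "\<dots> = (\<integral>z. entropy_density (exp 1) NN \<pi> z - g z \<partial>\<pi>)"
    by (rule integral_cong_AE[OF m(3) _ lnE]) (use m in simp)
  also have "\<dots> = KL_divergence (exp 1) NN \<pi> - (\<integral>z. g z \<partial>\<pi>)"
    using int ig by (simp add: KL_divergence_def)
  finally have "\<epsilon> * (\<integral>z. g z \<partial>\<pi>) < \<epsilon> * KL_divergence (exp 1) NN \<pi>"
    using eps by simp
  then show ?thesis
    using coupling_integral_g[OF \<pi>] True by (simp add: EOT_objective_def KL_def dual_def)
qed

lemma OT_eq: "OT A \<epsilon> \<mu>0 \<mu>1 = ereal dual"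
  unfolding OT_def
proof (rule antisym)
  show "(INF \<pi>\<in>couplings \<mu>0 \<mu>1. EOT_objective A \<epsilon> \<mu>0 \<mu>1 \<pi>) \<le> ereal dual"
    using INF_lower[OF opt_coupling] objective_opt by metis
  show "ereal dual \<le> (INF \<pi>\<in>couplings \<mu>0 \<mu>1. EOT_objective A \<epsilon> \<mu>0 \<mu>1 \<pi>)"
    using objective_gt objective_opt by (intro INF_greatest) (metis order_less_imp_le order_refl)
qed

lemma optimal_coupling_iff: "optimal_coupling A \<epsilon> \<mu>0 \<mu>1 \<pi> \<longleftrightarrow> \<pi> = opt"
  unfolding optimal_coupling_def OT_eq using opt_coupling objective_opt objective_gt by fastforce

end

subsection \<open>Reduction to bounded costs\<close>

lemma (in borel_prob_space) continuous_on_integral_compact: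
  fixes f :: "'a::heine_borel \<times> 'b \<Rightarrow> real"
  assumes f: "continuous_on UNIV f" and C: "AE y in M. y \<in> C" "compact C"
  shows "continuous_on UNIV (\<lambda>x. \<integral>y. f (x, y) \<partial>M)"
  unfolding continuous_on_sequentially
proof safe
  fix u :: "nat \<Rightarrow> 'a" and x assume u: "u \<longlonglongrightarrow> x"
  \<comment> \<open>A convergent sequence together with its limit is compact, so one bound of
    \<open>f\<close> on \<open>S\<close> dominates all terms.\<close>
  define S where "S = insert x (range u) \<times> C"
  have "compact S"
    unfolding S_def using u C by (intro compact_Times compact_sequence_with_limit)
  then obtain B where B: "\<And>z. z \<in> S \<Longrightarrow> \<bar>f z\<bar> \<le> B"
    using continuous_on_compact_abs_bound[OF _ continuous_on_subset[OF f subset_UNIV]] by blast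
  have meas: "(\<lambda>y. f (x, y)) \<in> borel_measurable M" for x
  proof -
    have "(\<lambda>y. f (x, y)) \<in> borel_measurable borel"
      by (intro borel_measurable_continuous_onI continuous_on_compose2[OF f] continuous_intros) auto
    then show ?thesis by simp
  qed
  show "((\<lambda>x. \<integral>y. f (x, y) \<partial>M) \<circ> u) \<longlonglongrightarrow> (\<integral>y. f (x, y) \<partial>M)"
    unfolding comp_def
  proof (rule integral_dominated_convergence[where w = "\<lambda>_. B"])
    show "AE y in M. (\<lambda>i. f (u i, y)) \<longlonglongrightarrow> f (x, y)"
    proof (intro AE_I2)
      fix y :: 'b
      have "(\<lambda>i. (u i, y)) \<longlonglongrightarrow> (x, y)" by (intro tendsto_intros u)
      then show "(\<lambda>i. f (u i, y)) \<longlonglongrightarrow> f (x, y)"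
        by (rule continuous_on_tendsto_compose[OF f]) auto
    qed
    show "AE y in M. norm (f (u i, y)) \<le> B" for i
      using C(1) by eventually_elim (use B in \<open>auto simp: S_def\<close>)
  qed (simp_all add: meas)
qed

lemma (in borel_prob_space) integral_exp_pos:
  fixes f :: "'b \<Rightarrow> real"
  assumes "integrable M (\<lambda>y. exp (f y))"
  shows "(\<integral>y. exp (f y) \<partial>M) > 0"
proof (rule ccontr)
  assume "\<not> ?thesis"
  moreover have "(\<integral>y. exp (f y) \<partial>M) \<ge> 0" by (rule integral_nonneg_AE) simp
  ultimately have "(\<integral>y. exp (f y) \<partial>M) = 0" by simp
  then have "AE y in M. exp (f y) = 0"
    using integral_nonneg_eq_0_iff_AE[OF assms] by simp
  then show False by simp
qed

text \<open>The retractions \<open>p\<close> and \<open>q\<close> make the cost bounded without changing it on the supports.\<close>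

locale clamped_eot =
  fixes \<mu>0 :: "(real ^ 'm) measure" and \<mu>1 :: "(real ^ 'n) measure" and \<epsilon> :: real
    and p :: "real ^ 'm \<Rightarrow> real ^ 'm" and q :: "real ^ 'n \<Rightarrow> real ^ 'n" and r :: real
  assumes supp0: "compactly_supported_prob \<mu>0" and supp1: "compactly_supported_prob \<mu>1"
    and eps: "\<epsilon> > 0"
    and p: "continuous_on UNIV p" "\<And>x. norm (p x) \<le> r" "\<And>x. x \<in> spt \<mu>0 \<Longrightarrow> p x = x"
    and q: "continuous_on UNIV q" "\<And>y. norm (q y) \<le> r" "\<And>y. y \<in> spt \<mu>1 \<Longrightarrow> q y = y"
begin

sublocale m0: borel_prob_space \<mu>0
  using supp0 by (auto simp: compactly_supported_prob_def borel_prob_space_def borel_prob_space_axioms_def)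
sublocale m1: borel_prob_space \<mu>1
  using supp1 by (auto simp: compactly_supported_prob_def borel_prob_space_def borel_prob_space_axioms_def)
sublocale schroedinger \<mu>0 \<mu>1 ..

lemma compact_spt: "compact (spt \<mu>0)" "compact (spt \<mu>1)"
  using supp0 supp1 by (auto simp: compactly_supported_prob_def)

lemma AE_p: "AE x in \<mu>0. p x = x"
  using AE_spt[OF m0.sets_eq] by eventually_elim (rule p)

lemma AE_q: "AE y in \<mu>1. q y = y"
  using AE_spt[OF m1.sets_eq] by eventually_elim (rule q)

lemma integral_clamp_fst:
  fixes f :: "_ \<Rightarrow> real"
  assumes "continuous_on UNIV f"
  shows "(\<integral>x. f (p x) \<partial>\<mu>0) = (\<integral>x. f x \<partial>\<mu>0)"
proof (rule integral_cong_AE)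
  show "AE x in \<mu>0. f (p x) = f x" using AE_p by eventually_elim simp
  have "f \<in> borel_measurable borel" "(\<lambda>x. f (p x)) \<in> borel_measurable borel"
    by (intro borel_measurable_continuous_onI assms continuous_on_compose2[OF assms p(1)]; simp)+
  then show "f \<in> borel_measurable \<mu>0" "(\<lambda>x. f (p x)) \<in> borel_measurable \<mu>0" by simp_all
qed

lemma integral_clamp_snd:
  fixes f :: "_ \<Rightarrow> real"
  assumes "continuous_on UNIV f"
  shows "(\<integral>y. f (q y) \<partial>\<mu>1) = (\<integral>y. f y \<partial>\<mu>1)"
proof (rule integral_cong_AE)
  show "AE x in \<mu>1. f (q x) = f x" using AE_q by eventually_elim simp
  have "f \<in> borel_measurable borel" "(\<lambda>x. f (q x)) \<in> borel_measurable borel"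
    by (intro borel_measurable_continuous_onI assms continuous_on_compose2[OF assms q(1)]; simp)+
  then show "f \<in> borel_measurable \<mu>1" "(\<lambda>x. f (q x)) \<in> borel_measurable \<mu>1" by simp_all
qed

lemma continuous_cost: "continuous_on UNIV (\<lambda>z. cost A (fst z) (snd z))"
  unfolding cost_def
  by (intro continuous_intros bounded_linear.continuous_on[OF matrix_vector_mul_bounded_linear])

lemma r_nonneg: "r \<ge> 0"
  using p(2)[of 0] norm_ge_zero[of "p 0"] by linarith

section \<open>The clamped and rescaled cost as an affine function of the matrix\<close>

definition lin :: "real ^ 'n ^ 'm \<Rightarrow> ((real ^ 'm) \<times> (real ^ 'n)) \<Rightarrow>\<^sub>C real" where
  "lin B = Bcontfun (\<lambda>z. - (32 / \<epsilon>) * (p (fst z) \<bullet> (B *v q (snd z))))"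

definition cst :: "real ^ 'n ^ 'm \<Rightarrow> ((real ^ 'm) \<times> (real ^ 'n)) \<Rightarrow>\<^sub>C real" where
  "cst A = Bcontfun (\<lambda>z. cost A (p (fst z)) (q (snd z)) / \<epsilon>)"

lemma continuous_clamp:
  "continuous_on S (\<lambda>z. p (fst z))" "continuous_on S (\<lambda>z. q (snd z))"
  by (intro continuous_on_compose2[OF p(1)] continuous_on_compose2[OF q(1)] continuous_intros; simp)+

lemma matrix_vector_bound: "\<exists>K\<ge>0. \<forall>(B :: real ^ 'n ^ 'm) y. norm (B *v y) \<le> norm B * norm y * K"
proof -
  have "bounded_bilinear (\<lambda>(B :: real ^ 'n ^ 'm) y. B *v y)"
  proof (rule bilinear_conv_bounded_bilinear[THEN iffD1])
    show "bilinear (\<lambda>(B :: real ^ 'n ^ 'm) y. B *v y)"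
      unfolding bilinear_def
      by (auto intro!: linearI simp: matrix_vector_right_distrib matrix_vector_mult_add_rdistrib
        matrix_vector_mult_scaleR scaleR_matrix_vector_assoc)
  qed
  from bounded_bilinear.nonneg_bounded[OF this] show ?thesis by simp
qed

lemma lin_bound: "\<exists>K\<ge>0. \<forall>B z. \<bar>- (32 / \<epsilon>) * (p (fst z) \<bullet> (B *v q (snd z)))\<bar> \<le> norm B * K"
proof -
  obtain K where K0: "K \<ge> 0" and "\<forall>(B :: real ^ 'n ^ 'm) y. norm (B *v y) \<le> norm B * norm y * K"
    using matrix_vector_bound by blast
  note K = K0 this(2)[rule_format]
  show ?thesis
  proof (intro exI[of _ "32 / \<epsilon> * (r * (r * K))"] conjI allI)
    fix B :: "real ^ 'n ^ 'm" and z :: "(real ^ 'm) \<times> (real ^ 'n)"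
    have "\<bar>p (fst z) \<bullet> (B *v q (snd z))\<bar> \<le> norm (p (fst z)) * norm (B *v q (snd z))"
      by (rule Cauchy_Schwarz_ineq2)
    also have "\<dots> \<le> r * (norm B * r * K)"
    proof (rule mult_mono[OF p(2) _ r_nonneg norm_ge_zero])
      have "norm B * norm (q (snd z)) * K \<le> norm B * r * K"
        by (intro mult_right_mono mult_left_mono q K0 norm_ge_zero)
      then show "norm (B *v q (snd z)) \<le> norm B * r * K"
        by (rule order_trans[OF K(2)])
    qed
    finally have "32 / \<epsilon> * \<bar>p (fst z) \<bullet> (B *v q (snd z))\<bar> \<le> 32 / \<epsilon> * (r * (norm B * r * K))"
      using eps by (intro mult_left_mono) auto
    then show "\<bar>- (32 / \<epsilon>) * (p (fst z) \<bullet> (B *v q (snd z)))\<bar> \<le> norm B * (32 / \<epsilon> * (r * (r * K)))"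
      using eps by (simp add: abs_mult algebra_simps)
  qed (use K0 eps r_nonneg in simp)
qed

lemma apply_lin [simp]: "lin B z = - (32 / \<epsilon>) * (p (fst z) \<bullet> (B *v q (snd z)))"
proof -
  obtain K where "\<forall>B z. \<bar>- (32 / \<epsilon>) * (p (fst z) \<bullet> (B *v q (snd z)))\<bar> \<le> norm B * K"
    using lin_bound by blast
  note K = this[rule_format]
  show ?thesis
    unfolding lin_def
    by (subst apply_Bcontfun[OF _ K])
      (intro continuous_intros continuous_clamp bounded_linear.continuous_on[OF matrix_vector_mul_bounded_linear], simp)
qed

lemma bounded_linear_lin: "bounded_linear lin"
proof -
  obtain K where "\<forall>B z. \<bar>- (32 / \<epsilon>) * (p (fst z) \<bullet> (B *v q (snd z)))\<bar> \<le> norm B * K"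
    using lin_bound by blast
  note K = this[rule_format]
  show ?thesis
  proof (rule bounded_linear_intro[where K = K])
    show "norm (lin B) \<le> norm B * K" for B
      using K by (intro bcontfun_norm_le) (simp only: apply_lin)
    show "lin (A + B) = lin A + lin B" for A B
      by (rule bcontfun_eqI) (simp add: matrix_vector_mult_add_rdistrib inner_add_right distrib_left)
    show "lin (a *\<^sub>R B) = a *\<^sub>R lin B" for a B
      by (rule bcontfun_eqI) (simp flip: scaleR_matrix_vector_assoc)
  qed
qed

lemma apply_cst [simp]: "cst A z = cost A (p (fst z)) (q (snd z)) / \<epsilon>"
proof -
  have c: "continuous_on UNIV (\<lambda>z. cost A (p (fst z)) (q (snd z)) / \<epsilon>)"
    unfolding cost_def
    by (intro continuous_intros continuous_clamp bounded_linear.continuous_on[OF matrix_vector_mul_bounded_linear])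
      (use eps in auto)
  have "\<exists>B. \<forall>z \<in> cball 0 r \<times> cball 0 r. \<bar>cost A (fst z) (snd z) / \<epsilon>\<bar> \<le> B"
    by (intro continuous_on_compact_abs_bound compact_Times compact_cball continuous_intros
        continuous_on_subset[OF continuous_cost]) (use eps in auto)
  then obtain B where B: "\<And>z. z \<in> cball 0 r \<times> cball 0 r \<Longrightarrow> \<bar>cost A (fst z) (snd z) / \<epsilon>\<bar> \<le> B"
    by blast
  show ?thesis
    unfolding cst_def
  proof (subst apply_Bcontfun[OF c, where b = B])
    show "\<bar>cost A (p (fst z)) (q (snd z)) / \<epsilon>\<bar> \<le> B" for z
      using B[of "(p (fst z), q (snd z))"] p(2) q(2) by simp
  qed simp
qed

lemma cst_eq: "cst A = cst 0 + lin A"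
  by (rule bcontfun_eqI) (simp add: cost_def diff_divide_distrib)

lemma cst_has_derivative: "(cst has_derivative lin) (at A)"
proof -
  have "((\<lambda>A. cst 0 + lin A) has_derivative (\<lambda>B. 0 + lin B)) (at A)"
    by (intro has_derivative_add has_derivative_const bounded_linear_imp_has_derivative bounded_linear_lin)
  then show ?thesis unfolding cst_eq[symmetric] by simp
qed

text \<open>Composed with the retractions and divided by \<open>\<epsilon>\<close>, any potentials
  solve the bounded system everywhere: at \<open>x\<close> the original equation is used at
  \<open>p x\<close>, and inside the integral \<open>q\<close> is the identity almost everywhere.
  Uniqueness of the normalized potential then identifies them up to a constant, which cancels in the
  kernel and in the dual value.\<close>

lemma potentials_clamped:
  assumes pot: "EOT_potentials A \<epsilon> \<mu>0 \<mu>1 \<phi>0 \<phi>1"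
  shows "x \<in> spt \<mu>0 \<Longrightarrow> y \<in> spt \<mu>1 \<Longrightarrow> EOT_kernel A \<epsilon> \<phi>0 \<phi>1 x y = dens (cst A) (x, y)"
    and "(\<integral>x. \<phi>0 x \<partial>\<mu>0) + (\<integral>y. \<phi>1 y \<partial>\<mu>1) = \<epsilon> * dual_value (cst A)"
proof -
  have c0: "continuous_on UNIV \<phi>0" and c1: "continuous_on UNIV \<phi>1"
    and e0: "\<And>x. (\<integral>y. EOT_kernel A \<epsilon> \<phi>0 \<phi>1 x y \<partial>\<mu>1) = 1" and e1: "\<And>y. (\<integral>x. EOT_kernel A \<epsilon> \<phi>0 \<phi>1 x y \<partial>\<mu>0) = 1"
    using pot by (auto simp: EOT_potentials_def)
  have bnd: "\<exists>b. \<forall>x. \<bar>f (s x) / \<epsilon>\<bar> \<le> b" if "continuous_on UNIV f" "\<And>x. norm (s x) \<le> r"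
    for f :: "'x::euclidean_space \<Rightarrow> real" and s :: "'x \<Rightarrow> 'x"
  proof -
    have "\<exists>B. \<forall>x \<in> cball 0 r. \<bar>f x / \<epsilon>\<bar> \<le> B"
      by (intro continuous_on_compact_abs_bound compact_cball continuous_intros continuous_on_subset[OF that(1)])
        (use eps in auto)
    then obtain B where "\<And>x. x \<in> cball 0 r \<Longrightarrow> \<bar>f x / \<epsilon>\<bar> \<le> B" by blast
    then show ?thesis using that(2) by (intro exI[of _ B]) simp
  qed
  obtain b0 b1 where b: "\<And>x. \<bar>\<phi>0 (p x) / \<epsilon>\<bar> \<le> b0" "\<And>y. \<bar>\<phi>1 (q y) / \<epsilon>\<bar> \<le> b1"
    using bnd[of \<phi>0 p, OF c0 p(2)] bnd[of \<phi>1 q, OF c1 q(2)] by blast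
  define a0 where "a0 = Bcontfun (\<lambda>x. \<phi>0 (p x) / \<epsilon>)"
  define a1 where "a1 = Bcontfun (\<lambda>y. \<phi>1 (q y) / \<epsilon>)"
  have a0: "a0 x = \<phi>0 (p x) / \<epsilon>" for x
    unfolding a0_def
    by (subst apply_Bcontfun[OF _ b(1)])
      (intro continuous_intros continuous_on_compose2[OF c0 p(1)], use eps in auto)
  have a1: "a1 y = \<phi>1 (q y) / \<epsilon>" for y
    unfolding a1_def
    by (subst apply_Bcontfun[OF _ b(2)])
      (intro continuous_intros continuous_on_compose2[OF c1 q(1)], use eps in auto)
  have ker: "exp (a0 x + a1 y - cst A (x, y)) = EOT_kernel A \<epsilon> \<phi>0 \<phi>1 (p x) (q y)" for x y
    by (simp add: a0 a1 EOT_kernel_def add_divide_distrib diff_divide_distrib)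
  have ck: "continuous_on UNIV (\<lambda>z. EOT_kernel A \<epsilon> \<phi>0 \<phi>1 (fst z) (snd z))"
    unfolding EOT_kernel_def
    by (intro continuous_intros continuous_cost continuous_on_compose2[OF c0] continuous_on_compose2[OF c1])
      (use eps in auto)
  \<comment> \<open>Shifting the pair by this mean gives the representative selected by
    \<open>normalized_potential\<close>.\<close>
  define m where "m = (\<integral>y. a1 y \<partial>\<mu>1)"
  have i0: "(\<integral>y. exp (a0 x + a1 y - cst A (x, y)) \<partial>\<mu>1) = 1" for x
  proof -
    have "continuous_on UNIV (\<lambda>y. EOT_kernel A \<epsilon> \<phi>0 \<phi>1 (p x) y)"
      by (rule continuous_on_compose2[OF ck, where f = "\<lambda>y. (p x, y)", simplified]) (intro continuous_intros)
    then show ?thesis unfolding ker using integral_clamp_snd[of "\<lambda>y. EOT_kernel A \<epsilon> \<phi>0 \<phi>1 (p x) y"] e0[of "p x"] by simp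
  qed
  have i1: "(\<integral>x. exp (a0 x + a1 y - cst A (x, y)) \<partial>\<mu>0) = 1" for y
  proof -
    have "continuous_on UNIV (\<lambda>x. EOT_kernel A \<epsilon> \<phi>0 \<phi>1 x (q y))"
      by (rule continuous_on_compose2[OF ck, where f = "\<lambda>x. (x, q y)", simplified]) (intro continuous_intros)
    then show ?thesis unfolding ker using integral_clamp_fst[of "\<lambda>x. EOT_kernel A \<epsilon> \<phi>0 \<phi>1 x (q y)"] e1[of "q y"] by simp
  qed
  have sum: "(a0 + const_bcontfun m) x + (a1 - const_bcontfun m) y = a0 x + a1 y" for x y by simp
  have f: "a0 + const_bcontfun m = fwd (cst A) (a1 - const_bcontfun m)"
    by (rule fwd_unique) (simp only: sum i0)
  have g: "a1 - const_bcontfun m = bwd (cst A) (a0 + const_bcontfun m)"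
    by (rule bwd_unique) (simp only: sum i1)
  have "normalized_potential (cst A) (a1 - const_bcontfun m)"
    using f g m1.integrable_bcontfun[of a1] by (simp add: normalized_potential_def m_def)
  then have a1_pot: "a1 - const_bcontfun m = pot (cst A)" by (rule pot_unique)
  then have a0_fwd: "a0 + const_bcontfun m = fwd (cst A) (pot (cst A))" using f by simp
  have pv: "pot (cst A) y = a1 y - m" for y
    by (simp only: a1_pot[symmetric]) simp
  have fv: "fwd (cst A) (pot (cst A)) x = a0 x + m" for x
    by (simp only: a0_fwd[symmetric]) simp
  show "EOT_kernel A \<epsilon> \<phi>0 \<phi>1 x y = dens (cst A) (x, y)" if "x \<in> spt \<mu>0" "y \<in> spt \<mu>1"
  proof -
    have "dens (cst A) (x, y) = exp (a0 x + a1 y - cst A (x, y))"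
      by (simp add: dens_def pv fv)
    also have "\<dots> = EOT_kernel A \<epsilon> \<phi>0 \<phi>1 x y" by (simp only: ker p(3)[OF that(1)] q(3)[OF that(2)])
    finally show ?thesis by simp
  qed
  have "dual_value (cst A) = (\<integral>x. a0 x \<partial>\<mu>0) + (\<integral>y. a1 y \<partial>\<mu>1)"
    using m0.integrable_bcontfun[of a0] m1.integrable_bcontfun[of a1]
    by (simp add: dual_value_def pv fv del: integral_pot)
  also have "\<dots> = (\<integral>x. \<phi>0 x \<partial>\<mu>0) / \<epsilon> + (\<integral>y. \<phi>1 y \<partial>\<mu>1) / \<epsilon>"
    unfolding a0 a1 by (simp add: integral_clamp_fst[OF c0] integral_clamp_snd[OF c1])
  finally show "(\<integral>x. \<phi>0 x \<partial>\<mu>0) + (\<integral>y. \<phi>1 y \<partial>\<mu>1) = \<epsilon> * dual_value (cst A)"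
    using eps by (simp add: field_simps)
qed

text \<open>The bounded potentials are tied to the original cost only on the supports. One further
  soft transform with that cost, applied to each separately, gives continuous functions on the whole
  space. They agree with the bounded ones, times \<open>\<epsilon>\<close>, on the supports, which
  is where the integrals see them, so both equations hold at every point.\<close>

lemma ex_potentials: "\<exists>\<phi>0 \<phi>1. EOT_potentials A \<epsilon> \<mu>0 \<mu>1 \<phi>0 \<phi>1"
proof -
  define \<psi>1 where "\<psi>1 = pot (cst A)"
  define \<psi>0 where "\<psi>0 = fwd (cst A) \<psi>1"
  define F where "F z = exp (\<psi>1 (snd z) - cost A (fst z) (snd z) / \<epsilon>)" for z
  define G where "G z = exp (\<psi>0 (fst z) - cost A (fst z) (snd z) / \<epsilon>)" for z
  have cF: "continuous_on UNIV F" and cG: "continuous_on UNIV G"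
    unfolding F_def G_def by (intro continuous_intros continuous_cost; use eps in simp)+
  have cF': "continuous_on UNIV (\<lambda>y. F (x, y))" and cG': "continuous_on UNIV (\<lambda>x. G (x, y))" for x y
    using continuous_on_compose2[OF cF, of UNIV "\<lambda>y. (x, y)"] continuous_on_compose2[OF cG, of UNIV "\<lambda>x. (x, y)"]
    by (simp_all add: continuous_on_Pair continuous_on_const)
  have iF: "integrable \<mu>1 (\<lambda>y. F (x, y))" for x
    by (rule integrable_continuous_AE_compact[OF m1.finite_measure_axioms m1.sets_eq AE_spt[OF m1.sets_eq] compact_spt(2) cF'])
  have iG: "integrable \<mu>0 (\<lambda>x. G (x, y))" for y
    by (rule integrable_continuous_AE_compact[OF m0.finite_measure_axioms m0.sets_eq AE_spt[OF m0.sets_eq] compact_spt(1) cG'])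
  have posF: "(\<integral>y. F (x, y) \<partial>\<mu>1) > 0" for x
    using iF unfolding F_def by (rule m1.integral_exp_pos)
  have posG: "(\<integral>x. G (x, y) \<partial>\<mu>0) > 0" for y
    using iG unfolding G_def by (rule m0.integral_exp_pos)
  define \<phi>0 where "\<phi>0 x = - \<epsilon> * ln (\<integral>y. F (x, y) \<partial>\<mu>1)" for x
  define \<phi>1 where "\<phi>1 y = - \<epsilon> * ln (\<integral>x. G (x, y) \<partial>\<mu>0)" for y
  have c0: "continuous_on UNIV \<phi>0"
    unfolding \<phi>0_def
    by (intro continuous_intros m1.continuous_on_integral_compact[OF cF AE_spt[OF m1.sets_eq] compact_spt(2)])
      (use posF in \<open>auto simp: less_imp_neq[THEN not_sym]\<close>)
  have cGs: "continuous_on UNIV (\<lambda>z. G (snd z, fst z))"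
    by (rule continuous_on_compose2[OF cG]) (intro continuous_intros, simp)
  have c1: "continuous_on UNIV \<phi>1"
    unfolding \<phi>1_def
    using m0.continuous_on_integral_compact[OF cGs AE_spt[OF m0.sets_eq] compact_spt(1)] posG
    by (intro continuous_intros) (auto simp: less_imp_neq[THEN not_sym])
  have "(\<integral>y. exp (\<psi>1 y - cst A (x, y)) \<partial>\<mu>1) = (\<integral>y. F (p x, y) \<partial>\<mu>1)" for x
  proof (rule integral_cong_AE)
    show "AE y in \<mu>1. exp (\<psi>1 y - cst A (x, y)) = F (p x, y)"
      using AE_q by eventually_elim (simp add: F_def)
    show "(\<lambda>y. exp (\<psi>1 y - cst A (x, y))) \<in> borel_measurable \<mu>1"
      using m1.integrable_exp_slice[of "bsnd \<psi>1 - cst A" x] by (auto dest: borel_measurable_integrable)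
    show "(\<lambda>y. F (p x, y)) \<in> borel_measurable \<mu>1"
      using iF by (rule borel_measurable_integrable)
  qed
  then have \<phi>0: "\<phi>0 x = \<epsilon> * \<psi>0 x" if "x \<in> spt \<mu>0" for x
    using p(3)[OF that] by (simp add: \<phi>0_def \<psi>0_def fwd_def)
  have "(\<integral>x. exp (\<psi>0 x - cst A (x, y)) \<partial>\<mu>0) = (\<integral>x. G (x, q y) \<partial>\<mu>0)" for y
  proof (rule integral_cong_AE)
    show "AE x in \<mu>0. exp (\<psi>0 x - cst A (x, y)) = G (x, q y)"
      using AE_p by eventually_elim (simp add: G_def)
    show "(\<lambda>x. exp (\<psi>0 x - cst A (x, y))) \<in> borel_measurable \<mu>0"
      using m0.integrable_exp_slice[of "bsnd \<psi>0 - bswap (cst A)" y] by (auto dest: borel_measurable_integrable)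
    show "(\<lambda>x. G (x, q y)) \<in> borel_measurable \<mu>0"
      using iG by (rule borel_measurable_integrable)
  qed
  moreover have "\<psi>1 = bwd (cst A) \<psi>0" by (simp add: \<psi>0_def \<psi>1_def)
  then have "\<psi>1 y = - ln (\<integral>x. exp (\<psi>0 x - cst A (x, y)) \<partial>\<mu>0)" for y
    by (simp add: bwd_def)
  ultimately have \<phi>1: "\<phi>1 y = \<epsilon> * \<psi>1 y" if "y \<in> spt \<mu>1" for y
    using q(3)[OF that] by (simp add: \<phi>1_def)
  have ck: "continuous_on UNIV (\<lambda>z. EOT_kernel A \<epsilon> \<phi>0 \<phi>1 (fst z) (snd z))"
    unfolding EOT_kernel_def
    by (intro continuous_intros continuous_cost continuous_on_compose2[OF c0] continuous_on_compose2[OF c1])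
      (use eps in auto)
  have "(\<integral>y. EOT_kernel A \<epsilon> \<phi>0 \<phi>1 x y \<partial>\<mu>1) = 1" for x
  proof -
    have "(\<integral>y. EOT_kernel A \<epsilon> \<phi>0 \<phi>1 x y \<partial>\<mu>1) = (\<integral>y. exp (\<phi>0 x / \<epsilon>) * F (x, y) \<partial>\<mu>1)"
    proof (rule integral_cong_AE)
      show "AE y in \<mu>1. EOT_kernel A \<epsilon> \<phi>0 \<phi>1 x y = exp (\<phi>0 x / \<epsilon>) * F (x, y)"
        using AE_spt[OF m1.sets_eq]
        by eventually_elim (use eps in \<open>simp add: EOT_kernel_def F_def \<phi>1 add_divide_distrib diff_divide_distrib flip: exp_add\<close>)
      have "continuous_on UNIV (\<lambda>y. EOT_kernel A \<epsilon> \<phi>0 \<phi>1 x y)"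
        by (rule continuous_on_compose2[OF ck, where f = "\<lambda>y. (x, y)", simplified]) (intro continuous_intros)
      then show "(\<lambda>y. EOT_kernel A \<epsilon> \<phi>0 \<phi>1 x y) \<in> borel_measurable \<mu>1"
        unfolding measurable_cong_sets[OF m1.sets_eq refl] by (rule borel_measurable_continuous_onI)
      show "(\<lambda>y. exp (\<phi>0 x / \<epsilon>) * F (x, y)) \<in> borel_measurable \<mu>1"
        using iF[of x] by (intro borel_measurable_times borel_measurable_const borel_measurable_integrable)
    qed
    also have "\<dots> = exp (\<phi>0 x / \<epsilon>) * (\<integral>y. F (x, y) \<partial>\<mu>1)" by simp
    also have "\<dots> = 1" using posF[of x] eps by (simp add: \<phi>0_def exp_minus)
    finally show ?thesis .
  qed
  moreover have "(\<integral>x. EOT_kernel A \<epsilon> \<phi>0 \<phi>1 x y \<partial>\<mu>0) = 1" for y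
  proof -
    have "(\<integral>x. EOT_kernel A \<epsilon> \<phi>0 \<phi>1 x y \<partial>\<mu>0) = (\<integral>x. exp (\<phi>1 y / \<epsilon>) * G (x, y) \<partial>\<mu>0)"
    proof (rule integral_cong_AE)
      show "AE x in \<mu>0. EOT_kernel A \<epsilon> \<phi>0 \<phi>1 x y = exp (\<phi>1 y / \<epsilon>) * G (x, y)"
        using AE_spt[OF m0.sets_eq]
        by eventually_elim (use eps in \<open>simp add: EOT_kernel_def G_def \<phi>0 add_divide_distrib diff_divide_distrib flip: exp_add\<close>)
      have "continuous_on UNIV (\<lambda>x. EOT_kernel A \<epsilon> \<phi>0 \<phi>1 x y)"
        by (rule continuous_on_compose2[OF ck, where f = "\<lambda>x. (x, y)", simplified]) (intro continuous_intros)
      then show "(\<lambda>x. EOT_kernel A \<epsilon> \<phi>0 \<phi>1 x y) \<in> borel_measurable \<mu>0"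
        unfolding measurable_cong_sets[OF m0.sets_eq refl] by (rule borel_measurable_continuous_onI)
      show "(\<lambda>x. exp (\<phi>1 y / \<epsilon>) * G (x, y)) \<in> borel_measurable \<mu>0"
        using iG[of y] by (intro borel_measurable_times borel_measurable_const borel_measurable_integrable)
    qed
    also have "\<dots> = exp (\<phi>1 y / \<epsilon>) * (\<integral>x. G (x, y) \<partial>\<mu>0)" by simp
    also have "\<dots> = 1" using posG[of y] eps by (simp add: \<phi>1_def exp_minus)
    finally show ?thesis .
  qed
  ultimately show ?thesis using c0 c1 unfolding EOT_potentials_def by blast
qed

lemma OT_dual: "OT A \<epsilon> \<mu>0 \<mu>1 = ereal (\<epsilon> * dual_value (cst A))"
proof -
  obtain \<phi>0 \<phi>1 where pot: "EOT_potentials A \<epsilon> \<mu>0 \<mu>1 \<phi>0 \<phi>1" using ex_potentials by blast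
  interpret E: eot \<mu>0 \<mu>1 \<epsilon> A \<phi>0 \<phi>1 by standard (fact supp0 supp1 eps pot)+
  show ?thesis using E.OT_eq potentials_clamped(2)[OF pot] by (simp add: E.dual_def)
qed

lemma Phi_eq: "Phi \<epsilon> \<mu>0 \<mu>1 A = 32 * (A \<bullet> A) + \<epsilon> * dual_value (cst A)"
  by (simp add: Phi_def OT_dual dot_square_norm)

lemma ex1_optimal_coupling: "\<exists>!\<pi>. optimal_coupling A \<epsilon> \<mu>0 \<mu>1 \<pi>"
proof -
  obtain \<phi>0 \<phi>1 where pot: "EOT_potentials A \<epsilon> \<mu>0 \<mu>1 \<phi>0 \<phi>1" using ex_potentials by blast
  interpret E: eot \<mu>0 \<mu>1 \<epsilon> A \<phi>0 \<phi>1 by standard (fact supp0 supp1 eps pot)+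
  show ?thesis by (rule ex1I[of _ E.opt]) (simp_all add: E.optimal_coupling_iff)
qed

text \<open>The density built from the given potentials and \<open>dens (cst A)\<close> agree on the
  product of the supports, which carries the product measure.\<close>

lemma optimal_coupling_integral:
  fixes f :: "((real ^ 'm) \<times> (real ^ 'n)) \<Rightarrow>\<^sub>C real"
  assumes "optimal_coupling A \<epsilon> \<mu>0 \<mu>1 \<pi>"
  shows "AE z in \<pi>. z \<in> spt \<mu>0 \<times> spt \<mu>1" "sets \<pi> = sets borel" "(\<integral>z. f z \<partial>\<pi>) = pairing (dens (cst A)) f"
proof -
  obtain \<phi>0 \<phi>1 where pot: "EOT_potentials A \<epsilon> \<mu>0 \<mu>1 \<phi>0 \<phi>1" using ex_potentials by blast
  interpret E: eot \<mu>0 \<mu>1 \<epsilon> A \<phi>0 \<phi>1 by standard (fact supp0 supp1 eps pot)+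
  have \<pi>: "\<pi> = E.opt" "\<pi> \<in> couplings \<mu>0 \<mu>1"
    using assms E.optimal_coupling_iff E.opt_coupling by auto
  show "AE z in \<pi>. z \<in> spt \<mu>0 \<times> spt \<mu>1" "sets \<pi> = sets borel"
    using E.coupling_AE[OF \<pi>(2)] E.coupling_sets[OF \<pi>(2)] by auto
  have m: "apply_bcontfun h \<in> borel_measurable (\<mu>0 \<Otimes>\<^sub>M \<mu>1)" for h :: "((real ^ 'm) \<times> (real ^ 'n)) \<Rightarrow>\<^sub>C real"
    using integrable_pair by (rule borel_measurable_integrable)
  have "(\<integral>z. f z \<partial>\<pi>) = (\<integral>z. exp (E.g z) * f z \<partial>(\<mu>0 \<Otimes>\<^sub>M \<mu>1))"
    unfolding \<pi>(1) E.opt_def using m by (subst integral_real_density) auto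
  also have "\<dots> = (\<integral>z. dens (cst A) z * f z \<partial>(\<mu>0 \<Otimes>\<^sub>M \<mu>1))"
  proof (rule integral_cong_AE)
    have "AE z in \<mu>0 \<Otimes>\<^sub>M \<mu>1. fst z \<in> spt \<mu>0 \<and> snd z \<in> spt \<mu>1"
    proof (rule AE_pair_measure)
      have "closed (spt \<mu>0 \<times> spt \<mu>1)" by (intro closed_Times closed_spt)
      then show "{z \<in> space (\<mu>0 \<Otimes>\<^sub>M \<mu>1). fst z \<in> spt \<mu>0 \<and> snd z \<in> spt \<mu>1} \<in> sets (\<mu>0 \<Otimes>\<^sub>M \<mu>1)"
        unfolding sets_pair
        by (simp add: space_pair_measure mem_Times_iff[symmetric] borel_closed)
      show "AE x in \<mu>0. AE y in \<mu>1. fst (x, y) \<in> spt \<mu>0 \<and> snd (x, y) \<in> spt \<mu>1"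
        using AE_spt[OF m0.sets_eq] by eventually_elim (use AE_spt[OF m1.sets_eq] in simp)
    qed
    then show "AE z in \<mu>0 \<Otimes>\<^sub>M \<mu>1. exp (E.g z) * f z = dens (cst A) z * f z"
    proof eventually_elim
      case (elim z)
      then show ?case using potentials_clamped(1)[OF pot, of "fst z" "snd z"] by (simp add: E.kernel_eq)
    qed
  qed (use m in simp_all)
  finally show "(\<integral>z. f z \<partial>\<pi>) = pairing (dens (cst A)) f" by (simp add: pairing_def)
qed

end

lemma trace_transpose_mult: "trace (transpose A ** B) = A \<bullet> B" for A B :: "real ^ 'n ^ 'm"
proof -
  have "trace (transpose A ** B) = (\<Sum>i\<in>UNIV. \<Sum>k\<in>UNIV. A $ k $ i * B $ k $ i)"
    by (simp add: trace_def matrix_matrix_mult_def transpose_def)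
  also have "\<dots> = (\<Sum>k\<in>UNIV. \<Sum>i\<in>UNIV. A $ k $ i * B $ k $ i)"
    by (rule sum.swap)
  finally show ?thesis by (simp add: inner_vec_def)
qed

text \<open>Tietze extension with preservation of the bound; through it elements of
  \<open>C(spt \<mu>1)\<close> enter the Banach space.\<close>

lemma compact_continuous_extension_bcontfun:
  fixes f :: "'a::{metric_space, second_countable_topology} \<Rightarrow> real"
  assumes "compact C" "continuous_on C f"
  shows "\<exists>v :: 'a \<Rightarrow>\<^sub>C real. \<forall>x\<in>C. v x = f x"
proof -
  obtain B where B: "\<And>x. x \<in> C \<Longrightarrow> \<bar>f x\<bar> \<le> B"
    using continuous_on_compact_abs_bound[OF assms] by blast
  have "closedin (top_of_set UNIV) C" using assms by (simp add: compact_imp_closed)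
  \<comment> \<open>If \<open>C\<close> is empty, \<open>B\<close> may be negative, whereas the
    extension theorem wants a nonnegative bound.\<close>
  moreover have "norm (f x) \<le> \<bar>B\<bar>" if "x \<in> C" for x using B[OF that] by simp
  ultimately obtain g where g: "continuous_on UNIV g" "\<And>x. x \<in> C \<Longrightarrow> g x = f x" "\<And>x. norm (g x) \<le> \<bar>B\<bar>"
    using Tietze[OF assms(2), of UNIV "\<bar>B\<bar>"] by (metis abs_ge_zero UNIV_I)
  have "apply_bcontfun (Bcontfun g) = g"
    using g(1,3) by (intro apply_Bcontfun[where b = "\<bar>B\<bar>"]) auto
  then show ?thesis using g(2) by (intro exI[of _ "Bcontfun g"]) simp
qed

lemma (in schroedinger) lin_snd_scaleR: "lin_snd k (r *\<^sub>R d) = r *\<^sub>R lin_snd k d"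
  and lin_fst_scaleR: "lin_fst k (r *\<^sub>R d) = r *\<^sub>R lin_fst k d"
proof -
  show s: "lin_snd k (r *\<^sub>R d) = r *\<^sub>R lin_snd k d"
    unfolding lin_snd_def bounded_bilinear.scaleR_right[OF bounded_bilinear_cond_snd]
      bounded_bilinear.scaleR_right[OF bounded_bilinear_cond_fst] blinfun.scaleR_right
    by (simp only: blinfun.scaleR_right flip: scaleR_diff_right)
  show "lin_fst k (r *\<^sub>R d) = r *\<^sub>R lin_fst k d"
    unfolding lin_fst_def s bounded_bilinear.scaleR_right[OF bounded_bilinear_cond_fst] blinfun.scaleR_right
    by (simp only: scaleR_diff_right)
qed

section \<open>Derivatives, smoothness and coercivity of the objective\<close>

context clamped_eot
begin

lemma Phi_has_derivative:
  "(Phi \<epsilon> \<mu>0 \<mu>1 has_derivative (\<lambda>B. 64 * (A \<bullet> B) + \<epsilon> * pairing (dens (cst A)) (lin B))) (at A)"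
proof -
  have "((\<lambda>A. 32 * (A \<bullet> A) + \<epsilon> * dual_value (cst A)) has_derivative
      (\<lambda>B. 32 * (A \<bullet> B + B \<bullet> A) + \<epsilon> * pairing (dens (cst A)) (lin B))) (at A)"
    unfolding pairing_def
    by (intro has_derivative_add has_derivative_mult_right has_derivative_inner has_derivative_ident
        dual_value_cost_has_derivative[OF cst_has_derivative])
  then show ?thesis
    unfolding Phi_eq[abs_def] by (simp add: inner_commute algebra_simps)
qed

lemma smooth_Phi: "smooth (Phi \<epsilon> \<mu>0 \<mu>1)"
  unfolding smooth_def
proof
  fix k
  have "continuously_differentiable k (\<lambda>A. 32 * (A \<bullet> A) + \<epsilon> * dual_value (cst A))"
  proof (intro continuously_differentiable_add continuously_differentiable_bounded_linear[OF bounded_linear_mult_right]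
      continuously_differentiable_dual_value[OF cst_has_derivative]
      continuously_differentiable_bilinear[OF bounded_bilinear_inner])
    show "continuously_differentiable k (\<lambda>A :: real ^ 'n ^ 'm. A)"
    proof (cases k)
      case (Suc j)
      show ?thesis
        unfolding Suc
        by (rule continuously_differentiable_SucI[OF has_derivative_ident continuously_differentiable_const])
    qed simp
    then show "continuously_differentiable k (\<lambda>A :: real ^ 'n ^ 'm. A)" .
  qed
  then show "continuously_differentiable k (Phi \<epsilon> \<mu>0 \<mu>1)"
    unfolding Phi_eq[abs_def] .
qed

text \<open>The dual value is at least \<open>- norm (cst A)\<close>, which decreases at most
  linearly in \<open>norm A\<close>, so the quadratic term wins.\<close>

lemma coercive_Phi: "coercive (Phi \<epsilon> \<mu>0 \<mu>1)"
proof -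
  obtain K where K: "\<And>B. norm (lin B) \<le> norm B * K" "K \<ge> 0"
    using bounded_linear.nonneg_bounded[OF bounded_linear_lin] by blast
  define a where "a = norm (cst 0)"
  have lower: "Phi \<epsilon> \<mu>0 \<mu>1 A \<ge> norm A * (32 * norm A - \<epsilon> * K) - \<epsilon> * a" for A
  proof -
    have "norm (cst A) \<le> a + norm A * K"
      unfolding a_def cst_eq[of A] using K(1)[of A] by (intro norm_triangle_le add_left_mono)
    then have "dual_value (cst A) \<ge> - (a + norm A * K)" using dual_value_ge[of "cst A"] by linarith
    then have "\<epsilon> * dual_value (cst A) \<ge> \<epsilon> * - (a + norm A * K)"
      using eps by (intro mult_left_mono) auto
    then show ?thesis
      by (simp add: Phi_eq dot_square_norm power2_eq_square algebra_simps)
  qed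
  show ?thesis
    unfolding coercive_def filterlim_at_top eventually_at_infinity
  proof (intro allI)
    fix Z :: real
    \<comment> \<open>Beyond this radius \<open>norm A \<ge> 1\<close> and \<open>32 * norm A -
      \<epsilon> * K \<ge> \<bar>Z\<bar> + \<epsilon> * a\<close>, so their product exceeds
      \<open>Z + \<epsilon> * a\<close> or equals it.\<close>
    define b where "b = 1 + \<epsilon> * K + \<bar>Z\<bar> + \<epsilon> * a"
    have nn: "\<epsilon> * K \<ge> 0" "\<epsilon> * a \<ge> 0" using eps K(2) by (auto simp: a_def)
    show "\<exists>b. \<forall>A. b \<le> norm A \<longrightarrow> Z \<le> Phi \<epsilon> \<mu>0 \<mu>1 A"
    proof (intro exI[of _ b] allI impI)
      fix A :: "real ^ 'n ^ 'm" assume A: "b \<le> norm A"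
      have n: "1 \<le> norm A" "\<bar>Z\<bar> + \<epsilon> * a \<le> 32 * norm A - \<epsilon> * K"
        using A nn by (auto simp: b_def)
      have "1 * (\<bar>Z\<bar> + \<epsilon> * a) \<le> norm A * (32 * norm A - \<epsilon> * K)"
        using n nn by (intro mult_mono) auto
      then show "Z \<le> Phi \<epsilon> \<mu>0 \<mu>1 A" using lower[of A] abs_ge_self[of Z] unfolding mult_1 by linarith
    qed
  qed
qed

text \<open>\<open>lin\<close> is the derivative of the rescaled cost \<open>c / \<epsilon>\<close>, whereas \<open>(h0, h1)\<close> is minus the derivative
  of the unscaled potentials; this accounts for the factor \<open>- \<epsilon>\<close>.\<close>

definition rhs :: "real ^ 'n ^ 'm \<Rightarrow> ((real ^ 'm) \<times> (real ^ 'n)) \<Rightarrow>\<^sub>C real" where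
  "rhs C = (- \<epsilon>) *\<^sub>R lin C"

lemma apply_rhs [simp]: "rhs C z = 32 * (p (fst z) \<bullet> (C *v q (snd z)))"
  using eps by (simp add: rhs_def)

context
  fixes A \<phi>0 \<phi>1
  assumes pot: "EOT_potentials A \<epsilon> \<mu>0 \<mu>1 \<phi>0 \<phi>1"
begin

text \<open>Translates the integral over the support into operators. \<open>s\<close> stands for
  \<open>h0 x\<close>, which is constant in \<open>y\<close> and comes out because the kernel has
  mass one; \<open>v\<close> is any bounded continuous function that agrees with \<open>h\<close> on
  the support.\<close>

lemma linearized_integral_snd:
  fixes v :: "(real ^ 'n) \<Rightarrow>\<^sub>C real"
  assumes x: "x \<in> spt \<mu>0" and v: "\<And>y. y \<in> spt \<mu>1 \<Longrightarrow> v y = h y"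
  shows "(LINT y:spt \<mu>1|\<mu>1. (s + h y - 32 * (x \<bullet> (C *v y))) * EOT_kernel A \<epsilon> \<phi>0 \<phi>1 x y) =
    s + cond_fst (dens (cst A)) (bsnd v) x - cond_fst (dens (cst A)) (rhs C) x"
proof -
  define k where "k = dens (cst A)"
  define F where "F = bmult k (const_bcontfun s + bsnd v - rhs C)"
  have m: "(\<lambda>y. f (x, y)) \<in> borel_measurable \<mu>1" for f :: "((real ^ 'm) \<times> (real ^ 'n)) \<Rightarrow>\<^sub>C real"
    using m1.integrable_slice by (rule borel_measurable_integrable)
  have "(LINT y:spt \<mu>1|\<mu>1. (s + h y - 32 * (x \<bullet> (C *v y))) * EOT_kernel A \<epsilon> \<phi>0 \<phi>1 x y) =
      (\<integral>y. indicator (spt \<mu>1) y *\<^sub>R F (x, y) \<partial>\<mu>1)"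
    unfolding set_lebesgue_integral_def
  proof (intro Bochner_Integration.integral_cong refl)
    fix y
    show "indicator (spt \<mu>1) y *\<^sub>R ((s + h y - 32 * (x \<bullet> (C *v y))) * EOT_kernel A \<epsilon> \<phi>0 \<phi>1 x y) =
        indicator (spt \<mu>1) y *\<^sub>R F (x, y)"
      using v[of y] potentials_clamped(1)[OF pot x, of y] p(3)[OF x] q(3)[of y]
      by (cases "y \<in> spt \<mu>1") (simp_all add: F_def k_def)
  qed
  also have "\<dots> = (\<integral>y. F (x, y) \<partial>\<mu>1)"
  proof (rule integral_cong_AE)
    show "AE y in \<mu>1. indicator (spt \<mu>1) y *\<^sub>R F (x, y) = F (x, y)"
      using AE_spt[OF m1.sets_eq] by eventually_elim simp
    have "spt \<mu>1 \<in> sets \<mu>1" using closed_spt[of \<mu>1] by (simp add: borel_closed)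
    then show "(\<lambda>y. indicator (spt \<mu>1) y *\<^sub>R F (x, y)) \<in> borel_measurable \<mu>1"
      using m[of F] by (intro borel_measurable_scaleR borel_measurable_indicator)
  qed (rule m)
  also have "\<dots> = cond_fst k (const_bcontfun s + bsnd v - rhs C) x"
    by (simp add: F_def apply_cond_fst)
  also have "\<dots> = s + cond_fst k (bsnd v) x - cond_fst k (rhs C) x"
    unfolding bounded_bilinear.diff_right[OF bounded_bilinear_cond_fst]
      bounded_bilinear.add_right[OF bounded_bilinear_cond_fst]
    by (simp add: k_def cond_fst_const[OF markov_dens])
  finally show ?thesis by (simp add: k_def)
qed

lemma linearized_integral_fst:
  fixes u :: "(real ^ 'm) \<Rightarrow>\<^sub>C real"
  assumes y: "y \<in> spt \<mu>1" and u: "\<And>x. x \<in> spt \<mu>0 \<Longrightarrow> u x = h x"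
  shows "(LINT x:spt \<mu>0|\<mu>0. (h x + s - 32 * (x \<bullet> (C *v y))) * EOT_kernel A \<epsilon> \<phi>0 \<phi>1 x y) =
    s + cond_snd (dens (cst A)) (bfst u) y - cond_snd (dens (cst A)) (rhs C) y"
proof -
  define k where "k = dens (cst A)"
  define F where "F = bmult k (const_bcontfun s + bfst u - rhs C)"
  have m: "(\<lambda>x. f (x, y)) \<in> borel_measurable \<mu>0" for f :: "((real ^ 'm) \<times> (real ^ 'n)) \<Rightarrow>\<^sub>C real"
    using m0.integrable_slice[of "bswap f" y] by (auto dest: borel_measurable_integrable)
  have "(LINT x:spt \<mu>0|\<mu>0. (h x + s - 32 * (x \<bullet> (C *v y))) * EOT_kernel A \<epsilon> \<phi>0 \<phi>1 x y) =
      (\<integral>x. indicator (spt \<mu>0) x *\<^sub>R F (x, y) \<partial>\<mu>0)"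
    unfolding set_lebesgue_integral_def
  proof (intro Bochner_Integration.integral_cong refl)
    fix x
    show "indicator (spt \<mu>0) x *\<^sub>R ((h x + s - 32 * (x \<bullet> (C *v y))) * EOT_kernel A \<epsilon> \<phi>0 \<phi>1 x y) =
        indicator (spt \<mu>0) x *\<^sub>R F (x, y)"
      using u[of x] potentials_clamped(1)[OF pot, of x y] p(3)[of x] q(3)[OF y] y
      by (cases "x \<in> spt \<mu>0") (simp_all add: F_def k_def)
  qed
  also have "\<dots> = (\<integral>x. F (x, y) \<partial>\<mu>0)"
  proof (rule integral_cong_AE)
    show "AE x in \<mu>0. indicator (spt \<mu>0) x *\<^sub>R F (x, y) = F (x, y)"
      using AE_spt[OF m0.sets_eq] by eventually_elim simp
    have "spt \<mu>0 \<in> sets \<mu>0" using closed_spt[of \<mu>0] by (simp add: borel_closed)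
    then show "(\<lambda>x. indicator (spt \<mu>0) x *\<^sub>R F (x, y)) \<in> borel_measurable \<mu>0"
      using m[of F] by (intro borel_measurable_scaleR borel_measurable_indicator)
  qed (rule m)
  also have "\<dots> = cond_snd k (const_bcontfun s + bfst u - rhs C) y"
    by (simp add: F_def apply_cond_snd)
  also have "\<dots> = s + cond_snd k (bfst u) y - cond_snd k (rhs C) y"
    unfolding bounded_bilinear.diff_right[OF bounded_bilinear_cond_snd]
      bounded_bilinear.add_right[OF bounded_bilinear_cond_snd]
    by (simp add: k_def cond_snd_const[OF markov_dens])
  finally show ?thesis by (simp add: k_def)
qed

text \<open>The equations given on the supports must become operator equations on the whole space
  before uniqueness can be applied. Only \<open>g1\<close> is extended by Tietze; global functions
  \<open>u\<close> and \<open>v\<close> are then defined by the equations themselves, and the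
  hypotheses say that they agree with \<open>g0\<close> and \<open>g1\<close> on the
  supports.\<close>

lemma linearized_system_iff:
  "linearized_system A \<epsilon> \<mu>0 \<mu>1 \<phi>0 \<phi>1 C g0 g1 \<longleftrightarrow>
    (\<exists>a. (\<forall>x\<in>spt \<mu>0. g0 x = lin_fst (dens (cst A)) (rhs C) x + a) \<and>
      (\<forall>y\<in>spt \<mu>1. g1 y = lin_snd (dens (cst A)) (rhs C) y - a))" (is "?L \<longleftrightarrow> ?R")
proof
  define k where "k = dens (cst A)"
  have k: "markov k" by (simp add: k_def markov_dens)
  assume L: ?L
  then have c1: "continuous_on (spt \<mu>1) g1"
    and e0: "\<And>x. x \<in> spt \<mu>0 \<Longrightarrow> (LINT y:spt \<mu>1|\<mu>1. (g0 x + g1 y - 32 * (x \<bullet> (C *v y))) * EOT_kernel A \<epsilon> \<phi>0 \<phi>1 x y) = 0"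
    and e1: "\<And>y. y \<in> spt \<mu>1 \<Longrightarrow> (LINT x:spt \<mu>0|\<mu>0. (g0 x + g1 y - 32 * (x \<bullet> (C *v y))) * EOT_kernel A \<epsilon> \<phi>0 \<phi>1 x y) = 0"
    by (auto simp: linearized_system_def)
  obtain w :: "(real ^ 'n) \<Rightarrow>\<^sub>C real" where w: "\<And>y. y \<in> spt \<mu>1 \<Longrightarrow> w y = g1 y"
    using compact_continuous_extension_bcontfun[OF compact_spt(2) c1] by blast
  define u where "u = cond_fst k (rhs C) - cond_fst k (bsnd w)"
  have u: "u x = g0 x" if "x \<in> spt \<mu>0" for x
    using e0[OF that] linearized_integral_snd[OF that w, of "g0 x" C] by (simp add: u_def k_def)
  define v where "v = cond_snd k (rhs C) - cond_snd k (bfst u)"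
  have v: "v y = g1 y" if "y \<in> spt \<mu>1" for y
    using e1[OF that] linearized_integral_fst[OF that u, of "g1 y" C] by (simp add: v_def k_def)
  \<comment> \<open>\<open>v\<close> replaces the arbitrary extension \<open>w\<close>: they agree
    on the support, and the integral defining \<open>P\<close> sees nothing else.\<close>
  have "cond_fst k (bsnd v) = cond_fst k (bsnd w)"
  proof (rule bcontfun_eqI)
    fix x
    have m: "(\<lambda>y. k (x, y) * f y) \<in> borel_measurable \<mu>1" for f :: "(real ^ 'n) \<Rightarrow>\<^sub>C real"
      using m1.integrable_slice[of "bmult k (bsnd f)" x] by (auto dest: borel_measurable_integrable)
    have "(\<integral>y. k (x, y) * v y \<partial>\<mu>1) = (\<integral>y. k (x, y) * w y \<partial>\<mu>1)"
    proof (rule integral_cong_AE[OF m m])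
      show "AE y in \<mu>1. k (x, y) * v y = k (x, y) * w y"
        using AE_spt[OF m1.sets_eq] by eventually_elim (simp add: v w)
    qed
    then show "cond_fst k (bsnd v) x = cond_fst k (bsnd w) x" by (simp add: apply_cond_fst)
  qed
  then have "u + cond_fst k (bsnd v) = cond_fst k (rhs C)" by (simp add: u_def)
  moreover have "v + cond_snd k (bfst u) = cond_snd k (rhs C)" by (simp add: v_def)
  ultimately obtain a where a: "u = lin_fst k (rhs C) + const_bcontfun a" "v = lin_snd k (rhs C) - const_bcontfun a"
    by (rule linearized_solution_unique[OF k])
  show ?R
  proof (intro exI[of _ a] conjI ballI)
    show "g0 x = lin_fst (dens (cst A)) (rhs C) x + a" if "x \<in> spt \<mu>0" for x
      unfolding u[OF that, symmetric] a(1) by (simp add: k_def)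
    show "g1 y = lin_snd (dens (cst A)) (rhs C) y - a" if "y \<in> spt \<mu>1" for y
      unfolding v[OF that, symmetric] a(2) by (simp add: k_def)
  qed
next
  define k where "k = dens (cst A)"
  have k: "markov k" by (simp add: k_def markov_dens)
  assume ?R
  then obtain a where a: "\<And>x. x \<in> spt \<mu>0 \<Longrightarrow> g0 x = (lin_fst k (rhs C) + const_bcontfun a) x"
    "\<And>y. y \<in> spt \<mu>1 \<Longrightarrow> g1 y = (lin_snd k (rhs C) - const_bcontfun a) y"
    by (auto simp: k_def)
  define u where "u = lin_fst k (rhs C) + const_bcontfun a"
  define v where "v = lin_snd k (rhs C) - const_bcontfun a"
  have u: "u x = g0 x" if "x \<in> spt \<mu>0" for x using a(1)[OF that] by (simp add: u_def)
  have v: "v y = g1 y" if "y \<in> spt \<mu>1" for y using a(2)[OF that] by (simp add: v_def)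
  have "cond_fst k (bsnd v) = cond_fst k (bsnd (lin_snd k (rhs C))) - const_bcontfun a"
    unfolding v_def bsnd_diff bounded_bilinear.diff_right[OF bounded_bilinear_cond_fst]
    by (simp add: bsnd_const cond_fst_const[OF k])
  then have eu: "u + cond_fst k (bsnd v) = cond_fst k (rhs C)"
    using linearized_solution(1)[OF k, of "rhs C"] by (simp add: u_def)
  have "(bfst u :: ((real ^ 'm) \<times> (real ^ 'n)) \<Rightarrow>\<^sub>C real) = bfst (lin_fst k (rhs C)) + bfst (const_bcontfun a)"
    by (auto intro!: bcontfun_eqI simp: u_def)
  then have "cond_snd k (bfst u) = cond_snd k (bfst (lin_fst k (rhs C))) + const_bcontfun a"
    by (simp add: bounded_bilinear.add_right[OF bounded_bilinear_cond_snd] bfst_const cond_snd_const[OF k])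
  then have ev: "v + cond_snd k (bfst u) = cond_snd k (rhs C)"
    using linearized_solution(2)[OF k, of "rhs C"] by (simp add: v_def)
  show ?L
    unfolding linearized_system_def
  proof (intro conjI ballI)
    show "continuous_on (spt \<mu>0) g0"
      by (rule continuous_on_eq[OF continuous_on_apply_bcontfun[of _ u] u])
    show "continuous_on (spt \<mu>1) g1"
      by (rule continuous_on_eq[OF continuous_on_apply_bcontfun[of _ v] v])
    show "(LINT y:spt \<mu>1|\<mu>1. (g0 x + g1 y - 32 * (x \<bullet> (C *v y))) * EOT_kernel A \<epsilon> \<phi>0 \<phi>1 x y) = 0"
      if x: "x \<in> spt \<mu>0" for x
    proof -
      have "(u + cond_fst k (bsnd v)) x = cond_fst k (rhs C) x" by (simp only: eu)
      then show ?thesis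
        using linearized_integral_snd[OF x v, of "g0 x" C] u[OF x] by (simp add: k_def)
    qed
    show "(LINT x:spt \<mu>0|\<mu>0. (g0 x + g1 y - 32 * (x \<bullet> (C *v y))) * EOT_kernel A \<epsilon> \<phi>0 \<phi>1 x y) = 0"
      if y: "y \<in> spt \<mu>1" for y
    proof -
      have "(v + cond_snd k (bfst u)) y = cond_snd k (rhs C) y" by (simp only: ev)
      then show ?thesis
        using linearized_integral_fst[OF y u, of "g1 y" C] v[OF y] by (simp add: k_def)
    qed
  qed
qed

lemma ex_linearized_system:
  "\<exists>h0 h1. \<forall>g0 g1. linearized_system A \<epsilon> \<mu>0 \<mu>1 \<phi>0 \<phi>1 C g0 g1 \<longleftrightarrow>
    (\<exists>a. (\<forall>x\<in>spt \<mu>0. g0 x = h0 x + a) \<and> (\<forall>y\<in>spt \<mu>1. g1 y = h1 y - a))"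
  unfolding linearized_system_iff by blast

text \<open>On the supports the bracket equals \<open>- \<epsilon> * H\<close>, the free constant
  \<open>a\<close> cancelling in the sum, and the bilinear form is
  \<open>- (\<epsilon> / 32) * lin B\<close>. The product carries
  \<open>\<epsilon> * \<epsilon> / 32\<close>, which the prefactor
  \<open>32 * inverse \<epsilon>\<close> turns into \<open>\<epsilon>\<close>.\<close>

lemma optimal_coupling_second_integral:
  assumes \<pi>: "optimal_coupling A \<epsilon> \<mu>0 \<mu>1 \<pi>" and h: "linearized_system A \<epsilon> \<mu>0 \<mu>1 \<phi>0 \<phi>1 C h0 h1"
  shows "32 * inverse \<epsilon> * (LINT z:spt \<mu>0 \<times> spt \<mu>1|\<pi>. (fst z \<bullet> (B *v snd z)) * (h0 (fst z) + h1 (snd z) - 32 * (fst z \<bullet> (C *v snd z)))) =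
    \<epsilon> * pairing (dens_deriv (dens (cst A)) (lin C)) (lin B)"
proof -
  define k where "k = dens (cst A)"
  define H where "H = bfst (lin_fst k (lin C)) + bsnd (lin_snd k (lin C)) - lin C"
  have fst_rhs: "lin_fst k (rhs C) = (- \<epsilon>) *\<^sub>R lin_fst k (lin C)"
    and snd_rhs: "lin_snd k (rhs C) = (- \<epsilon>) *\<^sub>R lin_snd k (lin C)"
    unfolding rhs_def by (rule lin_fst_scaleR lin_snd_scaleR)+
  obtain a where a: "\<And>x. x \<in> spt \<mu>0 \<Longrightarrow> h0 x = lin_fst k (rhs C) x + a"
    "\<And>y. y \<in> spt \<mu>1 \<Longrightarrow> h1 y = lin_snd k (rhs C) y - a"
    using h unfolding linearized_system_iff k_def by blast
  define F where "F = bmult H (lin B)"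
  have pt: "(fst z \<bullet> (B *v snd z)) * (h0 (fst z) + h1 (snd z) - 32 * (fst z \<bullet> (C *v snd z))) = (\<epsilon> * \<epsilon> / 32) * F z"
    if z: "z \<in> spt \<mu>0 \<times> spt \<mu>1" for z
  proof -
    have "h0 (fst z) + h1 (snd z) - 32 * (fst z \<bullet> (C *v snd z)) = - \<epsilon> * H z"
      using z eps a(1)[of "fst z"] a(2)[of "snd z"] p(3)[of "fst z"] q(3)[of "snd z"]
      by (auto simp: H_def fst_rhs snd_rhs algebra_simps)
    moreover have "fst z \<bullet> (B *v snd z) = - (\<epsilon> / 32) * lin B z"
      using z eps p(3)[of "fst z"] q(3)[of "snd z"] by auto
    ultimately show ?thesis by (simp only: F_def apply_bmult) (simp add: algebra_simps)
  qed
  have "(LINT z:spt \<mu>0 \<times> spt \<mu>1|\<pi>. (fst z \<bullet> (B *v snd z)) * (h0 (fst z) + h1 (snd z) - 32 * (fst z \<bullet> (C *v snd z)))) =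
      (\<integral>z. indicator (spt \<mu>0 \<times> spt \<mu>1) z *\<^sub>R ((\<epsilon> * \<epsilon> / 32) * F z) \<partial>\<pi>)"
    unfolding set_lebesgue_integral_def
    by (intro Bochner_Integration.integral_cong refl) (metis pt indicator_simps(2) scaleR_zero_left)
  also have "\<dots> = (\<integral>z. (\<epsilon> * \<epsilon> / 32) * F z \<partial>\<pi>)"
  proof (rule integral_cong_AE)
    show "AE z in \<pi>. indicator (spt \<mu>0 \<times> spt \<mu>1) z *\<^sub>R ((\<epsilon> * \<epsilon> / 32) * F z) = (\<epsilon> * \<epsilon> / 32) * F z"
      using optimal_coupling_integral(1)[OF \<pi>] by eventually_elim simp
    have S: "spt \<mu>0 \<times> spt \<mu>1 \<in> sets \<pi>"
      unfolding optimal_coupling_integral(2)[OF \<pi>] by (intro borel_closed closed_Times closed_spt)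
    have "apply_bcontfun F \<in> borel_measurable \<pi>"
      unfolding measurable_cong_sets[OF optimal_coupling_integral(2)[OF \<pi>] refl] by (rule borel_measurable_bcontfun)
    then show F: "(\<lambda>z. (\<epsilon> * \<epsilon> / 32) * F z) \<in> borel_measurable \<pi>"
      by (intro borel_measurable_times borel_measurable_const)
    show "(\<lambda>z. indicator (spt \<mu>0 \<times> spt \<mu>1) z *\<^sub>R ((\<epsilon> * \<epsilon> / 32) * F z)) \<in> borel_measurable \<pi>"
      by (intro borel_measurable_scaleR borel_measurable_indicator S F)
  qed
  also have "\<dots> = (\<epsilon> * \<epsilon> / 32) * (\<integral>z. F z \<partial>\<pi>)" by simp
  also have "(\<integral>z. F z \<partial>\<pi>) = pairing k F"
    unfolding k_def by (rule optimal_coupling_integral(3)[OF \<pi>])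
  also have "\<dots> = pairing (bmult k H) (lin B)"
    by (simp only: pairing_def F_def apply_bmult mult.assoc)
  finally show ?thesis using eps by (simp add: k_def H_def field_simps)
qed

end

lemma Phi_derivative:
  assumes \<pi>: "optimal_coupling A \<epsilon> \<mu>0 \<mu>1 \<pi>"
  shows "(Phi \<epsilon> \<mu>0 \<mu>1 has_derivative
    (\<lambda>B. 64 * trace (transpose A ** B) - 32 * (\<integral>z. fst z \<bullet> (B *v snd z) \<partial>\<pi>))) (at A)"
proof -
  have "\<epsilon> * pairing (dens (cst A)) (lin B) = - 32 * (\<integral>z. fst z \<bullet> (B *v snd z) \<partial>\<pi>)" for B
  proof -
    have "(\<integral>z. fst z \<bullet> (B *v snd z) \<partial>\<pi>) = (\<integral>z. - (\<epsilon> / 32) * lin B z \<partial>\<pi>)"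
    proof (rule integral_cong_AE)
      show "AE z in \<pi>. fst z \<bullet> (B *v snd z) = - (\<epsilon> / 32) * lin B z"
        using optimal_coupling_integral(1)[OF \<pi>] by eventually_elim (use eps p(3) q(3) in auto)
      show "(\<lambda>z. - (\<epsilon> / 32) * lin B z) \<in> borel_measurable \<pi>"
        unfolding measurable_cong_sets[OF optimal_coupling_integral(2)[OF \<pi>] refl]
        by (intro borel_measurable_times borel_measurable_const borel_measurable_bcontfun)
      show "(\<lambda>z. fst z \<bullet> (B *v snd z)) \<in> borel_measurable \<pi>"
        unfolding measurable_cong_sets[OF optimal_coupling_integral(2)[OF \<pi>] refl]
        by (intro borel_measurable_continuous_onI continuous_intros
            bounded_linear.continuous_on[OF matrix_vector_mul_bounded_linear])
    qed
    also have "\<dots> = - (\<epsilon> / 32) * (\<integral>z. lin B z \<partial>\<pi>)" by (rule integral_mult_right_zero)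
    also have "(\<integral>z. lin B z \<partial>\<pi>) = pairing (dens (cst A)) (lin B)"
      by (rule optimal_coupling_integral(3)[OF \<pi>])
    finally show ?thesis by simp
  qed
  then show ?thesis
    using Phi_has_derivative[of A] by (simp add: trace_transpose_mult)
qed

text \<open>The operator-valued gradient \<open>D\<close> depends on the matrix linearly and through
  the density. Differentiating it in direction \<open>C\<close> changes the density by
  \<open>dens_deriv\<close>, while \<open>B\<close> remains the argument of the gradient.\<close>

lemma Phi_second_derivative:
  assumes f'': "\<And>B C. f'' B C = 64 * (B \<bullet> C) + \<epsilon> * pairing (dens_deriv (dens (cst A)) (lin C)) (lin B)"
  shows "has_second_derivative (Phi \<epsilon> \<mu>0 \<mu>1) f'' A"
  unfolding has_second_derivative_def
proof (intro exI conjI allI)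
  define G where "G k = Blinfun (\<lambda>B. pairing k (lin B))" for k
  define D where "D A = 64 *\<^sub>R blinfun_inner_right A + \<epsilon> *\<^sub>R G (dens (cst A))" for A
  define D2 where "D2 C = 64 *\<^sub>R blinfun_inner_right C + \<epsilon> *\<^sub>R G (dens_deriv (dens (cst A)) (lin C))" for C
  have G: "G k B = pairing k (lin B)" for k B
    unfolding G_def by (rule blinfun_apply_pairing[OF cst_has_derivative])
  have "blinfun_apply (D u) = (\<lambda>B. 64 * (u \<bullet> B) + \<epsilon> * pairing (dens (cst u)) (lin B))" for u
    by (auto simp: D_def plus_blinfun.rep_eq scaleR_blinfun.rep_eq G)
  then show "\<forall>\<^sub>F u in nhds A. (Phi \<epsilon> \<mu>0 \<mu>1 has_derivative blinfun_apply (D u)) (at u)"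
    using Phi_has_derivative by (intro always_eventually) simp
  show "(D has_derivative D2) (at A)"
    unfolding D_def[abs_def] D2_def[abs_def] G_def
    by (intro has_derivative_add has_derivative_scaleR_right bounded_linear_imp_has_derivative
        bounded_linear_blinfun_inner_right dual_value_gradient_has_derivative[OF cst_has_derivative])
  show "f'' v w = blinfun_apply (D2 w) v" for v w
    by (simp add: f'' D2_def plus_blinfun.rep_eq scaleR_blinfun.rep_eq G inner_commute)
qed

end

theorem proposition2:
  fixes \<mu>0 :: "(real ^ 'm) measure" and \<mu>1 :: "(real ^ 'n) measure" and \<epsilon> :: real
  assumes "compactly_supported_prob \<mu>0" and "compactly_supported_prob \<mu>1" and "\<epsilon> > 0"
  shows
    "(\<forall>A. \<bar>OT A \<epsilon> \<mu>0 \<mu>1\<bar> \<noteq> \<infinity>) \<and>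
     smooth (Phi \<epsilon> \<mu>0 \<mu>1) \<and>
     coercive (Phi \<epsilon> \<mu>0 \<mu>1) \<and>
     (\<forall>A.
        (\<exists>!\<pi>. optimal_coupling A \<epsilon> \<mu>0 \<mu>1 \<pi>) \<and>
        (\<exists>\<phi>0 \<phi>1. EOT_potentials A \<epsilon> \<mu>0 \<mu>1 \<phi>0 \<phi>1) \<and>
        (\<forall>\<pi>. optimal_coupling A \<epsilon> \<mu>0 \<mu>1 \<pi> \<longrightarrow>
           (Phi \<epsilon> \<mu>0 \<mu>1 has_derivative
              (\<lambda>B. 64 * trace (transpose A ** B)
                    - 32 * (\<integral>z. fst z \<bullet> (B *v snd z) \<partial>\<pi>))) (at A) \<and>
           (\<forall>\<phi>0 \<phi>1. EOT_potentials A \<epsilon> \<mu>0 \<mu>1 \<phi>0 \<phi>1 \<longrightarrow>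
              (\<forall>C. \<exists>h0 h1. \<forall>g0 g1.
                 linearized_system A \<epsilon> \<mu>0 \<mu>1 \<phi>0 \<phi>1 C g0 g1 \<longleftrightarrow>
                 (\<exists>a. (\<forall>x\<in>spt \<mu>0. g0 x = h0 x + a) \<and> (\<forall>y\<in>spt \<mu>1. g1 y = h1 y - a))) \<and>
              (\<forall>h0 h1. (\<forall>C. linearized_system A \<epsilon> \<mu>0 \<mu>1 \<phi>0 \<phi>1 C (h0 C) (h1 C)) \<longrightarrow>
                 has_second_derivative (Phi \<epsilon> \<mu>0 \<mu>1)
                   (\<lambda>B C. 64 * trace (transpose B ** C)
                      + 32 * inverse \<epsilon> * (LINT z:spt \<mu>0 \<times> spt \<mu>1|\<pi>.
                          (fst z \<bullet> (B *v snd z))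
                          * (h0 C (fst z) + h1 C (snd z) - 32 * (fst z \<bullet> (C *v snd z)))))
                   A))))"
proof -
  have "bounded (spt \<mu>0)" "bounded (spt \<mu>1)"
    using assms by (auto simp: compactly_supported_prob_def compact_imp_bounded)
  then obtain r0 r1 where r: "\<And>x. x \<in> spt \<mu>0 \<Longrightarrow> norm x \<le> r0" "\<And>y. y \<in> spt \<mu>1 \<Longrightarrow> norm y \<le> r1"
    unfolding bounded_iff by blast
  \<comment> \<open>The \<open>0\<close> makes the ball nonempty. Projection onto this closed convex
    set is continuous and fixes its points, hence both supports.\<close>
  define r where "r = max 0 (max r0 r1)"
  define p :: "real ^ 'm \<Rightarrow> real ^ 'm" where "p = closest_point (cball 0 r)"
  define q :: "real ^ 'n \<Rightarrow> real ^ 'n" where "q = closest_point (cball 0 r)"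
  have ne: "cball 0 r \<noteq> ({} :: 'x::real_normed_vector set)" by (simp add: r_def)
  have norm_closest: "norm (closest_point (cball 0 r) x) \<le> r" for x :: "'x::euclidean_space"
    using closest_point_in_set[of "cball 0 r" x] ne by simp
  interpret clamped_eot \<mu>0 \<mu>1 \<epsilon> p q r
  proof
    show "continuous_on UNIV p" "continuous_on UNIV q"
      unfolding p_def q_def using ne by (auto intro!: continuous_on_closest_point)
    show "norm (p x) \<le> r" "norm (q y) \<le> r" for x y
      unfolding p_def q_def by (rule norm_closest)+
    show "p x = x" if "x \<in> spt \<mu>0" for x
      using r(1)[OF that] by (simp add: p_def r_def closest_point_self)
    show "q y = y" if "y \<in> spt \<mu>1" for y
      using r(2)[OF that] by (simp add: q_def r_def closest_point_self)
  qed (fact assms)+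
  have "has_second_derivative (Phi \<epsilon> \<mu>0 \<mu>1)
      (\<lambda>B C. 64 * trace (transpose B ** C)
        + 32 * inverse \<epsilon> * (LINT z:spt \<mu>0 \<times> spt \<mu>1|\<pi>. (fst z \<bullet> (B *v snd z))
            * (h0 C (fst z) + h1 C (snd z) - 32 * (fst z \<bullet> (C *v snd z))))) A"
    if "optimal_coupling A \<epsilon> \<mu>0 \<mu>1 \<pi>" "EOT_potentials A \<epsilon> \<mu>0 \<mu>1 \<phi>0 \<phi>1"
      "\<forall>C. linearized_system A \<epsilon> \<mu>0 \<mu>1 \<phi>0 \<phi>1 C (h0 C) (h1 C)" for A \<pi> \<phi>0 \<phi>1 h0 h1
    by (rule Phi_second_derivative)
      (simp only: trace_transpose_mult optimal_coupling_second_integral[OF that(2,1) that(3)[rule_format]])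
  then show ?thesis
    using smooth_Phi coercive_Phi ex1_optimal_coupling ex_potentials Phi_derivative ex_linearized_system
    by (simp add: OT_dual)
qed

end
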